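(* Let $M$ be an oriented conformal (or pseudo-Riemannian) 4-manifold and $V$ a vector bundle over $M$ with a connection $D$ whose curvature is $F$. If $D$ is anti-self-dual ($F_+=0$), then the complex $$\mathcal E^0(V)\xrightarrow{\ d^D\ }\mathcal E^1(V)\xrightarrow{\ 2\delta^D_+d^D_+\ }\mathcal E_1(V)\xrightarrow{\ \delta^D\ }\mathcal E_0(V)$$ coincides with the Yang-Mills detour complex $$\mathcal E^0(V)\xrightarrow{\ d^D\ }\mathcal E^1(V)\xrightarrow{\ M^D\ }\mathcal E_1(V)\xrightarrow{\ \delta^D\ }\mathcal E_0(V),$$ i.e. $M^D=2\delta^D_+d^D_+$. If $D$ is self-dual ($F_-=0$), then the complex $$\mathcal E^0(V)\xrightarrow{\ d^D\ }\mathcal E^1(V)\xrightarrow{\ 2\delta^D_-d^D_-\ }\mathcal E_1(V)\xrightarrow{\ \delta^D\ }\mathcal E_0(V)$$ coincides with the Yang-Mills detour complex, i.e. $M^D=2\delta^D_-d^D_-$.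
   Context: $E[w]$ is the conformal density line bundle of weight $w$ (associated to the $\mathbb R_+$-bundle of metrics in the conformal class via $x\mapsto x^{-w/2}$). With $n=4$, $\mathcal E^k(V)$ denotes smooth sections of $\wedge^kT^*M\otimes V$ and $\mathcal E_k(V)$ smooth sections of $\wedge^kT^*M\otimes E[2k-4]\otimes V$; they are identified when a metric is fixed. $d^D$ is the connection-coupled exterior derivative; $\delta^D:\mathcal E_{k+1}(V)\to\mathcal E_k(V)$ is the formal adjoint of $d^D:\mathcal E^k(V^* )\to\mathcal E^{k+1}(V^* )$. $M^D:\mathcal E^1(V)\to\mathcal E_1(V)$ is $M^D\phi=\delta^Dd^D\phi-F\cdot\phi$, where $(F\cdot\phi)_a=F_a{}^b\phi_b$ (with the $\operatorname{End}(V)$-action implicit, and $F_{ab}=D_aD_b-D_bD_a$ on sections of $V$). $\star$ is the Hodge star on $E^2=\wedge^2T^*M$. $E^2_\pm$ denote the $\pm1$ eigenspaces of $\star$, except in Minkowskian signature, where they denote the $\pm i$ eigenspaces (forms complexified). $E^2=E^2_+\oplus E^2_-$ is an orthogonal decomposition, and $F_\pm$ are the components of $F$ in $\mathcal E^2_\pm(\operatorname{End}(V))$. For $U=V$ or $V^*$, $d^D_\pm:\mathcal E^1(U)\to\mathcal E^2_\pm(U)$ is $d^D$ followed by the projection onto $\mathcal E^2_\pm(U)$; $\delta^D_\pm:\mathcal E^2_\pm(V)\to\mathcal E_1(V)$ is the formal adjoint of $d^D_\pm:\mathcal E^1(V^* )\to\mathcal E^2_\pm(V^* )$. *)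

theory Defs
  imports "HOL-Analysis.Analysis"
begin

text \<open>
  Manifolds and vector bundles are given by coordinate data.  One index type labels charts
  \<open>x\<^sub>i : U\<^sub>i \<rightarrow> \<real>\<^sup>4\<close> which also carry a local frame of the bundle; every vector bundle on a
  manifold has such an atlas.  A tensor field is the family of its component functions, the
  \<open>i\<close>-th being a function of the \<open>i\<close>-th coordinates, subject to the tensorial transformation
  law.  Component functions matter only on the coordinate domains \<open>x\<^sub>i(U\<^sub>i)\<close>, so that equality of
  sections means agreement there.
\<close>

section \<open>Smooth functions on open subsets of \<open>\<real>\<^sup>4\<close>\<close>

definition pd :: "4 \<Rightarrow> (real^4 \<Rightarrow> 'a::real_normed_vector) \<Rightarrow> real^4 \<Rightarrow> 'a" where
  "pd a f y = frechet_derivative f (at y) (axis a 1)"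

primrec Ck_on :: "nat \<Rightarrow> (real^4) set \<Rightarrow> (real^4 \<Rightarrow> 'a::real_normed_vector) \<Rightarrow> bool" where
  "Ck_on 0 S f \<longleftrightarrow> continuous_on S f"
| "Ck_on (Suc n) S f \<longleftrightarrow> f differentiable_on S \<and> (\<forall>a. Ck_on n S (pd a f))"

definition smooth_on :: "(real^4) set \<Rightarrow> (real^4 \<Rightarrow> 'a::real_normed_vector) \<Rightarrow> bool" where
  "smooth_on S f \<longleftrightarrow> (\<forall>n. Ck_on n S f)"

section \<open>Oriented 4-manifolds\<close>

record ('m, 'i) mfd =
  mtop :: "'m topology"
  dom :: "'i \<Rightarrow> 'm set"
  crd :: "'i \<Rightarrow> 'm \<Rightarrow> real^4"

definition cdom :: "('m, 'i) mfd \<Rightarrow> 'i \<Rightarrow> (real^4) set" where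
  "cdom N i = crd N i ` dom N i"

definition chart_inv :: "('m, 'i) mfd \<Rightarrow> 'i \<Rightarrow> real^4 \<Rightarrow> 'm" where
  "chart_inv N i = inv_into (dom N i) (crd N i)"

text \<open>\<open>jac N i j p $ b $ a\<close> is \<open>\<partial>x\<^sub>j\<^sup>b / \<partial>x\<^sub>i\<^sup>a\<close> at \<open>p\<close>.\<close>

definition jac :: "('m, 'i) mfd \<Rightarrow> 'i \<Rightarrow> 'i \<Rightarrow> 'm \<Rightarrow> real^4^4" where
  "jac N i j p = (\<chi> b a. pd a (\<lambda>y. crd N j (chart_inv N i y)) (crd N i p) $ b)"

definition oriented_manifold :: "('m, 'i) mfd \<Rightarrow> bool" where
  "oriented_manifold N \<longleftrightarrow>
     Hausdorff_space (mtop N) \<and> second_countable (mtop N) \<and>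
     (\<Union>i. dom N i) = topspace (mtop N) \<and>
     (\<forall>i. openin (mtop N) (dom N i) \<and> open (cdom N i) \<and>
          homeomorphic_map (subtopology (mtop N) (dom N i)) (top_of_set (cdom N i)) (crd N i)) \<and>
     (\<forall>i j. smooth_on (crd N i ` (dom N i \<inter> dom N j)) (\<lambda>y. crd N j (chart_inv N i y))) \<and>
     (\<forall>i j. \<forall>p \<in> dom N i \<inter> dom N j. det (jac N i j p) > 0)"

section \<open>Vector bundles with connection\<close>

text \<open>
  The scalars are \<open>K = \<real>\<close> or \<open>K = \<complex>\<close>; a real bundle is stored by complex matrices with real
  entries, so that its complexification has the same data with \<open>K = \<complex>\<close>.
  Fibre components transform by \<open>v\<^sub>i = \<tau>\<^sub>i\<^sub>j v\<^sub>j\<close>, and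
  \<open>D\<^sub>a s = \<partial>\<^sub>a s + A\<^sub>a s\<close> in each chart and frame.
\<close>

record ('m, 'i, 'r) vbundle =
  trans :: "'i \<Rightarrow> 'i \<Rightarrow> 'm \<Rightarrow> complex^'r^'r"
  conn :: "'i \<Rightarrow> real^4 \<Rightarrow> (complex^'r^'r)^4"

definition bundle_with_connection ::
    "('m, 'i) mfd \<Rightarrow> complex set \<Rightarrow> ('m, 'i, 'r::finite) vbundle \<Rightarrow> bool" where
  "bundle_with_connection N K V \<longleftrightarrow>
     (\<forall>i. \<forall>p \<in> dom N i. trans V i i p = mat 1) \<and>
     (\<forall>i j k. \<forall>p \<in> dom N i \<inter> dom N j \<inter> dom N k.
         trans V i j p ** trans V j k p = trans V i k p) \<and>
     (\<forall>i j. \<forall>p \<in> dom N i \<inter> dom N j. \<forall>s t. trans V i j p $ s $ t \<in> K) \<and>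
     (\<forall>i j. smooth_on (crd N i ` (dom N i \<inter> dom N j)) (\<lambda>y. trans V i j (chart_inv N i y))) \<and>
     (\<forall>i. smooth_on (cdom N i) (conn V i)) \<and>
     (\<forall>i. \<forall>y \<in> cdom N i. \<forall>a s t. conn V i y $ a $ s $ t \<in> K) \<and>
     (\<forall>i j. \<forall>p \<in> dom N i \<inter> dom N j. \<forall>a.
         conn V i (crd N i p) $ a ** trans V i j p
           + pd a (\<lambda>y. trans V i j (chart_inv N i y)) (crd N i p)
         = trans V i j p ** (\<Sum>b\<in>UNIV. jac N i j p $ b $ a *\<^sub>R conn V j (crd N j p) $ b))"

definition dual :: "('m, 'i, 'r::finite) vbundle \<Rightarrow> ('m, 'i, 'r) vbundle" where
  "dual V = \<lparr> trans = (\<lambda>i j p. transpose (matrix_inv (trans V i j p))),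
              conn = (\<lambda>i y. \<chi> a. - transpose (conn V i y $ a)) \<rparr>"

definition covd ::
    "('m, 'i, 'r::finite) vbundle \<Rightarrow> 'i \<Rightarrow> 4 \<Rightarrow> (real^4 \<Rightarrow> complex^'r) \<Rightarrow> real^4 \<Rightarrow> complex^'r" where
  "covd V i a s y = pd a s y + conn V i y $ a *v s y"

text \<open>The matrix of \<open>D\<^sub>aD\<^sub>b - D\<^sub>bD\<^sub>a\<close>, obtained by applying it to sections with constant components.\<close>

definition curvature :: "('m, 'i, 'r::finite) vbundle \<Rightarrow> 'i \<Rightarrow> real^4 \<Rightarrow> complex^'r^'r^4^4" where
  "curvature V i y = (\<chi> a b.
     matrix (\<lambda>v. covd V i a (covd V i b (\<lambda>_. v)) y - covd V i b (covd V i a (\<lambda>_. v)) y))"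

section \<open>Bundle-valued forms\<close>

type_synonym ('i, 'r) form0 = "'i \<Rightarrow> real^4 \<Rightarrow> complex^'r"
type_synonym ('i, 'r) form1 = "'i \<Rightarrow> real^4 \<Rightarrow> complex^'r^4"
type_synonym ('i, 'r) form2 = "'i \<Rightarrow> real^4 \<Rightarrow> complex^'r^4^4"

definition act0 :: "real^4^4 \<Rightarrow> complex^'r^'r \<Rightarrow> complex^'r \<Rightarrow> complex^'r::finite" where
  "act0 J T v = T *v v"

definition act1 :: "real^4^4 \<Rightarrow> complex^'r^'r \<Rightarrow> complex^'r^4 \<Rightarrow> complex^('r::finite)^4" where
  "act1 J T v = (\<chi> a. \<Sum>b\<in>UNIV. J $ b $ a *\<^sub>R (T *v v $ b))"

definition act2 :: "real^4^4 \<Rightarrow> complex^'r^'r \<Rightarrow> complex^'r^4^4 \<Rightarrow> complex^('r::finite)^4^4" where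
  "act2 J T v = (\<chi> a c. \<Sum>b\<in>UNIV. \<Sum>d\<in>UNIV. (J $ b $ a * J $ d $ c) *\<^sub>R (T *v v $ b $ d))"

definition is_section ::
    "('m, 'i) mfd \<Rightarrow> ('m, 'i, 'r::finite) vbundle \<Rightarrow> (real^4^4 \<Rightarrow> complex^'r^'r \<Rightarrow> 'v \<Rightarrow> 'v)
     \<Rightarrow> ('i \<Rightarrow> real^4 \<Rightarrow> 'v::real_normed_vector) \<Rightarrow> bool" where
  "is_section N V act \<phi> \<longleftrightarrow>
     (\<forall>i. smooth_on (cdom N i) (\<phi> i)) \<and>
     (\<forall>i j. \<forall>p \<in> dom N i \<inter> dom N j.
         \<phi> i (crd N i p) = act (jac N i j p) (trans V i j p) (\<phi> j (crd N j p)))"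

text \<open>\<open>forms\<^sub>k\<close> is \<open>\<E>\<^sup>k(V)\<close>, the smooth sections of \<open>\<and>\<^sup>kT\<^sup>*M \<otimes> V\<close>.\<close>

definition forms0 ::
    "('m, 'i) mfd \<Rightarrow> complex set \<Rightarrow> ('m, 'i, 'r::finite) vbundle \<Rightarrow> ('i, 'r) form0 set" where
  "forms0 N K V = {\<phi>. is_section N V act0 \<phi> \<and> (\<forall>i. \<forall>y \<in> cdom N i. \<forall>s. \<phi> i y $ s \<in> K)}"

definition forms1 ::
    "('m, 'i) mfd \<Rightarrow> complex set \<Rightarrow> ('m, 'i, 'r::finite) vbundle \<Rightarrow> ('i, 'r) form1 set" where
  "forms1 N K V = {\<phi>. is_section N V act1 \<phi> \<and> (\<forall>i. \<forall>y \<in> cdom N i. \<forall>a s. \<phi> i y $ a $ s \<in> K)}"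

definition forms2 ::
    "('m, 'i) mfd \<Rightarrow> complex set \<Rightarrow> ('m, 'i, 'r::finite) vbundle \<Rightarrow> ('i, 'r) form2 set" where
  "forms2 N K V = {\<phi>. is_section N V act2 \<phi> \<and>
     (\<forall>i. \<forall>y \<in> cdom N i. \<forall>a b s. \<phi> i y $ a $ b $ s \<in> K \<and> \<phi> i y $ a $ b = - \<phi> i y $ b $ a)}"

definition compact_support :: "('m, 'i) mfd \<Rightarrow> ('i \<Rightarrow> real^4 \<Rightarrow> 'v::zero) \<Rightarrow> bool" where
  "compact_support N \<phi> \<longleftrightarrow>
     (\<exists>C. compactin (mtop N) C \<and> (\<forall>i. \<forall>p \<in> dom N i - C. \<phi> i (crd N i p) = 0))"

definition d0 :: "('m, 'i, 'r::finite) vbundle \<Rightarrow> ('i, 'r) form0 \<Rightarrow> ('i, 'r) form1" where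
  "d0 V f = (\<lambda>i y. \<chi> a. covd V i a (f i) y)"

definition d1 :: "('m, 'i, 'r::finite) vbundle \<Rightarrow> ('i, 'r) form1 \<Rightarrow> ('i, 'r) form2" where
  "d1 V \<phi> = (\<lambda>i y. \<chi> a b. covd V i a (\<lambda>z. \<phi> i z $ b) y - covd V i b (\<lambda>z. \<phi> i z $ a) y)"

section \<open>Metrics, conformal classes and weighted forms\<close>

type_synonym 'i metric = "'i \<Rightarrow> real^4 \<Rightarrow> real^4^4"

text \<open>Symmetric, non-degenerate, with \<open>q\<close> minus signs in the signature.\<close>

definition has_index :: "nat \<Rightarrow> real^4^4 \<Rightarrow> bool" where
  "has_index q h \<longleftrightarrow> transpose h = h \<and>
     (\<exists>(P::real^4^4) \<sigma>. invertible P \<and> (\<forall>a. \<sigma> a \<in> {1, -1}) \<and> card {a. \<sigma> a = -1} = q \<and>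
        transpose P ** h ** P = (\<chi> a b. if a = b then \<sigma> a else 0))"

definition pseudo_metric :: "('m, 'i) mfd \<Rightarrow> nat \<Rightarrow> 'i metric \<Rightarrow> bool" where
  "pseudo_metric N q g \<longleftrightarrow>
     (\<forall>i. smooth_on (cdom N i) (g i) \<and> (\<forall>y \<in> cdom N i. has_index q (g i y))) \<and>
     (\<forall>i j. \<forall>p \<in> dom N i \<inter> dom N j.
         g i (crd N i p) = transpose (jac N i j p) ** g j (crd N j p) ** jac N i j p)"

text \<open>\<open>rescaling N \<omega> g h\<close> says \<open>h = \<omega>\<^sup>2 g\<close>; smoothness of \<open>\<omega>\<close> follows from that of \<open>g\<close> and \<open>h\<close>.\<close>

definition rescaling :: "('m, 'i) mfd \<Rightarrow> ('m \<Rightarrow> real) \<Rightarrow> 'i metric \<Rightarrow> 'i metric \<Rightarrow> bool" where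
  "rescaling N \<omega> g h \<longleftrightarrow> (\<forall>p \<in> topspace (mtop N). \<omega> p > 0) \<and>
     (\<forall>i. \<forall>p \<in> dom N i. h i (crd N i p) = (\<omega> p)\<^sup>2 *\<^sub>R g i (crd N i p))"

definition conformal_class :: "('m, 'i) mfd \<Rightarrow> nat \<Rightarrow> 'i metric set \<Rightarrow> bool" where
  "conformal_class N q c \<longleftrightarrow>
     (\<exists>g. pseudo_metric N q g \<and> c = {h. pseudo_metric N q h \<and> (\<exists>\<omega>. rescaling N \<omega> g h)})"

text \<open>
  A section of \<open>E[w] \<otimes> B\<close>, with \<open>E[w]\<close> associated to the bundle of metrics in the class via
  \<open>x \<mapsto> x\<^sup>-\<^sup>w\<^sup>/\<^sup>2\<close>, amounts to a section of \<open>B\<close> for each metric of the class, multiplied by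
  \<open>\<omega>\<^sup>w\<close> when the metric is multiplied by \<open>\<omega>\<^sup>2\<close>.
\<close>

definition weighted ::
    "('m, 'i) mfd \<Rightarrow> 'i metric set \<Rightarrow> int \<Rightarrow> ('i \<Rightarrow> real^4 \<Rightarrow> 'v::real_vector) set
     \<Rightarrow> ('i metric \<Rightarrow> 'i \<Rightarrow> real^4 \<Rightarrow> 'v) set" where
  "weighted N c w \<Gamma> = {\<Phi>. (\<forall>g\<in>c. \<Phi> g \<in> \<Gamma>) \<and>
     (\<forall>g\<in>c. \<forall>h\<in>c. \<forall>\<omega>. rescaling N \<omega> g h \<longrightarrow>
        (\<forall>i. \<forall>p \<in> dom N i. \<Phi> h i (crd N i p) = (\<omega> p powi w) *\<^sub>R \<Phi> g i (crd N i p)))}"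

text \<open>\<open>wforms\<^sub>k\<close> is \<open>\<E>\<^sub>k(V)\<close>, of weight \<open>2k - 4\<close>.\<close>

definition wforms0 :: "('m, 'i) mfd \<Rightarrow> 'i metric set \<Rightarrow> complex set \<Rightarrow> ('m, 'i, 'r::finite) vbundle
     \<Rightarrow> ('i metric \<Rightarrow> ('i, 'r) form0) set" where
  "wforms0 N c K V = weighted N c (-4) (forms0 N K V)"

definition wforms1 :: "('m, 'i) mfd \<Rightarrow> 'i metric set \<Rightarrow> complex set \<Rightarrow> ('m, 'i, 'r::finite) vbundle
     \<Rightarrow> ('i metric \<Rightarrow> ('i, 'r) form1) set" where
  "wforms1 N c K V = weighted N c (-2) (forms1 N K V)"

definition wforms2 :: "('m, 'i) mfd \<Rightarrow> 'i metric set \<Rightarrow> complex set \<Rightarrow> ('m, 'i, 'r::finite) vbundle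
     \<Rightarrow> ('i metric \<Rightarrow> ('i, 'r) form2) set" where
  "wforms2 N c K V = weighted N c 0 (forms2 N K V)"

section \<open>Self-dual and anti-self-dual 2-forms\<close>

definition levi_civita :: "4 \<Rightarrow> 4 \<Rightarrow> 4 \<Rightarrow> 4 \<Rightarrow> real" where
  "levi_civita a b c d = det (vector [axis a 1, axis b 1, axis c 1, axis d 1] :: real^4^4)"

definition hodge :: "real^4^4 \<Rightarrow> complex^4^4 \<Rightarrow> complex^4^4" where
  "hodge h u = (\<chi> a b. (1/2) * (\<Sum>c\<in>UNIV. \<Sum>d\<in>UNIV. \<Sum>e\<in>UNIV. \<Sum>f\<in>UNIV.
     of_real (sqrt \<bar>det h\<bar> * levi_civita a b c d * matrix_inv h $ c $ e * matrix_inv h $ d $ f)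
       * u $ e $ f))"

text \<open>
  The sign \<open>\<sigma> = 1\<close> or \<open>\<sigma> = -1\<close> selects \<open>E\<^sup>2\<^sub>+\<close> or \<open>E\<^sup>2\<^sub>-\<close>.  Minkowskian signature means
  \<open>q = 1\<close> or \<open>q = 3\<close>.
\<close>

definition star_eigenvalue :: "nat \<Rightarrow> complex \<Rightarrow> complex" where
  "star_eigenvalue q \<sigma> = (if q \<in> {1, 3} then \<sigma> * \<i> else \<sigma>)"

definition in_E2pm ::
    "nat \<Rightarrow> 'i metric set \<Rightarrow> complex \<Rightarrow> 'i \<Rightarrow> real^4 \<Rightarrow> complex^4^4 \<Rightarrow> bool" where
  "in_E2pm q c \<sigma> i y u \<longleftrightarrow> (\<forall>a b. u $ a $ b = - u $ b $ a) \<and>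
     (\<forall>g\<in>c. hodge (g i y) u = (\<chi> a b. star_eigenvalue q \<sigma> * u $ a $ b))"

definition proj_pm ::
    "nat \<Rightarrow> 'i metric set \<Rightarrow> complex \<Rightarrow> 'i \<Rightarrow> real^4 \<Rightarrow> complex^4^4 \<Rightarrow> complex^4^4" where
  "proj_pm q c \<sigma> i y u = (THE v. in_E2pm q c \<sigma> i y v \<and> in_E2pm q c (-\<sigma>) i y (u - v))"

text \<open>Vanishing of \<open>F\<^sub>+\<close> (for \<open>\<sigma> = 1\<close>) or \<open>F\<^sub>-\<close> (for \<open>\<sigma> = -1\<close>), entry by entry in \<open>End(V)\<close>.\<close>

definition curvature_pm_zero :: "('m, 'i) mfd \<Rightarrow> nat \<Rightarrow> 'i metric set \<Rightarrow> complex
     \<Rightarrow> ('m, 'i, 'r::finite) vbundle \<Rightarrow> bool" where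
  "curvature_pm_zero N q c \<sigma> V \<longleftrightarrow> (\<forall>i. \<forall>y \<in> cdom N i. \<forall>s t.
     proj_pm q c \<sigma> i y (\<chi> a b. curvature V i y $ a $ b $ s $ t) = 0)"

text \<open>The scalars after complexifying the forms in Minkowskian signature.\<close>

definition scalars_pm :: "nat \<Rightarrow> complex set \<Rightarrow> complex set" where
  "scalars_pm q K = (if q \<in> {1, 3} then UNIV else K)"

definition forms2_pm :: "('m, 'i) mfd \<Rightarrow> nat \<Rightarrow> 'i metric set \<Rightarrow> complex set \<Rightarrow> complex
     \<Rightarrow> ('m, 'i, 'r::finite) vbundle \<Rightarrow> ('i, 'r) form2 set" where
  "forms2_pm N q c K \<sigma> V = {\<phi> \<in> forms2 N (scalars_pm q K) V. \<forall>i. \<forall>y \<in> cdom N i. \<forall>s.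
     in_E2pm q c \<sigma> i y (\<chi> a b. \<phi> i y $ a $ b $ s)}"

definition d_pm :: "nat \<Rightarrow> 'i metric set \<Rightarrow> complex \<Rightarrow> ('m, 'i, 'r::finite) vbundle
     \<Rightarrow> ('i, 'r) form1 \<Rightarrow> ('i, 'r) form2" where
  "d_pm q c \<sigma> V \<phi> = (\<lambda>i y. \<chi> a b s.
     proj_pm q c \<sigma> i y (\<chi> a' b'. d1 V \<phi> i y $ a' $ b' $ s) $ a $ b)"

section \<open>Formal adjoints\<close>

definition volume_measure :: "('m, 'i) mfd \<Rightarrow> 'i metric \<Rightarrow> 'm measure \<Rightarrow> bool" where
  "volume_measure N g \<mu> \<longleftrightarrow>
     space \<mu> = topspace (mtop N) \<and>
     sets \<mu> = sigma_sets (topspace (mtop N)) {S. openin (mtop N) S} \<and>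
     (\<forall>i. \<forall>B \<in> sets \<mu>. B \<subseteq> dom N i \<longrightarrow>
        emeasure \<mu> B = (\<integral>\<^sup>+y\<in>crd N i ` B. ennreal (sqrt \<bar>det (g i y)\<bar>) \<partial>lborel))"

text \<open>For families \<open>f\<close> that represent a function on the manifold, the choice of chart is immaterial.\<close>

definition mfd_integral :: "('m, 'i) mfd \<Rightarrow> 'm measure \<Rightarrow> ('i \<Rightarrow> real^4 \<Rightarrow> complex) \<Rightarrow> complex" where
  "mfd_integral N \<mu> f =
     (LINT p|\<mu>. (let i = (SOME i. p \<in> dom N i) in f i (crd N i p)))"

definition dualpair :: "complex^'r \<Rightarrow> complex^'r::finite \<Rightarrow> complex" where
  "dualpair v w = (\<Sum>s\<in>UNIV. v $ s * w $ s)"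

definition pair1 :: "real^4^4 \<Rightarrow> complex^'r^4 \<Rightarrow> complex^('r::finite)^4 \<Rightarrow> complex" where
  "pair1 h v w = (\<Sum>a\<in>UNIV. \<Sum>b\<in>UNIV. of_real (matrix_inv h $ a $ b) * dualpair (v $ a) (w $ b))"

definition pair2 :: "real^4^4 \<Rightarrow> complex^'r^4^4 \<Rightarrow> complex^('r::finite)^4^4 \<Rightarrow> complex" where
  "pair2 h v w = (1/2) * (\<Sum>a\<in>UNIV. \<Sum>b\<in>UNIV. \<Sum>c\<in>UNIV. \<Sum>d\<in>UNIV.
     of_real (matrix_inv h $ a $ c * matrix_inv h $ b $ d) * dualpair (v $ a $ b) (w $ c $ d))"

text \<open>
  \<open>\<delta>\<^sup>D : \<E>\<^sub>1(V) \<rightarrow> \<E>\<^sub>0(V)\<close>, \<open>\<delta>\<^sup>D : \<E>\<^sub>2(V) \<rightarrow> \<E>\<^sub>1(V)\<close> and \<open>\<delta>\<^sup>D\<^sub>\<plusminus> : \<E>\<^sup>2\<^sub>\<plusminus>(V) \<rightarrow> \<E>\<^sub>1(V)\<close>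
  as formal adjoints, tested on compactly supported sections.  The integrands are independent of
  the metric \<open>g\<close> of the class used to write them.
\<close>

definition formal_adjoint_d0 :: "('m, 'i) mfd \<Rightarrow> 'i metric set \<Rightarrow> complex set
     \<Rightarrow> ('m, 'i, 'r::finite) vbundle \<Rightarrow> ('i metric \<Rightarrow> 'm measure)
     \<Rightarrow> (('i metric \<Rightarrow> ('i, 'r) form1) \<Rightarrow> 'i metric \<Rightarrow> ('i, 'r) form0) \<Rightarrow> bool" where
  "formal_adjoint_d0 N c K V vol \<delta> \<longleftrightarrow>
     (\<forall>\<Phi> \<in> wforms1 N c K V. \<delta> \<Phi> \<in> wforms0 N c K V \<and>
        (\<forall>\<psi> \<in> forms0 N K (dual V). compact_support N \<psi> \<longrightarrow>
          (\<forall>g\<in>c. mfd_integral N (vol g) (\<lambda>i y. dualpair (\<delta> \<Phi> g i y) (\<psi> i y)) =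
             mfd_integral N (vol g) (\<lambda>i y. pair1 (g i y) (\<Phi> g i y) (d0 (dual V) \<psi> i y)))))"

definition formal_adjoint_d1 :: "('m, 'i) mfd \<Rightarrow> 'i metric set \<Rightarrow> complex set
     \<Rightarrow> ('m, 'i, 'r::finite) vbundle \<Rightarrow> ('i metric \<Rightarrow> 'm measure)
     \<Rightarrow> (('i metric \<Rightarrow> ('i, 'r) form2) \<Rightarrow> 'i metric \<Rightarrow> ('i, 'r) form1) \<Rightarrow> bool" where
  "formal_adjoint_d1 N c K V vol \<delta> \<longleftrightarrow>
     (\<forall>\<Phi> \<in> wforms2 N c K V. \<delta> \<Phi> \<in> wforms1 N c K V \<and>
        (\<forall>\<psi> \<in> forms1 N K (dual V). compact_support N \<psi> \<longrightarrow>
          (\<forall>g\<in>c. mfd_integral N (vol g) (\<lambda>i y. pair1 (g i y) (\<delta> \<Phi> g i y) (\<psi> i y)) =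
             mfd_integral N (vol g) (\<lambda>i y. pair2 (g i y) (\<Phi> g i y) (d1 (dual V) \<psi> i y)))))"

definition formal_adjoint_d_pm :: "('m, 'i) mfd \<Rightarrow> nat \<Rightarrow> 'i metric set \<Rightarrow> complex set \<Rightarrow> complex
     \<Rightarrow> ('m, 'i, 'r::finite) vbundle \<Rightarrow> ('i metric \<Rightarrow> 'm measure)
     \<Rightarrow> (('i, 'r) form2 \<Rightarrow> 'i metric \<Rightarrow> ('i, 'r) form1) \<Rightarrow> bool" where
  "formal_adjoint_d_pm N q c K \<sigma> V vol \<delta> \<longleftrightarrow>
     (\<forall>\<phi> \<in> forms2_pm N q c K \<sigma> V. \<delta> \<phi> \<in> wforms1 N c (scalars_pm q K) V \<and>
        (\<forall>\<psi> \<in> forms1 N K (dual V). compact_support N \<psi> \<longrightarrow>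
          (\<forall>g\<in>c. mfd_integral N (vol g) (\<lambda>i y. pair1 (g i y) (\<delta> \<phi> g i y) (\<psi> i y)) =
             mfd_integral N (vol g)
               (\<lambda>i y. pair2 (g i y) (\<phi> i y) (d_pm q c \<sigma> (dual V) \<psi> i y)))))"

section \<open>Detour complexes\<close>

text \<open>\<open>(F\<cdot>\<phi>)\<^sub>a = F\<^sub>a\<^sup>b \<phi>\<^sub>b\<close>\<close>

definition curv_dot :: "('m, 'i, 'r::finite) vbundle \<Rightarrow> ('i, 'r) form1
     \<Rightarrow> 'i metric \<Rightarrow> ('i, 'r) form1" where
  "curv_dot V \<phi> = (\<lambda>g i y. \<chi> a. \<Sum>e\<in>UNIV. \<Sum>b\<in>UNIV.
     matrix_inv (g i y) $ e $ b *\<^sub>R (curvature V i y $ a $ e *v \<phi> i y $ b))"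

text \<open>\<open>M\<^sup>D\<close>; the constant family \<open>\<lambda>_. d1 V \<phi>\<close> is \<open>d\<^sup>D\<phi>\<close> under \<open>\<E>\<^sup>2(V) = \<E>\<^sub>2(V)\<close>.\<close>

definition yang_mills_op :: "('m, 'i, 'r::finite) vbundle
     \<Rightarrow> (('i metric \<Rightarrow> ('i, 'r) form2) \<Rightarrow> 'i metric \<Rightarrow> ('i, 'r) form1)
     \<Rightarrow> ('i, 'r) form1 \<Rightarrow> 'i metric \<Rightarrow> ('i, 'r) form1" where
  "yang_mills_op V \<delta> \<phi> = (\<lambda>g i y. \<delta> (\<lambda>_. d1 V \<phi>) g i y - curv_dot V \<phi> g i y)"

text \<open>\<open>2 \<delta>\<^sup>D\<^sub>\<plusminus> d\<^sup>D\<^sub>\<plusminus>\<close>\<close>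

definition half_op :: "nat \<Rightarrow> 'i metric set \<Rightarrow> complex \<Rightarrow> ('m, 'i, 'r::finite) vbundle
     \<Rightarrow> (('i, 'r) form2 \<Rightarrow> 'i metric \<Rightarrow> ('i, 'r) form1)
     \<Rightarrow> ('i, 'r) form1 \<Rightarrow> 'i metric \<Rightarrow> ('i, 'r) form1" where
  "half_op q c \<sigma> V \<delta> \<phi> = (\<lambda>g i y. 2 *\<^sub>R \<delta> (d_pm q c \<sigma> V \<phi>) g i y)"

definition wequal :: "('m, 'i) mfd \<Rightarrow> 'i metric set \<Rightarrow> ('i metric \<Rightarrow> 'i \<Rightarrow> real^4 \<Rightarrow> 'v)
     \<Rightarrow> ('i metric \<Rightarrow> 'i \<Rightarrow> real^4 \<Rightarrow> 'v) \<Rightarrow> bool" where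
  "wequal N c \<Phi> \<Psi> \<longleftrightarrow> (\<forall>g\<in>c. \<forall>i. \<forall>y \<in> cdom N i. \<Phi> g i y = \<Psi> g i y)"

text \<open>\<open>\<E>\<^sup>0(V) \<rightarrow> \<E>\<^sup>1(V) \<rightarrow> \<E>\<^sub>1(V) \<rightarrow> \<E>\<^sub>0(V)\<close> with vanishing compositions\<close>

definition detour_complex :: "('m, 'i) mfd \<Rightarrow> 'i metric set \<Rightarrow> complex set
     \<Rightarrow> ('m, 'i, 'r::finite) vbundle
     \<Rightarrow> (('i, 'r) form0 \<Rightarrow> ('i, 'r) form1)
     \<Rightarrow> (('i, 'r) form1 \<Rightarrow> 'i metric \<Rightarrow> ('i, 'r) form1)
     \<Rightarrow> (('i metric \<Rightarrow> ('i, 'r) form1) \<Rightarrow> 'i metric \<Rightarrow> ('i, 'r) form0) \<Rightarrow> bool" where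
  "detour_complex N c K V P Q R \<longleftrightarrow>
     (\<forall>f \<in> forms0 N K V. P f \<in> forms1 N K V \<and> wequal N c (Q (P f)) (\<lambda>_ _ _. 0)) \<and>
     (\<forall>\<phi> \<in> forms1 N K V. Q \<phi> \<in> wforms1 N c K V \<and> wequal N c (R (Q \<phi>)) (\<lambda>_ _ _. 0)) \<and>
     (\<forall>\<Phi> \<in> wforms1 N c K V. R \<Phi> \<in> wforms0 N c K V)"

end

theory Submission
  imports Defs
begin

text \<open>
  Let \<open>\<mu>\<close> be the eigenvalue of \<open>\<star>\<close> on \<open>E\<^sup>2\<^sub>\<sigma>\<close>, where \<open>\<sigma>\<close> is one of the two signs; then
  \<open>\<mu>\<^sup>2 = \<star>\<^sup>2\<close>, and \<open>P = (1 + \<mu>\<^sup>-\<^sup>1 \<star>) / 2\<close> is the projection onto \<open>E\<^sup>2\<^sub>\<sigma>\<close>.  Since \<open>\<star>\<close> is symmetric for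
  the pairing of 2-forms,
  \<open>\<langle>u, v\<rangle> - 2 \<langle>P u, P v\<rangle> = - \<mu>\<^sup>-\<^sup>1 \<langle>u, \<star> v\<rangle>\<close>, and the volume density turns the right-hand side into
  a constant multiple of \<open>u \<and> v\<close>, from which the metric has disappeared (\<open>ip2_half_proj\<close>).

  Take \<open>u = d\<^sup>D\<phi>\<close> and \<open>v = d\<^sup>D\<psi>\<close>, where \<open>\<psi>\<close> is a compactly supported 1-form with values in the
  dual bundle.  By the Leibniz rule \<open>d\<^sup>D\<phi> \<and> d\<^sup>D\<psi>\<close> is the exact form \<open>d (\<phi> \<and> d\<^sup>D\<psi>)\<close> plus a term in
  which the curvature acts algebraically (\<open>divergence_wedge_current\<close>).  If \<open>F\<^sub>\<sigma> = 0\<close>, that is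
  \<open>\<star> F = - \<mu> F\<close>, then the same constant turns the algebraic term into the density of \<open>\<langle>F \<cdot> \<phi>, \<psi>\<rangle>\<close>
  (\<open>raise_eigen\<close>, \<open>integrand_divergence\<close>).  Hence \<open>\<delta>\<^sup>D d\<^sup>D \<phi> - F \<cdot> \<phi> - 2 \<delta>\<^sub>\<sigma> d\<^sub>\<sigma> \<phi>\<close> is orthogonal to
  every test form \<open>\<psi>\<close>, so it vanishes (\<open>yang_mills_eq_half_op\<close>).

  With this equality both sequences are complexes.  On the one hand \<open>d\<^sub>\<sigma> d\<^sup>D f = F\<^sub>\<sigma> f = 0\<close>.  On the
  other hand the curvature of the dual bundle is \<open>- F\<^sup>T\<close>, so \<open>d\<^sub>\<sigma> d\<^sup>D \<psi> = 0\<close> there as well, and the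
  adjoint of this identity is \<open>\<delta>\<^sup>D \<delta>\<^sub>\<sigma> = 0\<close>.  In Minkowskian signature \<open>2 \<delta>\<^sub>\<sigma> d\<^sub>\<sigma> \<phi>\<close> is defined after
  complexification; that it is real for a real bundle is also a consequence of the equality.

  The operators \<open>\<delta>\<close> are known through their adjoint property alone, so every identity between
  their values comes from testing against sections: a bump function times a constant vector in
  one chart, transported to the other charts (\<open>is_section_bump_section\<close>).  All integrals then take
  place in that chart (\<open>mfd_integral_chart\<close>), and Stokes's theorem is reduced to the vanishing of
  \<open>\<integral> \<partial>\<^sub>a f\<close> for \<open>f\<close> of compact support in \<open>\<real>\<^sup>4\<close> (\<open>integral_pd_compact_support\<close>).  The test forms and
  \<open>d\<^sup>D\<phi>\<close> have to be sections on the whole manifold; for \<open>d\<^sup>D\<phi>\<close> this rests on the symmetry of second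
  derivatives of the chart transitions (\<open>pd_commute\<close>, \<open>d1_forms2\<close>).
\<close>

text \<open>Index expressions are sums over whole index types, written \<open>\<^bold>\<Sum>a b c. t\<close>.\<close>

abbreviation (input) sum_over_type :: "('a::finite \<Rightarrow> 'b::comm_monoid_add) \<Rightarrow> 'b" (binder "\<^bold>\<Sum>" 10)
  where "sum_over_type f \<equiv> sum f UNIV"

section \<open>Partial derivatives\<close>

lemma pd_eqI: "(f has_derivative f') (at y) \<Longrightarrow> pd a f y = f' (axis a 1)"
  unfolding pd_def using frechet_derivative_at by metis

lemma pd_cong_open:
  assumes "open S" "y \<in> S" "\<And>z. z \<in> S \<Longrightarrow> f z = g z"
  shows "pd a f y = pd a g y"
proof -
  have "(f has_derivative f') (at y) = (g has_derivative f') (at y)" for f'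
    using has_derivative_transform_within_open[of f f' y UNIV S g]
      has_derivative_transform_within_open[of g f' y UNIV S f] assms by auto
  then show ?thesis by (simp add: pd_def frechet_derivative_def)
qed

lemma has_derivative_pd:
  assumes "f differentiable (at y)"
  shows "(f has_derivative (\<lambda>h. \<^bold>\<Sum>a. h $ a *\<^sub>R pd a f y)) (at y)"
proof -
  let ?D = "frechet_derivative f (at y)"
  have D: "(f has_derivative ?D) (at y)" using assms frechet_derivative_works by blast
  then have L: "linear ?D" by (rule has_derivative_linear)
  have "?D h = (\<^bold>\<Sum>a. h $ a *\<^sub>R pd a f y)" for h
  proof -
    have "h = (\<^bold>\<Sum>a. h $ a *\<^sub>R axis a 1)"
      by (simp add: vec_eq_iff axis_def if_distrib sum.delta cong: if_cong)
    then have "?D h = ?D (\<^bold>\<Sum>a. h $ a *\<^sub>R axis a 1)" by simp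
    also have "\<dots> = (\<^bold>\<Sum>a. h $ a *\<^sub>R pd a f y)"
      by (simp add: linear_sum[OF L] linear_scale[OF L] pd_def)
    finally show ?thesis .
  qed
  then show ?thesis using D by (metis (no_types, lifting) ext)
qed

lemma pd_const [simp]: "pd a (\<lambda>_. c) y = 0"
  by (simp add: pd_def)

lemma pd_linear:
  assumes "bounded_linear L" "f differentiable (at y)"
  shows "pd a (\<lambda>z. L (f z)) y = L (pd a f y)"
    and "(\<lambda>z. L (f z)) differentiable (at y)"
proof -
  have D: "(f has_derivative frechet_derivative f (at y)) (at y)"
    using assms(2) frechet_derivative_works by blast
  have "((\<lambda>z. L (f z)) has_derivative (\<lambda>h. L (frechet_derivative f (at y) h))) (at y)"
    using bounded_linear.has_derivative[OF assms(1) D] .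
  from pd_eqI[OF this] show "pd a (\<lambda>z. L (f z)) y = L (pd a f y)" by (simp add: pd_def)
  show "(\<lambda>z. L (f z)) differentiable (at y)"
    using \<open>((\<lambda>z. L (f z)) has_derivative _) (at y)\<close> differentiable_def by blast
qed

lemma pd_add:
  assumes "f differentiable (at y)" "g differentiable (at y)"
  shows "pd a (\<lambda>z. f z + g z) y = pd a f y + pd a g y"
  using pd_eqI[OF has_derivative_add[OF assms[unfolded frechet_derivative_works]]]
  by (simp add: pd_def)

lemma pd_sum:
  assumes "finite I" "\<And>i. i \<in> I \<Longrightarrow> f i differentiable (at y)"
  shows "pd a (\<lambda>z. \<Sum>i\<in>I. f i z) y = (\<Sum>i\<in>I. pd a (f i) y)"
  using assms
proof (induction I)
  case (insert x I)
  then show ?case by (simp add: pd_add differentiable_sum)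
qed simp

lemma pd_bilinear:
  assumes "bounded_bilinear m" "f differentiable (at y)" "g differentiable (at y)"
  shows "pd a (\<lambda>z. m (f z) (g z)) y = m (f y) (pd a g y) + m (pd a f y) (g y)"
    and "(\<lambda>z. m (f z) (g z)) differentiable (at y)"
proof -
  note D = bounded_bilinear.FDERIV[OF assms(1) assms(2,3)[unfolded frechet_derivative_works]]
  from pd_eqI[OF D] show "pd a (\<lambda>z. m (f z) (g z)) y = m (f y) (pd a g y) + m (pd a f y) (g y)"
    by (simp add: pd_def)
  show "(\<lambda>z. m (f z) (g z)) differentiable (at y)" using D differentiable_def by blast
qed

lemma pd_compose:
  fixes g :: "real^4 \<Rightarrow> real^4"
  assumes "f differentiable (at (g y))" "g differentiable (at y)"
  shows "pd a (\<lambda>z. f (g z)) y = (\<^bold>\<Sum>b. pd a g y $ b *\<^sub>R pd b f (g y))"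
    and "(\<lambda>z. f (g z)) differentiable (at y)"
proof -
  have "((\<lambda>z. f (g z)) has_derivative
     (\<lambda>h. \<^bold>\<Sum>b. (frechet_derivative g (at y) h) $ b *\<^sub>R pd b f (g y))) (at y)"
    using has_derivative_compose[OF assms(2)[unfolded frechet_derivative_works]
        has_derivative_pd[OF assms(1)]] .
  from pd_eqI[OF this] this
  show "pd a (\<lambda>z. f (g z)) y = (\<^bold>\<Sum>b. pd a g y $ b *\<^sub>R pd b f (g y))"
    and "(\<lambda>z. f (g z)) differentiable (at y)"
    by (auto simp: pd_def differentiable_def)
qed

lemma pd_real_compose:
  fixes h :: "real \<Rightarrow> real"
  assumes "(h has_real_derivative d) (at (f y))" "f differentiable (at y)"
  shows "pd a (\<lambda>z. h (f z)) y = d * pd a f y"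
    and "(\<lambda>z. h (f z)) differentiable (at y)"
proof -
  have "((\<lambda>z. h (f z)) has_derivative (\<lambda>k. d * frechet_derivative f (at y) k)) (at y)"
    using has_derivative_compose[OF assms(2)[unfolded frechet_derivative_works]
      assms(1)[unfolded has_field_derivative_def]] by simp
  from pd_eqI[OF this] this
  show "pd a (\<lambda>z. h (f z)) y = d * pd a f y" "(\<lambda>z. h (f z)) differentiable (at y)"
    by (auto simp: pd_def differentiable_def)
qed

section \<open>Functions of class \<open>C\<^sup>k\<close>\<close>

lemma differentiable_on_open_cong:
  assumes "open S" "\<And>y. y \<in> S \<Longrightarrow> f y = g y" "f differentiable_on S"
  shows "g differentiable_on S"
  unfolding differentiable_on_def
proof
  fix y assume y: "y \<in> S"
  then have "f differentiable (at y within S)" using assms(3) by (auto simp: differentiable_on_def)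
  then show "g differentiable (at y within S)"
    using assms(2) y by (auto intro: differentiable_transform_within[OF _ zero_less_one])
qed

lemma Ck_on_cong:
  assumes "open S" "\<And>y. y \<in> S \<Longrightarrow> f y = g y" "Ck_on n S f"
  shows "Ck_on n S g"
  using assms
proof (induction n arbitrary: f g)
  case 0
  then show ?case using continuous_on_cong[of S S f g] by simp
next
  case (Suc n)
  have "Ck_on n S (pd a g)" for a
  proof (rule Suc.IH[OF Suc.prems(1)])
    show "pd a f y = pd a g y" if "y \<in> S" for y
      using pd_cong_open[OF Suc.prems(1) that] Suc.prems(2) by blast
    show "Ck_on n S (pd a f)" using Suc.prems(3) by simp
  qed
  moreover have "g differentiable_on S"
    using differentiable_on_open_cong[OF Suc.prems(1,2)] Suc.prems(3) by simp
  ultimately show ?case by simp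
qed

lemma Ck_on_Suc_imp: "Ck_on (Suc n) S f \<Longrightarrow> Ck_on n S f"
proof (induction n arbitrary: f)
  case 0
  then show ?case by (simp add: differentiable_imp_continuous_on)
next
  case (Suc n)
  then show ?case by (metis Ck_on.simps(2))
qed

lemma Ck_on_subset: "Ck_on n S f \<Longrightarrow> T \<subseteq> S \<Longrightarrow> Ck_on n T f"
  by (induction n arbitrary: f) (auto intro: continuous_on_subset differentiable_on_subset)

lemma Ck_on_const: "Ck_on n S (\<lambda>_. c)"
  by (induction n arbitrary: c) (auto simp: pd_const[abs_def])

lemma Ck_on_add:
  assumes "open S" "Ck_on n S f" "Ck_on n S g"
  shows "Ck_on n S (\<lambda>y. f y + g y)"
  using assms
proof (induction n arbitrary: f g)
  case (Suc n)
  then have d: "f differentiable (at y)" "g differentiable (at y)" if "y \<in> S" for y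
    using that by (auto simp: differentiable_on_eq_differentiable_at)
  have "Ck_on n S (pd a (\<lambda>y. f y + g y))" for a
    by (rule Ck_on_cong[OF Suc.prems(1), of "\<lambda>y. pd a f y + pd a g y"])
      (use Suc d in \<open>auto simp: pd_add\<close>)
  then show ?case using Suc.prems by auto
qed (auto intro: continuous_on_add)

lemma Ck_on_sum:
  assumes "open S" "finite I" "\<And>i. i \<in> I \<Longrightarrow> Ck_on n S (f i)"
  shows "Ck_on n S (\<lambda>y. \<Sum>i\<in>I. f i y)"
  using assms(2,3) by (induction I) (auto intro: Ck_on_const Ck_on_add[OF assms(1)])

lemma Ck_on_linear:
  assumes "bounded_linear L" "open S" "Ck_on n S f"
  shows "Ck_on n S (\<lambda>y. L (f y))"
  using assms(3)
proof (induction n arbitrary: f)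
  case 0
  then show ?case using assms(1) by (auto intro: bounded_linear.continuous_on)
next
  case (Suc n)
  then have d: "f differentiable (at y)" if "y \<in> S" for y
    using that assms(2) by (auto simp: differentiable_on_eq_differentiable_at)
  have "Ck_on n S (pd a (\<lambda>y. L (f y)))" for a
    by (rule Ck_on_cong[OF assms(2), of "\<lambda>y. L (pd a f y)"])
      (use Suc d pd_linear[OF assms(1)] in auto)
  then show ?case using d pd_linear(2)[OF assms(1)] assms(2)
    by (auto simp: differentiable_on_eq_differentiable_at)
qed

lemma Ck_on_bilinear:
  assumes "bounded_bilinear m" "open S" "Ck_on n S f" "Ck_on n S g"
  shows "Ck_on n S (\<lambda>y. m (f y) (g y))"
  using assms(3,4)
proof (induction n arbitrary: f g)
  case 0
  then show ?case using assms(1) by (auto intro: bounded_bilinear.continuous_on)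
next
  case (Suc n)
  then have d: "f differentiable (at y)" "g differentiable (at y)" if "y \<in> S" for y
    using that assms(2) by (auto simp: differentiable_on_eq_differentiable_at)
  have "Ck_on n S (pd a (\<lambda>y. m (f y) (g y)))" for a
    by (rule Ck_on_cong[OF assms(2), of "\<lambda>y. m (f y) (pd a g y) + m (pd a f y) (g y)"])
      (use Suc d pd_bilinear[OF assms(1)] in
        \<open>auto intro!: Ck_on_add[OF assms(2)] Suc.IH intro: Ck_on_Suc_imp\<close>)
  then show ?case using d pd_bilinear(2)[OF assms(1)] assms(2)
    by (auto simp: differentiable_on_eq_differentiable_at)
qed

lemma Ck_on_axis_nth:
  fixes g :: "real^4 \<Rightarrow> real^4"
  assumes "open S" "Ck_on n S g" shows "Ck_on n S (\<lambda>y. g y $ b)"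
  by (rule Ck_on_linear[OF bounded_linear_vec_nth assms])

lemma Ck_on_compose:
  fixes g :: "real^4 \<Rightarrow> real^4"
  assumes "open S" "open T" "g ` T \<subseteq> S" "Ck_on n S f" "Ck_on n T g"
  shows "Ck_on n T (\<lambda>y. f (g y))"
  using assms(4,5)
proof (induction n arbitrary: f)
  case 0
  then show ?case using assms(3)
    by (auto intro: continuous_on_compose2)
next
  case (Suc n)
  have df: "f differentiable (at (g y))" and dg: "g differentiable (at y)" if "y \<in> T" for y
    using that Suc.prems assms(1-3) by (auto simp: differentiable_on_eq_differentiable_at)
  note pdc = pd_compose[OF df dg]
  have g: "Ck_on n T g" using Suc.prems(2) Ck_on_Suc_imp by blast
  have "Ck_on n T (pd a (\<lambda>y. f (g y)))" for a
  proof (rule Ck_on_cong[OF assms(2), of "\<lambda>y. \<^bold>\<Sum>b. pd a g y $ b *\<^sub>R pd b f (g y)"])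
    show "Ck_on n T (\<lambda>y. \<^bold>\<Sum>b. pd a g y $ b *\<^sub>R pd b f (g y))"
      by (intro Ck_on_sum[OF assms(2)] Ck_on_bilinear[OF bounded_bilinear_scaleR assms(2)]
          Ck_on_axis_nth[OF assms(2)])
        (use Suc g in auto)
  qed (use pdc in auto)
  then show ?case using pdc(2) assms(2)
    by (auto simp: differentiable_on_eq_differentiable_at)
qed

lemma Ck_on_inverse:
  fixes f :: "real^4 \<Rightarrow> real"
  assumes "open S" "Ck_on n S f" "\<And>y. y \<in> S \<Longrightarrow> f y \<noteq> 0"
  shows "Ck_on n S (\<lambda>y. inverse (f y))"
  using assms(2)
proof (induction n)
  case 0
  then show ?case using assms(3) by (auto intro: continuous_on_inverse)
next
  case (Suc n)
  have d: "f differentiable (at y)" if "y \<in> S" for y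
    using that Suc.prems assms(1) by (auto simp: differentiable_on_eq_differentiable_at)
  have pdc: "pd a (\<lambda>y. inverse (f y)) y = - (inverse (f y) ^ 2) * pd a f y"
    "(\<lambda>y. inverse (f y)) differentiable (at y)" if "y \<in> S" for y a
    using pd_real_compose[OF DERIV_inverse[OF assms(3)[OF that]] d[OF that]]
    by (auto simp: power2_eq_square)
  have I: "Ck_on n S (\<lambda>y. inverse (f y))" using Suc Ck_on_Suc_imp by blast
  have "Ck_on n S (pd a (\<lambda>y. inverse (f y)))" for a
  proof (rule Ck_on_cong[OF assms(1), of "\<lambda>y. (-1) * ((inverse (f y) * inverse (f y)) * pd a f y)"])
    show "Ck_on n S (\<lambda>y. (-1) * ((inverse (f y) * inverse (f y)) * pd a f y))"
      by (intro Ck_on_bilinear[OF bounded_bilinear_mult assms(1)] I Ck_on_const)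
        (use Suc.prems in auto)
  qed (auto simp: pdc power2_eq_square)
  then show ?case using pdc(2) assms(1)
    by (auto simp: differentiable_on_eq_differentiable_at)
qed

lemma Ck_on_sqrt:
  fixes f :: "real^4 \<Rightarrow> real"
  assumes "open S" "Ck_on n S f" "\<And>y. y \<in> S \<Longrightarrow> f y > 0"
  shows "Ck_on n S (\<lambda>y. sqrt (f y))"
  using assms(2)
proof (induction n)
  case 0
  then show ?case by (auto intro: continuous_on_real_sqrt)
next
  case (Suc n)
  have d: "f differentiable (at y)" if "y \<in> S" for y
    using that Suc.prems assms(1) by (auto simp: differentiable_on_eq_differentiable_at)
  have pdc: "pd a (\<lambda>y. sqrt (f y)) y = inverse (sqrt (f y)) / 2 * pd a f y"
    "(\<lambda>y. sqrt (f y)) differentiable (at y)" if "y \<in> S" for y a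
    using pd_real_compose[OF DERIV_real_sqrt[OF assms(3)[OF that]] d[OF that]]
    by auto
  have I: "Ck_on n S (\<lambda>y. inverse (sqrt (f y)))"
    by (rule Ck_on_inverse[OF assms(1)]) (use Suc Ck_on_Suc_imp assms(3) in \<open>auto simp: less_imp_neq\<close>, fastforce)
  have "Ck_on n S (pd a (\<lambda>y. sqrt (f y)))" for a
  proof (rule Ck_on_cong[OF assms(1), of "\<lambda>y. (1/2) * (inverse (sqrt (f y)) * pd a f y)"])
    show "Ck_on n S (\<lambda>y. (1/2) * (inverse (sqrt (f y)) * pd a f y))"
      by (intro Ck_on_bilinear[OF bounded_bilinear_mult assms(1)] I Ck_on_const)
        (use Suc.prems in auto)
  qed (auto simp: pdc)
  then show ?case using pdc(2) assms(1)
    by (auto simp: differentiable_on_eq_differentiable_at)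
qed

lemma bounded_linear_axis: "bounded_linear (axis s :: 'a::real_normed_vector \<Rightarrow> 'a^'n::finite)"
proof (rule bounded_linear_intro[where K=1])
  show "norm (axis s x :: 'a^'n) \<le> norm x * 1" for x
  proof -
    have "(\<^bold>\<Sum>i. (norm ((axis s x :: 'a^'n) $ i))\<^sup>2) = (\<^bold>\<Sum>i. if i = s then (norm x)\<^sup>2 else 0)"
      by (intro sum.cong) (auto simp: axis_def)
    then show ?thesis by (simp add: norm_vec_def L2_set_def)
  qed
qed (auto simp: vec_eq_iff axis_def)

lemma vec_sum_axis: "v = (\<^bold>\<Sum>s. axis s (v $ s))" for v :: "'a::comm_monoid_add^'n::finite"
  by (simp add: vec_eq_iff axis_def)

text \<open>
  A vector is the sum of its components, each inserted by a bounded linear map, so closure under sums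
  and linear maps suffices.
\<close>

lemma Ck_on_componentwise:
  assumes "open S" "\<And>s. Ck_on n S (\<lambda>y. f y $ s)"
  shows "Ck_on n S (f :: _ \<Rightarrow> 'a::real_normed_vector^'n::finite)"
proof (rule Ck_on_cong[OF assms(1)])
  show "Ck_on n S (\<lambda>y. \<^bold>\<Sum>s. axis s (f y $ s) :: 'a^'n)"
    by (intro Ck_on_sum[OF assms(1)] Ck_on_linear[OF bounded_linear_axis assms(1)] assms(2)) simp
qed (rule vec_sum_axis[symmetric])

section \<open>Smooth functions\<close>

lemma smooth_on_cong:
  "\<lbrakk>open S; \<And>y. y \<in> S \<Longrightarrow> f y = g y; smooth_on S f\<rbrakk> \<Longrightarrow> smooth_on S g"
  unfolding smooth_on_def using Ck_on_cong by blast

lemma smooth_on_subset: "smooth_on S f \<Longrightarrow> T \<subseteq> S \<Longrightarrow> smooth_on T f"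
  unfolding smooth_on_def using Ck_on_subset by blast

lemma smooth_on_const: "smooth_on S (\<lambda>_. c)"
  unfolding smooth_on_def using Ck_on_const by blast

lemma smooth_on_add: "\<lbrakk>open S; smooth_on S f; smooth_on S g\<rbrakk> \<Longrightarrow> smooth_on S (\<lambda>y. f y + g y)"
  unfolding smooth_on_def using Ck_on_add by blast

lemma smooth_on_sum:
  "\<lbrakk>open S; finite I; \<And>i. i \<in> I \<Longrightarrow> smooth_on S (f i)\<rbrakk> \<Longrightarrow> smooth_on S (\<lambda>y. \<Sum>i\<in>I. f i y)"
  unfolding smooth_on_def using Ck_on_sum[of S I _ f] by blast

lemma smooth_on_linear: "\<lbrakk>bounded_linear L; open S; smooth_on S f\<rbrakk> \<Longrightarrow> smooth_on S (\<lambda>y. L (f y))"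
  unfolding smooth_on_def using Ck_on_linear by blast

lemma smooth_on_bilinear:
  "\<lbrakk>bounded_bilinear m; open S; smooth_on S f; smooth_on S g\<rbrakk> \<Longrightarrow> smooth_on S (\<lambda>y. m (f y) (g y))"
  unfolding smooth_on_def using Ck_on_bilinear by blast

lemmas smooth_on_mult = smooth_on_bilinear[OF bounded_bilinear_mult]
lemmas smooth_on_scaleR = smooth_on_bilinear[OF bounded_bilinear_scaleR]
lemmas smooth_on_vec_nth = smooth_on_linear[OF bounded_linear_vec_nth]
lemmas smooth_on_minus = smooth_on_linear[OF bounded_linear_minus[OF bounded_linear_ident]]
lemmas smooth_on_of_real = smooth_on_linear[OF bounded_linear_of_real]

lemma smooth_on_diff:
  "\<lbrakk>open S; smooth_on S f; smooth_on S g\<rbrakk> \<Longrightarrow> smooth_on S (\<lambda>y. f y - g y)"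
  using smooth_on_add[of S f "\<lambda>y. - g y"] smooth_on_minus by auto

lemma smooth_on_prod:
  fixes f :: "'i \<Rightarrow> real^4 \<Rightarrow> 'a::{real_normed_algebra,comm_ring_1}"
  shows "\<lbrakk>open S; finite I; \<And>i. i \<in> I \<Longrightarrow> smooth_on S (f i)\<rbrakk> \<Longrightarrow> smooth_on S (\<lambda>y. \<Prod>i\<in>I. f i y)"
  by (rotate_tac 1, induction I rule: finite_induct) (auto intro: smooth_on_const smooth_on_mult)

lemma smooth_on_compose:
  fixes g :: "real^4 \<Rightarrow> real^4"
  shows "\<lbrakk>open S; open T; g ` T \<subseteq> S; smooth_on S f; smooth_on T g\<rbrakk> \<Longrightarrow> smooth_on T (\<lambda>y. f (g y))"
  unfolding smooth_on_def using Ck_on_compose by blast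

lemma smooth_on_inverse:
  "\<lbrakk>open S; smooth_on S f; \<And>y. y \<in> S \<Longrightarrow> f y \<noteq> 0\<rbrakk> \<Longrightarrow> smooth_on S (\<lambda>y. inverse (f y :: real))"
  unfolding smooth_on_def using Ck_on_inverse by blast

lemma smooth_on_sqrt:
  "\<lbrakk>open S; smooth_on S f; \<And>y. y \<in> S \<Longrightarrow> f y > 0\<rbrakk> \<Longrightarrow> smooth_on S (\<lambda>y. sqrt (f y))"
  unfolding smooth_on_def using Ck_on_sqrt by blast

lemma smooth_on_componentwise:
  "\<lbrakk>open S; \<And>s. smooth_on S (\<lambda>y. f y $ s)\<rbrakk> \<Longrightarrow> smooth_on S f"
  unfolding smooth_on_def using Ck_on_componentwise by blast

lemma smooth_on_vec_lambda:
  "\<lbrakk>open S; \<And>s. smooth_on S (\<lambda>y. f y s)\<rbrakk> \<Longrightarrow> smooth_on S (\<lambda>y. \<chi> s. f y s)"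
  by (rule smooth_on_componentwise) auto

lemma smooth_on_pd: "smooth_on S f \<Longrightarrow> smooth_on S (pd a f)"
  unfolding smooth_on_def using Ck_on.simps(2) by blast

lemma smooth_on_differentiable: "\<lbrakk>smooth_on S f; open S; y \<in> S\<rbrakk> \<Longrightarrow> f differentiable (at y)"
  unfolding smooth_on_def using Ck_on.simps(2)[of 0 S f] differentiable_on_eq_differentiable_at by blast

lemma smooth_on_continuous: "smooth_on S f \<Longrightarrow> continuous_on S f"
  unfolding smooth_on_def using Ck_on.simps(1) by blast

lemma smooth_on_ident: "open S \<Longrightarrow> smooth_on S (\<lambda>y. y)"
proof -
  assume S: "open S"
  have p: "pd a (\<lambda>y. y) y = axis a 1" for a and y :: "real^4"
    using pd_eqI[OF has_derivative_ident] by simp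
  have "Ck_on n S (\<lambda>y. y)" for n
  proof (cases n)
    case (Suc m)
    then show ?thesis using Ck_on_cong[OF S p[symmetric] Ck_on_const]
      by (simp add: p[abs_def] Ck_on_const differentiable_on_id[unfolded id_def])
  qed simp
  then show ?thesis by (simp add: smooth_on_def)
qed

text \<open>
  Sections glued from several local formulas are smooth by this criterion.
\<close>

lemma smooth_on_local:
  assumes "\<And>y. y \<in> S \<Longrightarrow> \<exists>T. open T \<and> y \<in> T \<and> smooth_on T f"
  shows "smooth_on S f"
proof -
  have "Ck_on n S g" if "\<And>y. y \<in> S \<Longrightarrow> \<exists>T. open T \<and> y \<in> T \<and> Ck_on n T g"
    for n and g :: "real^4 \<Rightarrow> 'a"
    using that
  proof (induction n arbitrary: g)
    case 0
    show ?case unfolding Ck_on.simps continuous_on_eq_continuous_within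
    proof
      fix y assume "y \<in> S"
      then obtain T where "open T" "y \<in> T" "continuous_on T g" using 0 by auto
      then have "continuous (at y) g" using continuous_on_eq_continuous_at by blast
      then show "continuous (at y within S) g" by (rule continuous_at_imp_continuous_at_within)
    qed
  next
    case (Suc n)
    have "g differentiable (at y within S)" if y: "y \<in> S" for y
    proof -
      obtain T where T: "open T" "y \<in> T" "Ck_on (Suc n) T g" using Suc.prems[OF y] by blast
      then have "g differentiable_on T" by simp
      then have "g differentiable (at y)" using T differentiable_on_eq_differentiable_at by blast
      then show ?thesis by (rule differentiable_at_withinI)
    qed
    moreover have "Ck_on n S (pd a g)" for a
    proof (rule Suc.IH)
      fix y assume "y \<in> S"
      then obtain T where "open T" "y \<in> T" "Ck_on (Suc n) T g" using Suc.prems by blast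
      then show "\<exists>T. open T \<and> y \<in> T \<and> Ck_on n T (pd a g)" by auto
    qed
    ultimately show ?case by (simp add: differentiable_on_def)
  qed
  then show ?thesis using assms unfolding smooth_on_def by meson
qed

lemma smooth_on_det:
  fixes A :: "real^4 \<Rightarrow> real^'n^'n"
  assumes "open S" "\<And>i j. smooth_on S (\<lambda>y. A y $ i $ j)"
  shows "smooth_on S (\<lambda>y. det (A y))"
  unfolding det_def
  by (intro smooth_on_sum smooth_on_mult smooth_on_prod smooth_on_const assms) auto

lemma matrix_inv_mult:
  fixes A :: "'a::field^'n^'n"
  assumes "det A \<noteq> 0"
  shows "A ** matrix_inv A = mat 1" "matrix_inv A ** A = mat 1"
proof -
  have "\<exists>B. A ** B = mat 1 \<and> B ** A = mat 1"
    using assms invertible_det_nz invertible_def by blast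
  then have "A ** matrix_inv A = mat 1 \<and> matrix_inv A ** A = mat 1"
    unfolding matrix_inv_def by (rule someI_ex)
  then show "A ** matrix_inv A = mat 1" "matrix_inv A ** A = mat 1" by auto
qed

text \<open>
  Cramer's rule writes the entries of the inverse as quotients of polynomials in the entries, which
  shows that they depend smoothly on the matrix.
\<close>

lemma matrix_inv_cramer:
  fixes A :: "'a::field^'n^'n"
  assumes "det A \<noteq> 0"
  shows "matrix_inv A $ k $ l = det (\<chi> i j. if j = k then (if i = l then 1 else 0) else A $ i $ j) / det A"
proof -
  have "A ** matrix_inv A = mat 1" using matrix_inv_mult(1)[OF assms] .
  then have "A *v (matrix_inv A *v axis l 1) = axis l 1"
    by (simp add: matrix_vector_mul_assoc)
  then have "matrix_inv A *v axis l 1 =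
    (\<chi> k. det (\<chi> i j. if j = k then axis l 1 $ i else A $ i $ j) / det A)"
    using cramer[OF assms] by blast
  moreover have "(matrix_inv A *v axis l 1) $ k = matrix_inv A $ k $ l"
    by (simp add: matrix_vector_mult_def axis_def if_distrib cong: if_cong)
  ultimately show ?thesis by (simp add: axis_def cong: if_cong)
qed

lemma smooth_on_matrix_inv:
  fixes A :: "real^4 \<Rightarrow> real^'n^'n"
  assumes "open S" "smooth_on S A" "\<And>y. y \<in> S \<Longrightarrow> det (A y) \<noteq> 0"
  shows "smooth_on S (\<lambda>y. matrix_inv (A y) $ k $ l)"
proof (rule smooth_on_cong[OF assms(1)])
  show "smooth_on S (\<lambda>y. det (\<chi> i j. if j = k then (if i = l then 1 else 0) else A y $ i $ j) * inverse (det (A y)))"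
  proof (intro smooth_on_mult smooth_on_det smooth_on_inverse assms)
    show "smooth_on S (\<lambda>y. (\<chi> i j. if j = k then (if i = l then 1 else 0) else A y $ i $ j) $ i $ j)" for i j
      using smooth_on_vec_nth[OF assms(1) smooth_on_vec_nth[OF assms(1,2)]]
      by (cases "j = k") (auto simp: smooth_on_const)
    show "smooth_on S (\<lambda>y. A y $ i $ j)" for i j
      by (intro smooth_on_vec_nth assms)
  qed
qed (simp add: matrix_inv_cramer[OF assms(3)] field_simps)

section \<open>Symmetry of second derivatives\<close>

lemma has_derivative_along_axis:
  assumes "f differentiable (at (x + s *\<^sub>R axis a 1))"
  shows "((\<lambda>t. f (x + t *\<^sub>R axis a 1)) has_derivative (\<lambda>t. t *\<^sub>R pd a f (x + s *\<^sub>R axis a 1))) (at s)"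
proof -
  have 1: "((\<lambda>t. x + t *\<^sub>R axis a (1::real) :: real^4) has_derivative (\<lambda>t. t *\<^sub>R axis a 1)) (at s)"
    by (auto intro!: derivative_eq_intros)
  let ?D = "frechet_derivative f (at (x + s *\<^sub>R axis a 1))"
  have D: "(f has_derivative ?D) (at (x + s *\<^sub>R axis a 1))"
    using assms frechet_derivative_works by blast
  have "((\<lambda>t. f (x + t *\<^sub>R axis a 1)) has_derivative (\<lambda>t. ?D (t *\<^sub>R axis a 1))) (at s)"
    using has_derivative_compose[OF 1 D] .
  then show ?thesis
    using linear_scale[OF has_derivative_linear[OF D]] by (simp add: pd_def)
qed

text \<open>
  Two applications of the mean value theorem, first in direction \<open>a\<close> to the difference of \<open>f\<close> in
  direction \<open>b\<close>, then in direction \<open>b\<close>.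
\<close>

lemma second_difference_mean_value:
  fixes f :: "real^4 \<Rightarrow> real"
  assumes C: "Ck_on 2 (ball y r) f" and t: "0 < t" "2 * t < r"
  shows "\<exists>z \<in> cball y (2 * t).
    f (y + t *\<^sub>R axis a 1 + t *\<^sub>R axis b 1) - f (y + t *\<^sub>R axis a 1) - f (y + t *\<^sub>R axis b 1) + f y
      = t * t * pd b (pd a f) z"
proof -
  have inb: "dist y (y + s *\<^sub>R axis a 1 + u *\<^sub>R axis b 1) \<le> 2 * t" if "0 \<le> s" "s \<le> t" "0 \<le> u" "u \<le> t" for s u
  proof -
    have "norm (s *\<^sub>R axis a 1 + u *\<^sub>R axis b 1 :: real^4) \<le> \<bar>s\<bar> + \<bar>u\<bar>"
      by (rule order_trans[OF norm_triangle_ineq]) simp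
    moreover have "dist y (y + s *\<^sub>R axis a 1 + u *\<^sub>R axis b 1) = norm (s *\<^sub>R axis a 1 + u *\<^sub>R axis b 1 :: real^4)"
      unfolding dist_norm by (subst norm_minus_commute) (simp add: add.assoc)
    ultimately show ?thesis using that by simp
  qed
  have in': "y + s *\<^sub>R axis a 1 + u *\<^sub>R axis b 1 \<in> ball y r" if "0 \<le> s" "s \<le> t" "0 \<le> u" "u \<le> t" for s u
    using inb[OF that] t by auto
  have C2: "Ck_on (Suc (Suc 0)) (ball y r) f" using C by (simp add: numeral_2_eq_2)
  have df: "f differentiable (at z)" "pd a f differentiable (at z)" if "z \<in> ball y r" for z
    using C2 that by (auto simp: differentiable_on_eq_differentiable_at)
  define \<phi> where "\<phi> s = f (y + t *\<^sub>R axis b 1 + s *\<^sub>R axis a 1) - f (y + s *\<^sub>R axis a 1)" for s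
  define \<phi>' where "\<phi>' s = pd a f (y + t *\<^sub>R axis b 1 + s *\<^sub>R axis a 1) - pd a f (y + s *\<^sub>R axis a 1)" for s
  have "(\<phi> has_real_derivative \<phi>' s) (at s)" if "0 \<le> s" "s \<le> t" for s
  proof -
    have "y + t *\<^sub>R axis b 1 + s *\<^sub>R axis a 1 \<in> ball y r" "y + s *\<^sub>R axis a 1 \<in> ball y r"
      using in'[of s t] in'[of s 0] that t by (auto simp: ac_simps)
    then have "(\<phi> has_derivative (\<lambda>h. h *\<^sub>R pd a f (y + t *\<^sub>R axis b 1 + s *\<^sub>R axis a 1)
        - h *\<^sub>R pd a f (y + s *\<^sub>R axis a 1))) (at s)"
      unfolding \<phi>_def[abs_def] by (intro has_derivative_diff has_derivative_along_axis df)
    moreover have "(\<lambda>h. h *\<^sub>R pd a f (y + t *\<^sub>R axis b 1 + s *\<^sub>R axis a 1)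
        - h *\<^sub>R pd a f (y + s *\<^sub>R axis a 1)) = (*) (\<phi>' s)"
      by (auto simp: \<phi>'_def algebra_simps)
    ultimately show ?thesis by (simp add: has_field_derivative_def)
  qed
  from MVT2[OF t(1) this] obtain s where s: "0 < s" "s < t" "\<phi> t - \<phi> 0 = t * \<phi>' s" by auto
  define \<psi> where "\<psi> u = pd a f (y + s *\<^sub>R axis a 1 + u *\<^sub>R axis b 1)" for u
  have "(\<psi> has_real_derivative pd b (pd a f) (y + s *\<^sub>R axis a 1 + u *\<^sub>R axis b 1)) (at u)"
    if "0 \<le> u" "u \<le> t" for u
    using has_derivative_along_axis[OF df(2)[OF in'[of s u]]] that s
    by (simp add: \<psi>_def[abs_def] has_field_derivative_def mult_commute_abs)
  from MVT2[OF t(1) this] obtain u where u: "0 < u" "u < t"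
    "\<psi> t - \<psi> 0 = t * pd b (pd a f) (y + s *\<^sub>R axis a 1 + u *\<^sub>R axis b 1)" by auto
  have "\<phi>' s = \<psi> t - \<psi> 0" by (simp add: \<phi>'_def \<psi>_def ac_simps)
  then have "\<phi> t - \<phi> 0 = t * t * pd b (pd a f) (y + s *\<^sub>R axis a 1 + u *\<^sub>R axis b 1)"
    using s u by simp
  moreover have "y + s *\<^sub>R axis a 1 + u *\<^sub>R axis b 1 \<in> cball y (2 * t)"
    using inb s u by simp
  moreover have "f (y + t *\<^sub>R axis a 1 + t *\<^sub>R axis b 1) - f (y + t *\<^sub>R axis a 1) - f (y + t *\<^sub>R axis b 1) + f y
      = \<phi> t - \<phi> 0" by (simp add: \<phi>_def add.commute add.left_commute)
  ultimately show ?thesis by metis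
qed

text \<open>
  The second difference is symmetric in the two directions.  So, by
  \<open>second_difference_mean_value\<close>, the two mixed derivatives share a value at points arbitrarily near
  \<open>y\<close>, and continuity forces equality at \<open>y\<close>.
\<close>

lemma pd_commute_real:
  fixes f :: "real^4 \<Rightarrow> real"
  assumes S: "open S" "y \<in> S" and f: "Ck_on 2 S f"
  shows "pd a (pd b f) y = pd b (pd a f) y"
proof (rule ccontr)
  assume ne: "pd a (pd b f) y \<noteq> pd b (pd a f) y"
  define e where "e = \<bar>pd a (pd b f) y - pd b (pd a f) y\<bar> / 2"
  have e: "e > 0" using ne by (simp add: e_def)
  have "continuous_on S (pd a (pd b f))" "continuous_on S (pd b (pd a f))"
    using f by (auto simp: numeral_2_eq_2)
  then have c: "isCont (pd a (pd b f)) y" "isCont (pd b (pd a f)) y"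
    using S continuous_on_eq_continuous_at by blast+
  obtain d1 where d1: "d1 > 0" "\<And>z. dist z y < d1 \<Longrightarrow> \<bar>pd a (pd b f) z - pd a (pd b f) y\<bar> < e"
    using c(1)[unfolded continuous_at_eps_delta dist_real_def, rule_format, OF e] by blast
  obtain d2 where d2: "d2 > 0" "\<And>z. dist z y < d2 \<Longrightarrow> \<bar>pd b (pd a f) z - pd b (pd a f) y\<bar> < e"
    using c(2)[unfolded continuous_at_eps_delta dist_real_def, rule_format, OF e] by blast
  note d = d1 d2
  obtain r where r: "r > 0" "ball y r \<subseteq> S" using S open_contains_ball by blast
  \<comment> \<open>The points supplied by the mean value theorem lie within \<open>2 t\<close> of \<open>y\<close>.\<close>
  define t where "t = min r (min d1 d2) / 3"
  have t: "0 < t" "2 * t < r" "2 * t < d1" "2 * t < d2" using r d by (auto simp: t_def)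
  have C: "Ck_on 2 (ball y r) f" using Ck_on_subset f r by blast
  obtain z where z: "z \<in> cball y (2 * t)"
    "f (y + t *\<^sub>R axis a 1 + t *\<^sub>R axis b 1) - f (y + t *\<^sub>R axis a 1) - f (y + t *\<^sub>R axis b 1) + f y
      = t * t * pd b (pd a f) z" using second_difference_mean_value[OF C t(1,2)] by blast
  obtain w where w: "w \<in> cball y (2 * t)"
    "f (y + t *\<^sub>R axis b 1 + t *\<^sub>R axis a 1) - f (y + t *\<^sub>R axis b 1) - f (y + t *\<^sub>R axis a 1) + f y
      = t * t * pd a (pd b f) w" using second_difference_mean_value[OF C t(1,2)] by blast
  have "t * t * pd b (pd a f) z = t * t * pd a (pd b f) w"
    unfolding z(2)[symmetric] w(2)[symmetric] by (simp add: ac_simps)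
  then have "pd b (pd a f) z = pd a (pd b f) w" using t by simp
  moreover have "\<bar>pd a (pd b f) w - pd a (pd b f) y\<bar> < e"
    by (rule d(2)) (use w t in \<open>auto simp: dist_commute\<close>)
  moreover have "\<bar>pd b (pd a f) z - pd b (pd a f) y\<bar> < e"
    by (rule d(4)) (use z t in \<open>auto simp: dist_commute\<close>)
  moreover have "2 * e = \<bar>pd a (pd b f) y - pd b (pd a f) y\<bar>" by (simp add: e_def)
  ultimately show False by linarith
qed

lemma pd_commute:
  fixes f :: "real^4 \<Rightarrow> 'a::euclidean_space"
  assumes S: "open S" "y \<in> S" and f: "smooth_on S f"
  shows "pd a (pd b f) y = pd b (pd a f) y"
proof (rule euclidean_eqI)
  fix e :: 'a
  have L: "bounded_linear (\<lambda>v. v \<bullet> e)" by (rule bounded_linear_inner_left)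
  have c: "pd a (pd b f) y \<bullet> e = pd a (pd b (\<lambda>z. f z \<bullet> e)) y" for a b
  proof -
    have "pd a (pd b (\<lambda>z. f z \<bullet> e)) y = pd a (\<lambda>z. pd b f z \<bullet> e) y"
      by (rule pd_cong_open[OF S]) (use pd_linear(1)[OF L] smooth_on_differentiable[OF f S(1)] in auto)
    also have "\<dots> = pd a (pd b f) y \<bullet> e"
      by (rule pd_linear(1)[OF L]) (use smooth_on_differentiable[OF smooth_on_pd[OF f] S] in auto)
    finally show ?thesis by simp
  qed
  have "Ck_on 2 S (\<lambda>z. f z \<bullet> e)"
    using smooth_on_linear[OF L S(1) f] by (auto simp: smooth_on_def)
  then show "pd a (pd b f) y \<bullet> e = pd b (pd a f) y \<bullet> e"
    using pd_commute_real[OF S] c by simp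
qed

section \<open>Bump functions\<close>

text \<open>
  The family is indexed by \<open>k\<close> because its linear span is closed under differentiation; smoothness
  of \<open>e\<^sup>-\<^sup>1\<^sup>/\<^sup>t\<close> extended by zero then follows by an induction over all \<open>k\<close> at once.
\<close>

definition flat_exp :: "nat \<Rightarrow> real \<Rightarrow> real" where
  "flat_exp k t = (if t > 0 then exp (- (1 / t)) / t ^ k else 0)"

lemma flat_exp_tendsto_0: "(flat_exp k \<longlongrightarrow> 0) (at_right 0)"
proof -
  have "((\<lambda>t::real. inverse t ^ k / exp (inverse t)) \<longlongrightarrow> 0) (at_right 0)"
    by (rule filterlim_compose[OF tendsto_power_div_exp_0 filterlim_inverse_at_top_right])
  then show ?thesis
  proof (rule Lim_transform_eventually)
    show "\<forall>\<^sub>F t in at_right 0. inverse t ^ k / exp (inverse t) = flat_exp k t"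
      by (auto simp: eventually_at_filter flat_exp_def exp_minus field_simps power_inverse)
  qed
qed

lemma DERIV_flat_exp:
  "(flat_exp k has_real_derivative (flat_exp (k + 2) t - real k * flat_exp (k + 1) t)) (at t)"
proof -
  consider "t > 0" | "t < 0" | "t = 0" by linarith
  then show ?thesis
  proof cases
    case 1
    have "((\<lambda>t. exp (- (1 / t)) / t ^ k) has_real_derivative
        (flat_exp (k + 2) t - real k * flat_exp (k + 1) t)) (at t)"
      using 1 by (auto intro!: derivative_eq_intros simp: flat_exp_def)
        (cases k; simp add: field_simps power_add power2_eq_square)
    then show ?thesis
      by (rule has_field_derivative_transform_within_open[OF _ open_greaterThan[of 0]])
        (use 1 in \<open>auto simp: flat_exp_def\<close>)
  next
    case 2
    have "((\<lambda>t. 0) has_real_derivative 0) (at t)" by simp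
    then have "(flat_exp k has_real_derivative 0) (at t)"
      by (rule has_field_derivative_transform_within_open[OF _ open_lessThan[of 0]])
        (use 2 in \<open>auto simp: flat_exp_def\<close>)
    then show ?thesis using 2 by (simp add: flat_exp_def)
  next
    case 3
    have "((\<lambda>h. flat_exp k h / h) \<longlongrightarrow> 0) (at_right 0)"
      by (rule Lim_transform_eventually[OF flat_exp_tendsto_0[of "Suc k"]])
        (auto simp: eventually_at_filter flat_exp_def field_simps)
    moreover have "((\<lambda>h. flat_exp k h / h) \<longlongrightarrow> 0) (at_left 0)"
      by (rule Lim_transform_eventually[OF tendsto_const])
        (auto simp: eventually_at_filter flat_exp_def)
    ultimately have "((\<lambda>h. flat_exp k h / h) \<longlongrightarrow> 0) (at 0)"
      using filterlim_split_at_real by blast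
    then show ?thesis using 3 by (simp add: has_field_derivative_iff flat_exp_def)
  qed
qed

lemma smooth_on_flat_exp:
  fixes f :: "real^4 \<Rightarrow> real"
  assumes S: "open S" and f: "smooth_on S f"
  shows "smooth_on S (\<lambda>y. flat_exp k (f y))"
proof -
  have "Ck_on n S (\<lambda>y. flat_exp k (f y))" for n
  proof (induction n arbitrary: k)
    case 0
    have "continuous_on UNIV (flat_exp k)"
      using DERIV_flat_exp DERIV_isCont continuous_at_imp_continuous_on by blast
    then show ?case using continuous_on_compose2[of UNIV "flat_exp k" S f] smooth_on_continuous[OF f] by simp
  next
    case (Suc n)
    have d: "f differentiable (at y)" if "y \<in> S" for y using smooth_on_differentiable[OF f S that] .
    have "Ck_on n S (pd a (\<lambda>y. flat_exp k (f y)))" for a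
    proof (rule Ck_on_cong[OF S])
      show "Ck_on n S (\<lambda>y. (flat_exp (k + 2) (f y) + (- real k) * flat_exp (k + 1) (f y)) * pd a f y)"
        using smooth_on_pd[OF f]
        by (intro Ck_on_bilinear[OF bounded_bilinear_mult] Ck_on_add S Suc.IH Ck_on_const)
          (simp add: smooth_on_def)
      show "(flat_exp (k + 2) (f y) + (- real k) * flat_exp (k + 1) (f y)) * pd a f y =
         pd a (\<lambda>y. flat_exp k (f y)) y" if "y \<in> S" for y
        using pd_real_compose(1)[OF DERIV_flat_exp d[OF that]] by simp
    qed
    moreover have "(\<lambda>y. flat_exp k (f y)) differentiable_on S"
      using pd_real_compose(2)[OF DERIV_flat_exp d] S
      by (auto simp: differentiable_on_eq_differentiable_at)
    ultimately show ?case by simp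
  qed
  then show ?thesis by (simp add: smooth_on_def)
qed

definition bump :: "real^4 \<Rightarrow> real \<Rightarrow> real^4 \<Rightarrow> real" where
  "bump x r y = flat_exp 0 (r\<^sup>2 - (y - x) \<bullet> (y - x))"

lemma smooth_on_bump: "open S \<Longrightarrow> smooth_on S (bump x r)"
  unfolding bump_def
  by (intro smooth_on_flat_exp smooth_on_diff smooth_on_const smooth_on_ident
      smooth_on_bilinear[OF bounded_bilinear_inner])

lemma bump_nonneg: "bump x r y \<ge> 0"
  by (simp add: bump_def flat_exp_def)

lemma bump_pos: "dist x y < r \<Longrightarrow> bump x r y > 0"
proof -
  assume "dist x y < r"
  then have "norm (y - x) ^ 2 < r ^ 2" by (intro power_strict_mono) (auto simp: dist_norm norm_minus_commute)
  then show ?thesis by (simp add: bump_def flat_exp_def power2_norm_eq_inner)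
qed

lemma bump_zero: "dist x y \<ge> r \<Longrightarrow> r > 0 \<Longrightarrow> bump x r y = 0"
proof -
  assume "dist x y \<ge> r" "r > 0"
  then have "norm (y - x) ^ 2 \<ge> r ^ 2" by (intro power_mono) (auto simp: dist_norm norm_minus_commute)
  then show ?thesis by (simp add: bump_def flat_exp_def power2_norm_eq_inner)
qed

section \<open>Integrals of compactly supported functions\<close>

lemma integrable_compact_support:
  fixes f :: "real^4 \<Rightarrow> 'a::euclidean_space"
  assumes "continuous_on (cball x r) f" "\<And>y. y \<notin> cball x r \<Longrightarrow> f y = 0"
  shows "integrable lborel f"
proof -
  have "integrable lborel (\<lambda>y. indicator (cball x r) y *\<^sub>R f y)"
    by (rule borel_integrable_compact) (use assms in auto)
  moreover have "(\<lambda>y. indicator (cball x r) y *\<^sub>R f y) = f"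
    using assms(2) by (auto simp: indicator_def)
  ultimately show ?thesis by simp
qed

text \<open>
  All translates of \<open>f\<close> have the same integral, so the difference quotients in direction \<open>a\<close> have
  integral zero; dominated convergence passes to their limit.
\<close>

lemma integral_pd_compact_support:
  fixes f :: "real^4 \<Rightarrow> complex"
  assumes d: "\<And>y. f differentiable (at y)" and c: "continuous_on UNIV (pd a f)"
    and z: "\<And>y. y \<notin> cball x r \<Longrightarrow> f y = 0"
  shows "(LINT y|lborel. pd a f y) = 0"
proof -
  let ?e = "axis a 1 :: real^4"
  have cf: "continuous_on UNIV f"
    using d by (simp add: continuous_at_imp_continuous_on differentiable_imp_continuous_within)
  have intf: "integrable lborel f"
    by (rule integrable_compact_support[of x r]) (use cf z continuous_on_subset in blast)+
  have z': "pd a f y = 0" if "y \<notin> cball x r" for y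
  proof -
    have "pd a f y = pd a (\<lambda>_. 0) y"
      by (rule pd_cong_open[of "- cball x r"]) (use z that in auto)
    then show ?thesis by simp
  qed
  have "bounded (pd a f ` cball x r)"
    by (intro compact_imp_bounded compact_continuous_image continuous_on_subset[OF c]) auto
  then obtain B where B: "B > 0" "\<And>y. y \<in> cball x r \<Longrightarrow> norm (pd a f y) \<le> B"
    unfolding bounded_pos by auto
  have B': "norm (pd a f y) \<le> B" for y using B z'[of y] by (cases "y \<in> cball x r") auto
  define t where "t n = inverse (real (Suc n))" for n
  have t: "0 < t n" "t n \<le> 1" "t n \<noteq> 0" for n by (auto simp: t_def field_simps)
  have t0: "t \<longlonglongrightarrow> 0" unfolding t_def by (rule LIMSEQ_inverse_real_of_nat)
  define s where "s n y = (1 / t n) *\<^sub>R (f (y + t n *\<^sub>R ?e) - f y)" for n y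
  have line: "((\<lambda>u. f (y + u *\<^sub>R ?e)) has_derivative (\<lambda>h. h *\<^sub>R pd a f (y + u *\<^sub>R ?e))) (at u)" for y u
    by (rule has_derivative_along_axis[OF d])
  have lim: "(\<lambda>n. s n y) \<longlonglongrightarrow> pd a f y" for y
  proof -
    have "((\<lambda>u. norm (f (y + u *\<^sub>R ?e) - f y - u *\<^sub>R pd a f y) / norm u) \<longlongrightarrow> 0) (at 0)"
      using line[of y 0] unfolding has_derivative_at by simp
    then have "((\<lambda>u. norm ((f (y + u *\<^sub>R ?e) - f y) /\<^sub>R u - pd a f y)) \<longlongrightarrow> 0) (at 0)"
    proof (rule Lim_transform_eventually)
      have "norm (f (y + u *\<^sub>R ?e) - f y - u *\<^sub>R pd a f y) / norm u
        = norm ((f (y + u *\<^sub>R ?e) - f y) /\<^sub>R u - pd a f y)" if "u \<noteq> 0" for u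
      proof -
        have "(f (y + u *\<^sub>R ?e) - f y) /\<^sub>R u - pd a f y = (f (y + u *\<^sub>R ?e) - f y - u *\<^sub>R pd a f y) /\<^sub>R u"
          using that by (simp add: scaleR_diff_right)
        then show ?thesis by (simp add: divide_inverse mult.commute)
      qed
      then show "\<forall>\<^sub>F u in at 0. norm (f (y + u *\<^sub>R ?e) - f y - u *\<^sub>R pd a f y) / norm u
        = norm ((f (y + u *\<^sub>R ?e) - f y) /\<^sub>R u - pd a f y)"
        by (auto simp: eventually_at_filter)
    qed
    then have L: "((\<lambda>u. (f (y + u *\<^sub>R ?e) - f y) /\<^sub>R u) \<longlongrightarrow> pd a f y) (at 0)"
      using Lim_null[of _ "pd a f y"] tendsto_norm_zero_iff by blast
    have "filterlim t (at 0) sequentially" using t0 t(3) by (simp add: filterlim_at)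
    from filterlim_compose[OF L this] show ?thesis by (simp add: s_def inverse_eq_divide)
  qed
  \<comment> \<open>As \<open>t n \<le> 1\<close>, all difference quotients are supported in the ball enlarged by 1.\<close>
  have bound: "norm (s n y) \<le> B * indicator (cball x (r + 1)) y" for n y
  proof (cases "y \<in> cball x (r + 1)")
    case True
    have "norm (f (y + t n *\<^sub>R ?e) - f (y + 0 *\<^sub>R ?e)) \<le> B * norm (t n - 0)"
    proof (rule differentiable_bound[of UNIV "\<lambda>u. f (y + u *\<^sub>R ?e)"])
      show "onorm (\<lambda>h. h *\<^sub>R pd a f (y + u *\<^sub>R ?e)) \<le> B" for u
        by (rule onorm_le) (use mult_right_mono[OF B' abs_ge_zero] in \<open>simp add: mult.commute\<close>)
    qed (use line in auto)
    then have "norm (f (y + t n *\<^sub>R ?e) - f y) / t n \<le> B"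
      using t[of n] by (simp add: divide_le_eq)
    then show ?thesis using True t[of n] by (simp add: s_def del: scaleR_diff_right)
  next
    case False
    then have y: "dist x y > r + 1" by simp
    have "dist y (y + t n *\<^sub>R ?e) \<le> 1" using t[of n] by (simp add: dist_norm)
    then have "dist x (y + t n *\<^sub>R ?e) > r" using y dist_triangle[of x y "y + t n *\<^sub>R ?e"]
      by (simp add: dist_commute)
    then show ?thesis using False y z by (simp add: s_def)
  qed
  have shift: "integrable lborel (\<lambda>y. f (y + v))" "(LINT y|lborel. f (y + v)) = (LINT y|lborel. f y)" for v
  proof -
    have "integrable (distr lborel borel ((+) v)) f" using intf by (simp add: lborel_distr_plus)
    then show "integrable lborel (\<lambda>y. f (y + v))"
      by (subst (asm) integrable_distr_eq) (use intf in \<open>auto simp: add.commute\<close>)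
    have "(LINT y|lborel. f y) = (LINT y|distr lborel borel ((+) v). f y)" by (simp add: lborel_distr_plus)
    also have "\<dots> = (LINT y|lborel. f (v + y))" by (rule integral_distr) (use intf in auto)
    finally show "(LINT y|lborel. f (y + v)) = (LINT y|lborel. f y)" by (simp add: add.commute)
  qed
  have s0: "(LINT y|lborel. s n y) = 0" for n
    unfolding s_def using shift intf by simp
  have "(\<lambda>n. LINT y|lborel. s n y) \<longlonglongrightarrow> (LINT y|lborel. pd a f y)"
  proof (rule integral_dominated_convergence[where w="\<lambda>y. B * indicator (cball x (r + 1)) y"])
    show "pd a f \<in> borel_measurable lborel" using c borel_measurable_continuous_onI by auto
    show "s n \<in> borel_measurable lborel" for n
      unfolding s_def using shift(1) intf by (intro borel_measurable_scaleR borel_measurable_diff) auto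
    show "integrable lborel (\<lambda>y. B * indicator (cball x (r + 1)) y)"
      by (intro integrable_mult_right integrable_real_indicator) (use emeasure_lborel_cball_finite[of x "r + 1"] in \<open>auto simp: infinity_ennreal_def\<close>)
  qed (use lim bound in auto)
  then show ?thesis using s0 LIMSEQ_unique by (simp add: LIMSEQ_const_iff)
qed

text \<open>
  If \<open>G x \<noteq> 0\<close>, then the inner product of \<open>G\<close> with \<open>G x\<close> is positive on a ball about \<open>x\<close>, and a bump
  supported there has positive integral against it.
\<close>

lemma continuous_zero_if_bump_integrals_zero:
  fixes G :: "real^4 \<Rightarrow> complex"
  assumes S: "open S" "x \<in> S" and G: "continuous_on S G"
    and int: "\<And>r. r > 0 \<Longrightarrow> cball x r \<subseteq> S \<Longrightarrow> (LINT y|lborel. bump x r y *\<^sub>R G y) = 0"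
  shows "G x = 0"
proof (rule ccontr)
  assume ne: "G x \<noteq> 0"
  have "isCont G x" using S G continuous_on_eq_continuous_at by blast
  then obtain d where d: "d > 0" "\<And>y. dist y x < d \<Longrightarrow> dist (G y) (G x) < norm (G x)"
    using ne unfolding continuous_at_eps_delta by (metis zero_less_norm_iff)
  obtain r0 where r0: "r0 > 0" "cball x r0 \<subseteq> S" using S open_contains_cball by blast
  define r where "r = min r0 (d / 2)"
  have r: "r > 0" "cball x r \<subseteq> S" "r < d" using d r0 by (auto simp: r_def)
  define H where "H y = bump x r y * (G y \<bullet> G x)" for y
  have pos: "G y \<bullet> G x > 0" if "y \<in> cball x r" for y
  proof -
    have "norm (G y - G x) < norm (G x)" using d(2)[of y] that r by (simp add: dist_norm norm_minus_commute)
    then have "(norm (G y - G x))\<^sup>2 < (norm (G x))\<^sup>2" by (intro power_strict_mono) auto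
    then have "G y \<bullet> G y - 2 * (G y \<bullet> G x) < 0"
      by (simp add: power2_norm_eq_inner inner_diff inner_commute)
    then show ?thesis using inner_ge_zero[of "G y"] by linarith
  qed
  have bz: "bump x r y = 0" if "y \<notin> cball x r" for y using bump_zero[of r x y] that r by auto
  have cb: "continuous_on A (bump x r)" for A
    using smooth_on_continuous[OF smooth_on_bump[OF open_UNIV]] continuous_on_subset by blast
  have iG: "integrable lborel (\<lambda>y. bump x r y *\<^sub>R G y)"
    by (rule integrable_compact_support[of x r])
      (use cb bz r G in \<open>auto intro!: continuous_intros intro: continuous_on_subset\<close>)
  have H: "H = (\<lambda>y. (bump x r y *\<^sub>R G y) \<bullet> G x)" by (auto simp: H_def)
  have iH: "integrable lborel H" "(LINT y|lborel. H y) = 0"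
    unfolding H using integrable_inner_left[of "G x", OF iG] integral_inner_left[of "G x", OF iG]
      int[OF r(1,2)] by simp_all
  have nn: "H y \<ge> 0" for y
    using bump_nonneg[of x r y] pos[of y] bz[of y] by (cases "y \<in> cball x r") (auto simp: H_def)
  have "AE y in lborel. H y = 0"
    using integral_nonneg_eq_0_iff_AE[OF iH(1)] iH(2) nn by auto
  then have "AE y in lborel. y \<notin> ball x r"
  proof eventually_elim
    case (elim y)
    then show ?case using pos[of y] bump_pos[of x y r] by (auto simp: H_def)
  qed
  then have "emeasure lborel (ball x r) = 0"
    by (subst (asm) AE_iff_measurable[OF _ refl]) (auto simp: ball_def)
  then show False using content_ball_pos[OF r(1), of x] by (simp add: measure_def)
qed

section \<open>The Levi-Civita symbol\<close>

lemma det_4: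
  "det (A :: 'a::comm_ring_1^4^4) =
     A$1$1 * (A$2$2 * (A$3$3 * A$4$4 - A$3$4 * A$4$3) - A$2$3 * (A$3$2 * A$4$4 - A$3$4 * A$4$2) + A$2$4 * (A$3$2 * A$4$3 - A$3$3 * A$4$2))
   - A$1$2 * (A$2$1 * (A$3$3 * A$4$4 - A$3$4 * A$4$3) - A$2$3 * (A$3$1 * A$4$4 - A$3$4 * A$4$1) + A$2$4 * (A$3$1 * A$4$3 - A$3$3 * A$4$1))
   + A$1$3 * (A$2$1 * (A$3$2 * A$4$4 - A$3$4 * A$4$2) - A$2$2 * (A$3$1 * A$4$4 - A$3$4 * A$4$1) + A$2$4 * (A$3$1 * A$4$2 - A$3$2 * A$4$1))
   - A$1$4 * (A$2$1 * (A$3$2 * A$4$3 - A$3$3 * A$4$2) - A$2$2 * (A$3$1 * A$4$3 - A$3$3 * A$4$1) + A$2$3 * (A$3$1 * A$4$2 - A$3$2 * A$4$1))"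
proof -
  have f1: "finite {2::4, 3, 4}" "1 \<notin> {2::4, 3, 4}"
    and f2: "finite {3::4, 4}" "2 \<notin> {3::4, 4}" and f3: "finite {4::4}" "3 \<notin> {4::4}" by auto
  show ?thesis
    unfolding det_def UNIV_4
    unfolding sum_over_permutations_insert[OF f1]
    unfolding sum_over_permutations_insert[OF f2]
    unfolding sum_over_permutations_insert[OF f3]
    unfolding permutes_sing
    by (simp add: sign_swap_id permutation_swap_id sign_compose sign_id swap_id_eq algebra_simps
        permutation_compose)
qed

lemma vector_4:
  "(vector [x, y, z, w] :: 'a::zero^4) $ 1 = x" "(vector [x, y, z, w] :: 'a^4) $ 2 = y"
  "(vector [x, y, z, w] :: 'a^4) $ 3 = z" "(vector [x, y, z, w] :: 'a^4) $ 4 = w"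
  unfolding vector_def by simp_all

text \<open>
  The type \<open>4\<close> is cyclic, with \<open>4 = 0\<close>; here its elements are put in the order \<open>1, 2, 3, 4\<close>.
\<close>

definition idx :: "4 \<Rightarrow> real" where
  "idx a = (if a = 1 then 1 else if a = 2 then 2 else if a = 3 then 3 else 4)"

lemma idx_simps: "idx 1 = 1" "idx 2 = 2" "idx 3 = 3" "idx 4 = 4"
  by (simp_all add: idx_def)

lemma axis_4_nth:
  fixes a :: 4
  shows "axis a (1::real) $ a = 1"
  "axis 1 (1::real) $ (2::4) = 0" "axis 1 (1::real) $ (3::4) = 0" "axis 1 (1::real) $ (4::4) = 0"
  "axis 2 (1::real) $ (1::4) = 0" "axis 2 (1::real) $ (3::4) = 0" "axis 2 (1::real) $ (4::4) = 0"
  "axis 3 (1::real) $ (1::4) = 0" "axis 3 (1::real) $ (2::4) = 0" "axis 3 (1::real) $ (4::4) = 0"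
  "axis 4 (1::real) $ (1::4) = 0" "axis 4 (1::real) $ (2::4) = 0" "axis 4 (1::real) $ (3::4) = 0"
  by (simp_all add: axis_def)

text \<open>
  The Vandermonde product of the indices is alternating, and equals 12 at \<open>(1, 2, 3, 4)\<close>.  In this form
  identities between values of the symbol become polynomial identities or finite arithmetic.
\<close>

lemma levi_civita_vandermonde:
  "levi_civita a b c d = (idx b - idx a) * (idx c - idx a) * (idx d - idx a) *
     (idx c - idx b) * (idx d - idx b) * (idx d - idx c) / 12"
  unfolding levi_civita_def det_4 vector_4
  using exhaust_4[of a] exhaust_4[of b] exhaust_4[of c] exhaust_4[of d]
  by (elim disjE; hypsubst; simp add: axis_4_nth idx_simps)

lemma levi_civita_swap:
  "levi_civita b a c d = - levi_civita a b c d"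
  "levi_civita a c b d = - levi_civita a b c d"
  "levi_civita a b d c = - levi_civita a b c d"
  unfolding levi_civita_vandermonde by (simp_all add: field_simps)

lemma levi_civita_contract:
  "(\<^bold>\<Sum>c d. levi_civita a b c d * levi_civita c d k l)
     = 2 * ((if a = k then 1 else 0) * (if b = l then 1 else 0) - (if a = l then 1 else 0) * (if b = k then 1 else 0))"
proof -
  have "\<forall>a b k l. (\<^bold>\<Sum>c d. levi_civita a b c d * levi_civita c d k l)
     = 2 * ((if a = k then 1 else 0) * (if b = l then 1 else 0) - (if a = l then 1 else 0) * (if b = k then 1 else 0))"
    by (simp add: forall_4 sum_4 levi_civita_vandermonde idx_simps)
  then show ?thesis by blast
qed

text \<open>
  Both sides are the determinant of the matrix with rows \<open>A\<^sub>a, A\<^sub>b, A\<^sub>c, A\<^sub>d\<close>: on the left by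
  multilinearity in the rows, on the right as a product of matrices.
\<close>

lemma det_vector_levi_civita:
  fixes A :: "real^4^4"
  shows "(\<^bold>\<Sum>e f g h. A $ a $ e * A $ b $ f * A $ c $ g * A $ d $ h * levi_civita e f g h) = det A * levi_civita a b c d"
proof -
  have "(vector [axis a 1, axis b 1, axis c 1, axis d 1] :: real^4^4) ** A = vector [A $ a, A $ b, A $ c, A $ d]"
  proof -
    have row: "(\<^bold>\<Sum>k. axis i (1::real) $ k * A $ k $ j) = A $ i $ j" for i j
      by (simp add: axis_def if_distrib if_distribR cong: if_cong)
    have "((vector [axis a 1, axis b 1, axis c 1, axis d 1] :: real^4^4) ** A) $ i $ j
        = vector [A $ a, A $ b, A $ c, A $ d] $ i $ j" for i j
      using exhaust_4[of i] by (elim disjE; hypsubst; simp add: vector_4 matrix_matrix_mult_def row)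
    then show ?thesis by (simp add: vec_eq_iff)
  qed
  then have "det A * levi_civita a b c d = det (vector [A $ a, A $ b, A $ c, A $ d] :: real^4^4)"
    unfolding levi_civita_def by (metis det_mul mult.commute)
  also have "\<dots> = (\<^bold>\<Sum>e f g h. A $ a $ e * A $ b $ f * A $ c $ g * A $ d $ h * levi_civita e f g h)"
    by (simp add: det_4 vector_4 sum_4 levi_civita_vandermonde idx_simps algebra_simps)
  finally show ?thesis by simp
qed

section \<open>Contraction with the Levi-Civita symbol\<close>

lemmas scaleR_complex = scaleR_conv_of_real[where 'a = complex]

definition cmat :: "real^'n^'m \<Rightarrow> complex^'n^'m" where
  "cmat A = (\<chi> i j. of_real (A $ i $ j))"

lemma cmat_nth [simp]: "cmat A $ i $ j = of_real (A $ i $ j)" by (simp add: cmat_def)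

lemma cmat_mult: "cmat (A ** B) = cmat A ** cmat B"
  by (simp add: vec_eq_iff matrix_matrix_mult_def)

lemma cmat_transpose: "cmat (transpose A) = transpose (cmat A)"
  by (simp add: vec_eq_iff transpose_def)

lemma cmat_mat_1: "cmat (mat 1) = mat 1"
  by (simp add: vec_eq_iff mat_def)

lemma cmat_scaleR: "cmat (t *\<^sub>R A) = t *\<^sub>R cmat A"
  by (simp add: vec_eq_iff scaleR_complex)

lemma matrix_scaleR_left: "(k *\<^sub>R A) ** B = k *\<^sub>R (A ** B)" for A :: "('a::real_algebra_1)^'m^'n"
  by (simp add: scalar_matrix_assoc)

lemma matrix_scaleR_right: "A ** (k *\<^sub>R B) = k *\<^sub>R (A ** B)" for A :: "('a::real_algebra_1)^'m^'n"
  by (simp add: matrix_scalar_ac scalar_matrix_assoc)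

abbreviation (input) raised :: "real^4^4 \<Rightarrow> complex^4^4 \<Rightarrow> complex^4^4" where
  "raised h u \<equiv> cmat (matrix_inv h) ** u ** transpose (cmat (matrix_inv h))"

abbreviation (input) pullback :: "real^4^4 \<Rightarrow> complex^4^4 \<Rightarrow> complex^4^4" where
  "pullback J u \<equiv> transpose (cmat J) ** u ** cmat J"

lemma matrix_conj_nth:
  fixes A :: "'a::comm_semiring_1^'n^'m"
  shows "(A ** w ** transpose B) $ i $ j = (\<^bold>\<Sum>k l. A $ i $ k * B $ j $ l * w $ k $ l)"
  unfolding matrix_matrix_mult_def transpose_def
  by (simp add: sum_distrib_left sum_distrib_right mult.assoc mult.left_commute mult.commute)
    (rule sum.swap)

lemma pullback_nth:
  "(pullback J w) $ a $ b = (\<^bold>\<Sum>k l. of_real (J $ k $ a * J $ l $ b) * w $ k $ l)"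
  using matrix_conj_nth[of "transpose (cmat J)" w "transpose (cmat J)" a b]
  by (simp add: transpose_transpose) (simp add: transpose_def)

text \<open>
  The part of the Hodge star that contains no metric.
\<close>

definition eps2 :: "complex^4^4 \<Rightarrow> complex^4^4" where
  "eps2 u = (\<chi> a b. \<^bold>\<Sum>c d. of_real (levi_civita a b c d) * u $ c $ d)"

lemma eps2_scaleR: "eps2 (t *\<^sub>R u) = t *\<^sub>R eps2 u"
  by (simp add: eps2_def vec_eq_iff scaleR_sum_right)

lemma eps2_antisym: "eps2 u $ b $ a = - eps2 u $ a $ b"
  by (simp add: eps2_def levi_civita_swap(1)[of b a] sum_negf)

lemma eps2_eps2:
  assumes "\<And>a b. u $ b $ a = - u $ a $ b"
  shows "eps2 (eps2 u) = 4 *\<^sub>R u"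
proof -
  have "eps2 (eps2 u) $ a $ b = 4 * u $ a $ b" for a b
  proof -
    have "eps2 (eps2 u) $ a $ b = (\<^bold>\<Sum>c d k l. of_real (levi_civita a b c d * levi_civita c d k l) * u $ k $ l)"
      by (simp add: eps2_def sum_distrib_left mult.assoc)
    also have "\<dots> = (\<^bold>\<Sum>c k d l. of_real (levi_civita a b c d * levi_civita c d k l) * u $ k $ l)"
      by (intro sum.cong refl sum.swap)
    also have "\<dots> = (\<^bold>\<Sum>k c l d. of_real (levi_civita a b c d * levi_civita c d k l) * u $ k $ l)"
      by (subst sum.swap) (intro sum.cong refl sum.swap)
    also have "\<dots> = (\<^bold>\<Sum>k l c d. of_real (levi_civita a b c d * levi_civita c d k l) * u $ k $ l)"
      by (intro sum.cong refl sum.swap)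
    also have "\<dots> = (\<^bold>\<Sum>k l. of_real (\<^bold>\<Sum>c d. levi_civita a b c d * levi_civita c d k l) * u $ k $ l)"
      by (simp add: sum_distrib_right)
    also have "\<dots> = (\<^bold>\<Sum>k l. of_real (2 * ((if a = k then 1 else 0) * (if b = l then 1 else 0)
       - (if a = l then 1 else 0) * (if b = k then 1 else 0))) * u $ k $ l)"
      by (simp only: levi_civita_contract)
    also have "\<dots> = (\<^bold>\<Sum>k l. (if a = k then (if b = l then 2 * u $ k $ l else 0) else 0))
        - (\<^bold>\<Sum>k l. (if b = k then (if a = l then 2 * u $ k $ l else 0) else 0))"
      unfolding sum_subtractf[symmetric] by (intro sum.cong refl) auto
    also have "(\<^bold>\<Sum>k l. (if a = k then (if b = l then 2 * u $ k $ l else 0) else 0)) = 2 * u $ a $ b"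
      by (subst sum.cong[OF refl, where h = "\<lambda>k. if a = k then 2 * u $ k $ b else 0"]) auto
    also have "(\<^bold>\<Sum>k l. (if b = k then (if a = l then 2 * u $ k $ l else 0) else 0)) = 2 * u $ b $ a"
      by (subst sum.cong[OF refl, where h = "\<lambda>k. if b = k then 2 * u $ k $ a else 0"]) auto
    finally show ?thesis using assms[where a=a and b=b] by simp
  qed
  then show ?thesis by (simp add: vec_eq_iff scaleR_complex)
qed

lemma sum_swap4:
  "(\<^bold>\<Sum>k l a b. f k l a b) = (\<^bold>\<Sum>a b k l. f k l a b)"
  for f :: "'a::finite \<Rightarrow> 'b::finite \<Rightarrow> 'c::finite \<Rightarrow> 'd::finite \<Rightarrow> 'e::comm_monoid_add"
proof -
  have "(\<^bold>\<Sum>k l a b. f k l a b) = (\<^bold>\<Sum>k a l b. f k l a b)"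
    by (intro sum.cong refl sum.swap)
  also have "\<dots> = (\<^bold>\<Sum>a k b l. f k l a b)"
    by (subst sum.swap) (intro sum.cong refl sum.swap)
  also have "\<dots> = (\<^bold>\<Sum>a b k l. f k l a b)"
    by (intro sum.cong refl sum.swap)
  finally show ?thesis .
qed

text \<open>
  The Levi-Civita symbol is a tensor density: transforming all four indices by \<open>A\<close> multiplies it by
  \<open>det A\<close>.
\<close>

lemma eps2_conj:
  fixes A :: "real^4^4"
  shows "cmat A ** eps2 (pullback A w) ** transpose (cmat A) = det A *\<^sub>R eps2 w"
proof -
  have "(cmat A ** eps2 (pullback A w) ** transpose (cmat A)) $ i $ j
      = of_real (det A) * eps2 w $ i $ j" for i j
  proof -
    have "(cmat A ** eps2 (pullback A w) ** transpose (cmat A)) $ i $ j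
      = (\<^bold>\<Sum>a b. of_real (A $ i $ a * A $ j $ b) * (\<^bold>\<Sum>c d. of_real (levi_civita a b c d) * (\<^bold>\<Sum>k l. of_real (A $ k $ c * A $ l $ d) * w $ k $ l)))"
      unfolding matrix_conj_nth by (simp add: eps2_def pullback_nth)
    also have "\<dots> = (\<^bold>\<Sum>a b. (\<^bold>\<Sum>k l. (\<^bold>\<Sum>c d. of_real (A $ i $ a * A $ j $ b * A $ k $ c * A $ l $ d * levi_civita a b c d) * w $ k $ l)))"
    proof (intro sum.cong refl)
      fix a b
      have "of_real (A $ i $ a * A $ j $ b) * (\<^bold>\<Sum>c d. of_real (levi_civita a b c d) * (\<^bold>\<Sum>k l. of_real (A $ k $ c * A $ l $ d) * w $ k $ l))
        = (\<^bold>\<Sum>c d k l. of_real (A $ i $ a * A $ j $ b * A $ k $ c * A $ l $ d * levi_civita a b c d) * w $ k $ l)"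
        by (simp add: sum_distrib_left ac_simps)
      also have "\<dots> = (\<^bold>\<Sum>k l c d. of_real (A $ i $ a * A $ j $ b * A $ k $ c * A $ l $ d * levi_civita a b c d) * w $ k $ l)"
        by (rule sum_swap4)
      finally show "of_real (A $ i $ a * A $ j $ b) * (\<^bold>\<Sum>c d. of_real (levi_civita a b c d) * (\<^bold>\<Sum>k l. of_real (A $ k $ c * A $ l $ d) * w $ k $ l))
        = (\<^bold>\<Sum>k l. (\<^bold>\<Sum>c d. of_real (A $ i $ a * A $ j $ b * A $ k $ c * A $ l $ d * levi_civita a b c d) * w $ k $ l))" .
    qed
    also have "\<dots> = (\<^bold>\<Sum>k l a b c d. of_real (A $ i $ a * A $ j $ b * A $ k $ c * A $ l $ d * levi_civita a b c d) * w $ k $ l)"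
      by (rule sum_swap4)
    also have "\<dots> = (\<^bold>\<Sum>k l. of_real (\<^bold>\<Sum>a b c d. A $ i $ a * A $ j $ b * A $ k $ c * A $ l $ d * levi_civita a b c d) * w $ k $ l)"
      by (simp add: sum_distrib_right)
    also have "\<dots> = of_real (det A) * eps2 w $ i $ j"
      unfolding det_vector_levi_civita by (simp add: eps2_def sum_distrib_left mult.assoc)
    finally show ?thesis .
  qed
  then show ?thesis by (simp add: vec_eq_iff scaleR_complex)
qed

section \<open>The Hodge star on 2-forms\<close>

lemma hodge_eps2:
  "hodge h u = (sqrt \<bar>det h\<bar> / 2) *\<^sub>R
     eps2 (raised h u)"
proof -
  have "hodge h u $ a $ b = of_real (sqrt \<bar>det h\<bar> / 2) *
     eps2 (raised h u) $ a $ b" for a b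
    unfolding hodge_def eps2_def matrix_conj_nth
    by (simp add: sum_distrib_left mult.assoc mult.left_commute)
  then show ?thesis by (simp add: vec_eq_iff scaleR_complex)
qed

lemma matrix_inv_unique:
  fixes A :: "'a::field^'n^'n"
  assumes "A ** B = mat 1"
  shows "matrix_inv A = B"
proof -
  have "invertible A" using assms invertible_right_inverse by blast
  then have "matrix_inv A ** A = mat 1" using matrix_inv_mult(2) invertible_det_nz by blast
  then show ?thesis using assms by (metis matrix_mul_assoc matrix_mul_lid matrix_mul_rid)
qed

lemma matrix_inv_symmetric:
  fixes h :: "'a::field^'n^'n"
  assumes "transpose h = h" "det h \<noteq> 0"
  shows "transpose (matrix_inv h) = matrix_inv h"
proof -
  have "h ** transpose (matrix_inv h) = transpose (matrix_inv h ** h)"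
    using assms by (simp add: matrix_transpose_mul)
  also have "\<dots> = mat 1" using matrix_inv_mult(2)[OF assms(2)] by simp
  finally show ?thesis using matrix_inv_unique by metis
qed

lemma det_matrix_inv:
  fixes h :: "'a::field^'n^'n"
  assumes "det h \<noteq> 0" shows "det (matrix_inv h) = inverse (det h)"
  using matrix_inv_mult(1)[OF assms] by (metis det_mul det_I inverse_unique)

lemma matrix_inv_symmetric_nth:
  fixes h :: "'a::field^'n^'n"
  assumes "transpose h = h" "det h \<noteq> 0"
  shows "matrix_inv h $ i $ j = matrix_inv h $ j $ i"
  using arg_cong[OF matrix_inv_symmetric[OF assms], of "\<lambda>A. A $ j $ i"] by (simp add: transpose_def)

lemma matrix_inv_congruence:
  fixes J h :: "'a::field^'n^'n"
  assumes "det J \<noteq> 0" "det h \<noteq> 0"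
  shows "matrix_inv (transpose J ** h ** J) = matrix_inv J ** matrix_inv h ** transpose (matrix_inv J)"
    and "J ** matrix_inv (transpose J ** h ** J) ** transpose J = matrix_inv h"
proof -
  note J = matrix_inv_mult[OF assms(1)] and h = matrix_inv_mult[OF assms(2)]
  have Jt: "transpose J ** transpose (matrix_inv J) = mat 1" "transpose (matrix_inv J) ** transpose J = mat 1"
    using J by (metis matrix_transpose_mul transpose_mat)+
  have "(transpose J ** h ** J) ** (matrix_inv J ** matrix_inv h ** transpose (matrix_inv J))
     = transpose J ** (h ** (J ** matrix_inv J) ** matrix_inv h) ** transpose (matrix_inv J)"
    by (simp add: matrix_mul_assoc)
  also have "\<dots> = mat 1" by (simp add: J h Jt)
  finally show i: "matrix_inv (transpose J ** h ** J) = matrix_inv J ** matrix_inv h ** transpose (matrix_inv J)"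
    by (rule matrix_inv_unique)
  have "J ** matrix_inv (transpose J ** h ** J) ** transpose J
    = (J ** matrix_inv J) ** matrix_inv h ** (transpose (matrix_inv J) ** transpose J)"
    unfolding i by (simp add: matrix_mul_assoc)
  then show "J ** matrix_inv (transpose J ** h ** J) ** transpose J = matrix_inv h" by (simp add: J Jt)
qed

text \<open>
  The inverse metrics that raise the indices of \<open>\<star> u\<close> and those inside the star together transform all
  four indices of the Levi-Civita symbol, so \<open>eps2_conj\<close> leaves nothing of the metric but its
  determinant.
\<close>

lemma raise_hodge:
  assumes "transpose h = h" "det h \<noteq> 0"
  shows "raised h (hodge h u)
    = (sgn (det h) / (2 * sqrt \<bar>det h\<bar>)) *\<^sub>R eps2 u"
proof -
  have sym: "transpose (cmat (matrix_inv h)) = cmat (matrix_inv h)"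
    using matrix_inv_symmetric[OF assms] by (metis cmat_transpose)
  have "raised h (eps2 (raised h u))
    = det (matrix_inv h) *\<^sub>R eps2 u"
    using eps2_conj[of "matrix_inv h" u] unfolding sym by simp
  then have "raised h (hodge h u)
    = (sqrt \<bar>det h\<bar> / 2 * inverse (det h)) *\<^sub>R eps2 u"
    by (simp add: hodge_eps2 matrix_scaleR_left matrix_scaleR_right det_matrix_inv[OF assms(2)])
  also have "sqrt \<bar>det h\<bar> / 2 * inverse (det h) = sgn (det h) / (2 * sqrt \<bar>det h\<bar>)"
  proof -
    have "sqrt \<bar>det h\<bar> * sqrt \<bar>det h\<bar> = sgn (det h) * det h" by (auto simp: sgn_if abs_if)
    moreover have "r / 2 * inverse d = s / (2 * r)" if "r * r = s * d" "r \<noteq> 0" "d \<noteq> 0" for r d s :: real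
      using that by (simp add: field_simps)
    moreover have "sqrt \<bar>det h\<bar> \<noteq> 0" using assms(2) by simp
    ultimately show ?thesis using assms(2) by blast
  qed
  finally show ?thesis .
qed

lemma hodge_hodge:
  assumes "transpose h = h" "det h \<noteq> 0" "\<And>a b. u $ b $ a = - u $ a $ b"
  shows "hodge h (hodge h u) = sgn (det h) *\<^sub>R u"
proof -
  have "hodge h (hodge h u) = (sqrt \<bar>det h\<bar> / 2) *\<^sub>R (sgn (det h) / (2 * sqrt \<bar>det h\<bar>)) *\<^sub>R 4 *\<^sub>R u"
    by (subst hodge_eps2) (simp add: raise_hodge[OF assms(1,2)] eps2_scaleR eps2_eps2[OF assms(3)])
  then show ?thesis using assms(2) by simp
qed

text \<open>
  The conformal invariance of the star in middle degree: the density contributes \<open>t\<^sup>2\<close>, the two inverse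
  metrics \<open>t\<^sup>-\<^sup>2\<close>.
\<close>

lemma hodge_rescale:
  assumes "t > 0" "det h \<noteq> 0"
  shows "hodge (t *\<^sub>R h) u = hodge h u"
proof -
  have "(t *\<^sub>R h) ** (inverse t *\<^sub>R matrix_inv h) = mat 1"
    using matrix_inv_mult(1)[OF assms(2)] assms(1) by (simp add: matrix_scaleR_left matrix_scaleR_right)
  then have i: "matrix_inv (t *\<^sub>R h) = inverse t *\<^sub>R matrix_inv h" by (rule matrix_inv_unique)
  have "det (t *\<^sub>R h) = (t\<^sup>2)\<^sup>2 * det h" by (simp add: det_4) algebra
  then have "\<bar>det (t *\<^sub>R h)\<bar> = (t\<^sup>2)\<^sup>2 * \<bar>det h\<bar>" by (simp only: abs_mult abs_power2)
  then have d: "sqrt \<bar>det (t *\<^sub>R h)\<bar> = t\<^sup>2 * sqrt \<bar>det h\<bar>"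
    by (simp only: real_sqrt_mult real_sqrt_abs abs_power2)
  have tr: "transpose (s *\<^sub>R A) = s *\<^sub>R transpose A" for s and A :: "complex^4^4"
    by (simp add: transpose_def vec_eq_iff)
  show ?thesis
    unfolding hodge_eps2 d i cmat_scaleR tr matrix_scaleR_left matrix_scaleR_right eps2_scaleR
    using assms(1) by (simp add: field_simps power2_eq_square)
qed

text \<open>
  The density scales by \<open>\<bar>det J\<bar>\<close> and the Levi-Civita symbol by \<open>det J\<close>, so the star is natural under
  maps that preserve the orientation.
\<close>

lemma hodge_pullback:
  assumes "det J > 0" "det h \<noteq> 0"
  shows "hodge (transpose J ** h ** J) (pullback J u)
    = pullback J (hodge h u)"
proof -
  let ?J = "cmat J" and ?I = "cmat (matrix_inv J)" and ?H = "cmat (matrix_inv h)"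
  have J: "det J \<noteq> 0" using assms by simp
  have cJ: "?J ** ?I = mat 1" using matrix_inv_mult(1)[OF J] by (metis cmat_mult cmat_mat_1)
  then have cJt: "transpose ?I ** transpose ?J = mat 1" by (metis matrix_transpose_mul transpose_mat)
  note i = matrix_inv_congruence(1)[OF J assms(2)]
  let ?w = "?I ** (?H ** u ** transpose ?H) ** transpose ?I"
  have w: "cmat (matrix_inv (transpose J ** h ** J)) ** (transpose ?J ** u ** ?J) **
      transpose (cmat (matrix_inv (transpose J ** h ** J))) = ?w"
  proof -
    have "cmat (matrix_inv (transpose J ** h ** J)) ** (transpose ?J ** u ** ?J) **
      transpose (cmat (matrix_inv (transpose J ** h ** J)))
      = ?I ** ?H ** (transpose ?I ** transpose ?J) ** u ** (?J ** ?I) ** transpose ?H ** transpose ?I"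
      by (simp add: i cmat_mult cmat_transpose matrix_transpose_mul matrix_mul_assoc)
    then show ?thesis by (simp add: cJ cJt matrix_mul_assoc)
  qed
  have "?J ** ?w ** transpose ?J = (?J ** ?I) ** (?H ** u ** transpose ?H) ** (transpose ?I ** transpose ?J)"
    by (simp add: matrix_mul_assoc)
  then have Jw: "?J ** ?w ** transpose ?J = ?H ** u ** transpose ?H" by (simp add: cJ cJt)
  have "transpose ?J ** eps2 (?J ** ?w ** transpose ?J) ** ?J = det J *\<^sub>R eps2 ?w"
    using eps2_conj[of "transpose J" ?w] by (simp add: cmat_transpose)
  then have e: "det J *\<^sub>R eps2 ?w = transpose ?J ** eps2 (?H ** u ** transpose ?H) ** ?J"
    using Jw by simp
  have d: "sqrt \<bar>det (transpose J ** h ** J)\<bar> = sqrt \<bar>det h\<bar> * det J"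
    using assms(1) by (simp add: det_mul abs_mult real_sqrt_mult)
  have "hodge (transpose J ** h ** J) (transpose ?J ** u ** ?J)
      = (sqrt \<bar>det h\<bar> / 2) *\<^sub>R (det J *\<^sub>R eps2 ?w)"
    unfolding hodge_eps2 w d by simp
  also have "\<dots> = transpose ?J ** hodge h u ** ?J"
    unfolding e hodge_eps2 by (simp add: matrix_scaleR_left matrix_scaleR_right)
  finally show ?thesis .
qed


section \<open>Eigenspaces of the Hodge star\<close>

definition skew :: "'a::uminus^'n^'n \<Rightarrow> bool" where
  "skew u \<longleftrightarrow> (\<forall>a b. u $ a $ b = - u $ b $ a)"

text \<open>
  For \<open>\<mu>\<^sup>2 = \<star>\<^sup>2\<close> this is the projection onto the \<open>\<mu>\<close>-eigenspace of the star along the \<open>-\<mu>\<close>-eigenspace.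
\<close>

definition half_proj :: "real^4^4 \<Rightarrow> complex \<Rightarrow> complex^4^4 \<Rightarrow> complex^4^4" where
  "half_proj h \<mu> u = (\<chi> a b. (u $ a $ b + hodge h u $ a $ b / \<mu>) / 2)"

text \<open>
  The pairing \<open>pair2\<close> for scalar 2-forms.
\<close>

definition ip2 :: "real^4^4 \<Rightarrow> complex^4^4 \<Rightarrow> complex^4^4 \<Rightarrow> complex" where
  "ip2 h u v = (1/2) * (\<^bold>\<Sum>a b. u $ a $ b *
     raised h v $ a $ b)"

text \<open>
  Four times the coefficient of \<open>u \<and> v\<close> with respect to \<open>dx\<^sup>1 \<and> dx\<^sup>2 \<and> dx\<^sup>3 \<and> dx\<^sup>4\<close>.
\<close>

definition wedge2 :: "complex^4^4 \<Rightarrow> complex^4^4 \<Rightarrow> complex" where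
  "wedge2 u v = (\<^bold>\<Sum>a b. u $ a $ b * eps2 v $ a $ b)"

lemma pair2_ip2: "pair2 h v w = (\<^bold>\<Sum>s. ip2 h (\<chi> a b. v $ a $ b $ s) (\<chi> a b. w $ a $ b $ s))"
proof -
  have "(\<^bold>\<Sum>s. ip2 h (\<chi> a b. v $ a $ b $ s) (\<chi> a b. w $ a $ b $ s))
    = (1/2) * (\<^bold>\<Sum>s a b c d. of_real (matrix_inv h $ a $ c * matrix_inv h $ b $ d) * (v $ a $ b $ s * w $ c $ d $ s))"
    unfolding ip2_def matrix_conj_nth sum_distrib_left[symmetric]
    by (simp add: sum_distrib_left ac_simps)
  also have "\<dots> = (1/2) * (\<^bold>\<Sum>a b s c d. of_real (matrix_inv h $ a $ c * matrix_inv h $ b $ d) * (v $ a $ b $ s * w $ c $ d $ s))"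
    by (subst sum.swap) (intro arg_cong[where f = "(*) (1/2)"] sum.cong refl sum.swap)
  also have "\<dots> = (1/2) * (\<^bold>\<Sum>a b c d s. of_real (matrix_inv h $ a $ c * matrix_inv h $ b $ d) * (v $ a $ b $ s * w $ c $ d $ s))"
    by (intro arg_cong[where f = "(*) (1/2)"] sum.cong refl, subst sum.swap)
      (intro sum.cong refl sum.swap)
  also have "\<dots> = pair2 h v w"
    unfolding pair2_def dualpair_def by (simp add: sum_distrib_left)
  finally show ?thesis by simp
qed

lemma sum_swap4':
  fixes f :: "4 \<Rightarrow> 4 \<Rightarrow> 4 \<Rightarrow> 4 \<Rightarrow> 'a::comm_monoid_add"
  shows "(\<^bold>\<Sum>a b c d. f a b c d)
       = (\<^bold>\<Sum>a b c d. f c d a b)"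
  by (rule sum_swap4)

lemma wedge2_sym: "wedge2 u v = wedge2 v u"
proof -
  have lc: "levi_civita a b c d = levi_civita c d a b" for a b c d
    unfolding levi_civita_vandermonde by (simp add: algebra_simps)
  have "wedge2 u v = (\<^bold>\<Sum>a b c d. u $ a $ b * v $ c $ d * of_real (levi_civita a b c d))"
    by (simp add: wedge2_def eps2_def sum_distrib_left ac_simps)
  also have "\<dots> = (\<^bold>\<Sum>a b c d. u $ c $ d * v $ a $ b * of_real (levi_civita c d a b))"
    by (rule sum_swap4')
  also have "\<dots> = (\<^bold>\<Sum>a b c d. u $ c $ d * v $ a $ b * of_real (levi_civita a b c d))"
    by (intro sum.cong refl, subst lc, rule refl)
  also have "\<dots> = wedge2 v u"
    by (simp add: wedge2_def eps2_def sum_distrib_left ac_simps)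
  finally show ?thesis .
qed

lemma ip2_sym:
  assumes "transpose h = h" "det h \<noteq> 0"
  shows "ip2 h u v = ip2 h v u"
proof -
  have sym: "matrix_inv h $ i $ j = matrix_inv h $ j $ i" for i j
    by (rule matrix_inv_symmetric_nth[OF assms])
  have "(\<^bold>\<Sum>a b. u $ a $ b * (\<^bold>\<Sum>c d. cmat (matrix_inv h) $ a $ c * cmat (matrix_inv h) $ b $ d * v $ c $ d))
    = (\<^bold>\<Sum>a b c d. u $ a $ b * v $ c $ d * (cmat (matrix_inv h) $ a $ c * cmat (matrix_inv h) $ b $ d))" for u v
    by (simp add: sum_distrib_left ac_simps)
  note e = this
  have "(\<^bold>\<Sum>a b c d. u $ a $ b * v $ c $ d * (cmat (matrix_inv h) $ a $ c * cmat (matrix_inv h) $ b $ d))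
    = (\<^bold>\<Sum>a b c d. u $ c $ d * v $ a $ b * (cmat (matrix_inv h) $ c $ a * cmat (matrix_inv h) $ d $ b))"
    by (rule sum_swap4')
  also have "\<dots> = (\<^bold>\<Sum>a b c d. v $ a $ b * u $ c $ d * (cmat (matrix_inv h) $ a $ c * cmat (matrix_inv h) $ b $ d))"
    by (intro sum.cong refl, subst (1 2) cmat_nth, subst (1 2) sym) (simp add: mult.commute)
  finally show ?thesis unfolding ip2_def matrix_conj_nth e by simp
qed

lemma ip2_hodge:
  assumes "transpose h = h" "det h \<noteq> 0"
  shows "of_real (sqrt \<bar>det h\<bar>) * ip2 h u (hodge h v) = of_real (sgn (det h)) / 4 * wedge2 u v"
proof -
  have "ip2 h u (hodge h v) = of_real (sgn (det h) / (2 * sqrt \<bar>det h\<bar>)) / 2 * wedge2 u v"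
    by (simp add: ip2_def raise_hodge[OF assms] wedge2_def scaleR_complex sum_distrib_left sum_divide_distrib ac_simps)
  then show ?thesis using assms by simp
qed

text \<open>
  Both sides are multiples of \<open>u \<and> v\<close>, and 2-forms commute.
\<close>

lemma ip2_hodge_sym:
  assumes "transpose h = h" "det h \<noteq> 0"
  shows "ip2 h (hodge h u) v = ip2 h u (hodge h v)"
proof -
  have "of_real (sqrt \<bar>det h\<bar>) * ip2 h (hodge h u) v = of_real (sqrt \<bar>det h\<bar>) * ip2 h u (hodge h v)"
    unfolding ip2_hodge[OF assms] ip2_sym[OF assms, of "hodge h u"] wedge2_sym[of v] by simp
  then show ?thesis using assms by simp
qed

lemma ip2_linear_right:
  "ip2 h u (\<chi> a b. (v $ a $ b + w $ a $ b / \<mu>) / 2) = (ip2 h u v + ip2 h u w / \<mu>) / 2"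
  unfolding ip2_def matrix_conj_nth
  by (simp add: sum_distrib_left sum_divide_distrib sum.distrib algebra_simps add_divide_distrib)

lemma ip2_linear_left:
  "ip2 h (\<chi> a b. (u $ a $ b + w $ a $ b / \<mu>) / 2) v = (ip2 h u v + ip2 h w v / \<mu>) / 2"
  unfolding ip2_def
  by (simp add: sum_distrib_left sum_divide_distrib sum.distrib algebra_simps add_divide_distrib)

lemma ip2_scaleR_right: "ip2 h u (t *\<^sub>R v) = of_real t * ip2 h u v"
  unfolding ip2_def matrix_scaleR_left matrix_scaleR_right
  by (simp add: scaleR_complex sum_distrib_left ac_simps)

text \<open>
  The projection \<open>P\<close> is self-adjoint and idempotent, so \<open>2 \<langle>P u, P v\<rangle> = 2 \<langle>u, P v\<rangle> = \<langle>u, v\<rangle> + \<mu>\<^sup>-\<^sup>1 \<langle>u, \<star> v\<rangle>\<close>.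
  What remains is a multiple of \<open>u \<and> v\<close> by \<open>ip2_hodge\<close>.
\<close>

lemma ip2_half_proj:
  assumes h: "transpose h = h" "det h \<noteq> 0" and \<mu>: "\<mu>\<^sup>2 = of_real (sgn (det h))" and v: "skew v"
  shows "of_real (sqrt \<bar>det h\<bar>) * (ip2 h u v - 2 * ip2 h (half_proj h \<mu> u) (half_proj h \<mu> v))
    = - (\<mu> / 4) * wedge2 u v"
proof -
  have \<mu>0: "\<mu> \<noteq> 0" using \<mu> h by (auto simp: sgn_if split: if_splits)
  have vv: "hodge h (hodge h v) = sgn (det h) *\<^sub>R v"
    using hodge_hodge[OF h] v by (metis skew_def)
  have 1: "ip2 h (hodge h u) (hodge h v) = \<mu>\<^sup>2 * ip2 h u v"
    unfolding ip2_hodge_sym[OF h] vv ip2_scaleR_right \<mu> by simp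
  have "2 * ip2 h (half_proj h \<mu> u) (half_proj h \<mu> v) = ip2 h u v + ip2 h u (hodge h v) / \<mu>"
    unfolding half_proj_def ip2_linear_right ip2_linear_left 1 unfolding ip2_hodge_sym[OF h]
    using \<mu>0 by (simp add: field_simps power2_eq_square)
  then have "of_real (sqrt \<bar>det h\<bar>) * (ip2 h u v - 2 * ip2 h (half_proj h \<mu> u) (half_proj h \<mu> v))
     = - (of_real (sqrt \<bar>det h\<bar>) * ip2 h u (hodge h v)) / \<mu>" by simp
  also have "\<dots> = - (\<mu>\<^sup>2 / 4 * wedge2 u v) / \<mu>" unfolding ip2_hodge[OF h] \<mu> by simp
  finally show ?thesis using \<mu>0 by (simp add: field_simps power2_eq_square)
qed

text \<open>
  For an eigenform of the star \<open>raise_hodge\<close> says how its indices are raised without the metric.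
\<close>

lemma raise_eigen:
  assumes h: "transpose h = h" "det h \<noteq> 0" and \<mu>: "\<mu>\<^sup>2 = of_real (sgn (det h))"
    and F: "hodge h F = (\<chi> a b. - \<mu> * F $ a $ b)"
  shows "of_real (sqrt \<bar>det h\<bar>) * raised h F $ a $ b
    = - (\<mu> / 2) * eps2 F $ a $ b"
proof -
  let ?R = "raised h"
  have \<mu>0: "\<mu> \<noteq> 0" using \<mu> h by (auto simp: sgn_if split: if_splits)
  have "?R (hodge h F) $ a $ b = - \<mu> * ?R F $ a $ b"
    unfolding F matrix_conj_nth by (simp add: sum_distrib_left sum_negf ac_simps)
  then have "- \<mu> * ?R F $ a $ b = of_real (sgn (det h) / (2 * sqrt \<bar>det h\<bar>)) * eps2 F $ a $ b"
    unfolding raise_hodge[OF h] by (simp add: scaleR_complex)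
  then have "of_real (sqrt \<bar>det h\<bar>) * (- \<mu> * ?R F $ a $ b) = \<mu>\<^sup>2 / 2 * eps2 F $ a $ b"
    using h by (simp add: \<mu>)
  then have "\<mu> * (of_real (sqrt \<bar>det h\<bar>) * ?R F $ a $ b) = \<mu> * (- (\<mu> / 2) * eps2 F $ a $ b)"
    by (simp add: power2_eq_square field_simps) algebra
  then show ?thesis using \<mu>0 mult_left_cancel by blast
qed

lemma skew_hodge: "skew (hodge h u)"
  unfolding skew_def hodge_eps2 vector_scaleR_component
  by (intro allI, subst eps2_antisym) (rule scaleR_minus_right)

lemma hodge_linear:
  "hodge h (\<chi> a b. x * u $ a $ b + z * v $ a $ b) = (\<chi> a b. x * hodge h u $ a $ b + z * hodge h v $ a $ b)"
  unfolding hodge_def by (simp add: vec_eq_iff sum_distrib_left sum.distrib algebra_simps)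

lemma hodge_half_proj:
  assumes h: "transpose h = h" "det h \<noteq> 0" and \<mu>: "\<mu>\<^sup>2 = of_real (sgn (det h))" and u: "skew u"
  shows "hodge h (half_proj h \<mu> u) = (\<chi> a b. \<mu> * half_proj h \<mu> u $ a $ b)"
    and "hodge h (u - half_proj h \<mu> u) = (\<chi> a b. - \<mu> * (u - half_proj h \<mu> u) $ a $ b)"
proof -
  have \<mu>0: "\<mu> \<noteq> 0" using \<mu> h by (auto simp: sgn_if split: if_splits)
  have uu: "hodge h (hodge h u) $ a $ b = \<mu>\<^sup>2 * u $ a $ b" for a b
  proof -
    have "u $ b $ a = - u $ a $ b" for a b using u unfolding skew_def by blast
    then have "hodge h (hodge h u) = sgn (det h) *\<^sub>R u" by (rule hodge_hodge[OF h])
    then show ?thesis by (simp add: \<mu> scaleR_complex)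
  qed
  have e: "half_proj h \<mu> u = (\<chi> a b. 1/2 * u $ a $ b + 1/(2*\<mu>) * hodge h u $ a $ b)"
    "u - half_proj h \<mu> u = (\<chi> a b. 1/2 * u $ a $ b + (- 1/(2*\<mu>)) * hodge h u $ a $ b)"
    by (simp_all add: half_proj_def vec_eq_iff field_simps)
  show "hodge h (half_proj h \<mu> u) = (\<chi> a b. \<mu> * half_proj h \<mu> u $ a $ b)"
    unfolding e(1) hodge_linear using \<mu>0 by (simp add: vec_eq_iff uu field_simps power2_eq_square)
  show "hodge h (u - half_proj h \<mu> u) = (\<chi> a b. - \<mu> * (u - half_proj h \<mu> u) $ a $ b)"
    unfolding e(2) hodge_linear using \<mu>0 by (simp add: vec_eq_iff uu field_simps power2_eq_square)
qed

lemma half_proj_unique: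
  assumes "\<mu> \<noteq> 0" "hodge h v = (\<chi> a b. \<mu> * v $ a $ b)" "hodge h (u - v) = (\<chi> a b. - \<mu> * (u - v) $ a $ b)"
  shows "v = half_proj h \<mu> u"
proof -
  have "hodge h (\<chi> a b. 1 * v $ a $ b + 1 * (u - v) $ a $ b)
      = (\<chi> a b. 1 * hodge h v $ a $ b + 1 * hodge h (u - v) $ a $ b)" by (rule hodge_linear)
  moreover have "(\<chi> a b. 1 * v $ a $ b + 1 * (u - v) $ a $ b) = u" by (simp add: vec_eq_iff)
  ultimately have "hodge h u $ a $ b = \<mu> * v $ a $ b - \<mu> * (u $ a $ b - v $ a $ b)" for a b
    using assms(2,3) by simp
  then show ?thesis using assms(1) by (simp add: half_proj_def vec_eq_iff field_simps)
qed

lemma skew_half_proj: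
  assumes "skew u" shows "skew (half_proj h \<mu> u)"
  unfolding skew_def
proof (intro allI)
  fix a b
  have "u $ a $ b = - u $ b $ a" "hodge h u $ a $ b = - hodge h u $ b $ a"
    using assms skew_hodge[of h u] unfolding skew_def by blast+
  then show "half_proj h \<mu> u $ a $ b = - half_proj h \<mu> u $ b $ a"
    by (simp add: half_proj_def diff_divide_distrib add_divide_distrib)
qed

lemma half_proj_pullback:
  assumes "det J > 0" "det h \<noteq> 0"
  shows "half_proj (transpose J ** h ** J) \<mu> (pullback J u)
    = pullback J (half_proj h \<mu> u)"
proof -
  have "(pullback J (half_proj h \<mu> u)) $ a $ b
    = ((pullback J u) $ a $ b + (pullback J (hodge h u)) $ a $ b / \<mu>) / 2" for a b
    unfolding pullback_nth half_proj_def
    by (simp add: sum_divide_distrib sum.distrib algebra_simps add_divide_distrib)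
  then show ?thesis
    by (simp add: half_proj_def[of "transpose J ** h ** J"] hodge_pullback[OF assms] vec_eq_iff)
qed

section \<open>Charts and transition maps\<close>

lemma bounded_bilinear_matrix_vector:
  "bounded_bilinear (\<lambda>(A :: complex^'n^'m) v. A *v v)"
proof -
  have "bilinear (\<lambda>(A :: complex^'n^'m) v. A *v v)"
    unfolding bilinear_def
    by (auto intro!: linearI simp: matrix_vector_mult_def vec_eq_iff algebra_simps sum.distrib scaleR_sum_right)
  then show ?thesis by (simp add: bilinear_conv_bounded_bilinear)
qed

lemma bounded_bilinear_matrix_matrix:
  "bounded_bilinear (\<lambda>(A :: complex^'n^'m) (B :: complex^'k^'n). A ** B)"
proof -
  have "bilinear (\<lambda>(A :: complex^'n^'m) (B :: complex^'k^'n). A ** B)"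
    unfolding bilinear_def
    by (auto intro!: linearI simp: matrix_matrix_mult_def vec_eq_iff algebra_simps sum.distrib scaleR_sum_right)
  then show ?thesis by (simp add: bilinear_conv_bounded_bilinear)
qed

lemma bounded_linear_transpose: "bounded_linear (transpose :: complex^'n^'m \<Rightarrow> _)"
  unfolding linear_conv_bounded_linear[symmetric]
  by (auto intro!: linearI simp: transpose_def vec_eq_iff)

definition transition :: "('m, 'i) mfd \<Rightarrow> 'i \<Rightarrow> 'i \<Rightarrow> real^4 \<Rightarrow> real^4" where
  "transition N i j y = crd N j (chart_inv N i y)"

definition overlap :: "('m, 'i) mfd \<Rightarrow> 'i \<Rightarrow> 'i \<Rightarrow> (real^4) set" where
  "overlap N i j = crd N i ` (dom N i \<inter> dom N j)"

locale oriented_mfd =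
  fixes N :: "('m, 'i) mfd"
  assumes N: "oriented_manifold N"
begin

lemma homeomorphic_crd: "homeomorphic_map (subtopology (mtop N) (dom N i)) (top_of_set (cdom N i)) (crd N i)"
  using N by (simp add: oriented_manifold_def)

lemma openin_dom: "openin (mtop N) (dom N i)"
  using N by (simp add: oriented_manifold_def)

lemma open_cdom: "open (cdom N i)"
  using N by (simp add: oriented_manifold_def)

lemma dom_subset: "dom N i \<subseteq> topspace (mtop N)"
  using openin_dom openin_subset by blast

lemma topspace_sub: "topspace (subtopology (mtop N) (dom N i)) = dom N i"
  using dom_subset by auto

lemma inj_crd: "inj_on (crd N i) (dom N i)"
  using homeomorphic_imp_injective_map[OF homeomorphic_crd] topspace_sub by metis

lemma chart_inv_crd [simp]: "p \<in> dom N i \<Longrightarrow> chart_inv N i (crd N i p) = p"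
  unfolding chart_inv_def by (rule inv_into_f_f[OF inj_crd])

lemma crd_in_cdom [simp]: "p \<in> dom N i \<Longrightarrow> crd N i p \<in> cdom N i"
  by (simp add: cdom_def)

lemma chart_inv_dom [simp]: "y \<in> cdom N i \<Longrightarrow> chart_inv N i y \<in> dom N i"
  by (auto simp: cdom_def)

lemma crd_chart_inv [simp]: "y \<in> cdom N i \<Longrightarrow> crd N i (chart_inv N i y) = y"
  by (auto simp: cdom_def)

lemma open_crd_image:
  assumes "openin (mtop N) U"
  shows "open (crd N i ` (dom N i \<inter> U))"
proof -
  have "openin (subtopology (mtop N) (dom N i)) (dom N i \<inter> U)"
    using assms by (simp add: openin_subtopology_Int2)
  then have "openin (top_of_set (cdom N i)) (crd N i ` (dom N i \<inter> U))"
    using homeomorphic_map_openness[OF homeomorphic_crd] topspace_sub by (metis inf_le1)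
  then show ?thesis using open_cdom openin_open_eq by blast
qed

lemma open_overlap: "open (overlap N i j)"
  unfolding overlap_def by (rule open_crd_image[OF openin_dom])

lemma overlapE:
  assumes "y \<in> overlap N i j"
  obtains p where "p \<in> dom N i" "p \<in> dom N j" "y = crd N i p" "chart_inv N i y = p"
    "transition N i j y = crd N j p"
  using assms by (auto simp: overlap_def transition_def)

lemma overlap_crd: "p \<in> dom N i \<Longrightarrow> p \<in> dom N j \<Longrightarrow> crd N i p \<in> overlap N i j"
  by (auto simp: overlap_def)

lemma transition_crd: "p \<in> dom N i \<Longrightarrow> transition N i j (crd N i p) = crd N j p"
  by (simp add: transition_def)

lemma transition_overlap: "transition N i j ` overlap N i j \<subseteq> overlap N j i"
  by (auto elim!: overlapE simp: overlap_crd)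

lemma smooth_transition: "smooth_on (overlap N i j) (transition N i j)"
  using N unfolding oriented_manifold_def overlap_def transition_def[abs_def] by blast

lemma transition_differentiable: "y \<in> overlap N i j \<Longrightarrow> transition N i j differentiable (at y)"
  using smooth_on_differentiable[OF smooth_transition open_overlap] .

lemma jac_transition: "p \<in> dom N i \<Longrightarrow> jac N i j p $ b $ a = pd a (transition N i j) (crd N i p) $ b"
  by (simp add: jac_def transition_def[abs_def])

lemma det_jac: "p \<in> dom N i \<Longrightarrow> p \<in> dom N j \<Longrightarrow> det (jac N i j p) > 0"
  using N by (simp add: oriented_manifold_def)

lemma jac_self: "p \<in> dom N i \<Longrightarrow> jac N i i p = mat 1"
proof -
  assume p: "p \<in> dom N i"
  have "pd a (transition N i i) (crd N i p) = pd a (\<lambda>y. y) (crd N i p)" for a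
    by (rule pd_cong_open[OF open_cdom[of i]]) (use p in \<open>auto simp: transition_def\<close>)
  also have "pd a (\<lambda>y. y) y = axis a 1" for a and y :: "real^4"
    using pd_eqI[OF has_derivative_ident] by simp
  finally show ?thesis using p by (simp add: vec_eq_iff jac_transition mat_def axis_def)
qed

lemma jac_cocycle:
  assumes p: "p \<in> dom N i" "p \<in> dom N j" "p \<in> dom N k"
  shows "jac N i k p = jac N j k p ** jac N i j p"
proof -
  let ?y = "crd N i p"
  define S where "S = crd N i ` (dom N i \<inter> (dom N j \<inter> dom N k))"
  have S: "open S" "?y \<in> S"
    using p by (auto simp: S_def intro: open_crd_image openin_Int openin_dom)
  have "pd a (transition N i k) ?y = (\<^bold>\<Sum>b. pd a (transition N i j) ?y $ b *\<^sub>R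
      pd b (transition N j k) (transition N i j ?y))" for a
  proof -
    have "pd a (transition N i k) ?y = pd a (\<lambda>z. transition N j k (transition N i j z)) ?y"
      by (rule pd_cong_open[OF S]) (auto simp: S_def transition_def)
    also have "\<dots> = (\<^bold>\<Sum>b. pd a (transition N i j) ?y $ b *\<^sub>R
      pd b (transition N j k) (transition N i j ?y))"
      by (rule pd_compose) (use p in \<open>auto intro!: transition_differentiable simp: overlap_crd transition_crd\<close>)
    finally show ?thesis .
  qed
  then show ?thesis
    using p by (simp add: vec_eq_iff matrix_matrix_mult_def jac_transition transition_crd mult.commute)
qed

definition jacf :: "'i \<Rightarrow> 'i \<Rightarrow> real^4 \<Rightarrow> real^4^4" where
  "jacf i j y = jac N i j (chart_inv N i y)"

lemma jacf_nth: "y \<in> overlap N i j \<Longrightarrow> jacf i j y $ b $ a = pd a (transition N i j) y $ b"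
  by (auto elim!: overlapE simp: jacf_def jac_transition)

lemma smooth_jacf: "smooth_on (overlap N i j) (jacf i j)"
proof (intro smooth_on_componentwise open_overlap)
  fix b a
  show "smooth_on (overlap N i j) (\<lambda>y. jacf i j y $ b $ a)"
  proof (rule smooth_on_cong[OF open_overlap])
    show "smooth_on (overlap N i j) (\<lambda>y. pd a (transition N i j) y $ b)"
      by (intro smooth_on_vec_nth open_overlap smooth_on_pd smooth_transition)
  qed (simp add: jacf_nth)
qed

text \<open>
  Both sides are second derivatives of the transition map.
\<close>

lemma pd_jacf_sym:
  assumes y: "y \<in> overlap N i j"
  shows "pd c (\<lambda>z. jacf i j z $ b $ a) y = pd a (\<lambda>z. jacf i j z $ b $ c) y"
proof -
  have e: "pd c (\<lambda>z. jacf i j z $ b $ a) y = pd c (pd a (transition N i j)) y $ b" for c a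
  proof -
    have "pd c (\<lambda>z. jacf i j z $ b $ a) y = pd c (\<lambda>z. pd a (transition N i j) z $ b) y"
      by (rule pd_cong_open[OF open_overlap y]) (simp add: jacf_nth)
    also have "\<dots> = pd c (pd a (transition N i j)) y $ b"
      by (intro pd_linear(1) bounded_linear_vec_nth smooth_on_differentiable[OF _ open_overlap y]
          smooth_on_pd smooth_transition)
    finally show ?thesis .
  qed
  show ?thesis unfolding e using pd_commute[OF open_overlap y smooth_transition] by simp
qed

lemma smooth_pull:
  assumes "smooth_on (overlap N j i) f"
  shows "smooth_on (overlap N i j) (\<lambda>y. f (transition N i j y))"
  by (rule smooth_on_compose[OF open_overlap open_overlap transition_overlap assms smooth_transition])

end

section \<open>Bundles with connection and their duals\<close>

definition scalar_field :: "complex set \<Rightarrow> bool" where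
  "scalar_field K \<longleftrightarrow> K = \<real> \<or> K = UNIV"

lemma scalar_field_closed:
  assumes "scalar_field K"
  shows "x \<in> K \<Longrightarrow> y \<in> K \<Longrightarrow> x + y \<in> K" "x \<in> K \<Longrightarrow> y \<in> K \<Longrightarrow> x - y \<in> K"
    "x \<in> K \<Longrightarrow> y \<in> K \<Longrightarrow> x * y \<in> K" "x \<in> K \<Longrightarrow> - x \<in> K" "of_real t \<in> K" "0 \<in> K" "1 \<in> K"
    "x \<in> K \<Longrightarrow> t *\<^sub>R x \<in> K"
    "(\<And>i. i \<in> I \<Longrightarrow> h i \<in> K) \<Longrightarrow> sum h I \<in> K"
  using assms by (auto simp: scalar_field_def scaleR_conv_of_real intro: Reals_minus)

lemma pd_scalar_field:
  assumes K: "scalar_field K" and S: "open S" "y \<in> S" and f: "f differentiable (at y)" "\<And>z. z \<in> S \<Longrightarrow> f z \<in> K"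
  shows "pd a f y \<in> K"
proof (cases "K = UNIV")
  case False
  then have [simp]: "K = \<real>" using K by (simp add: scalar_field_def)
  have "Im (pd a f y) = pd a (\<lambda>z. Im (f z)) y"
    by (rule pd_linear(1)[OF bounded_linear_Im f(1), symmetric])
  also have "\<dots> = pd a (\<lambda>_. 0) y"
    by (rule pd_cong_open[OF S]) (use f(2) in \<open>auto simp: complex_is_Real_iff\<close>)
  finally show ?thesis by (simp add: complex_is_Real_iff)
qed simp

locale connection_bundle = oriented_mfd N for N :: "('m, 'i) mfd" +
  fixes K :: "complex set" and V :: "('m, 'i, 'r::finite) vbundle"
  assumes K: "scalar_field K" and V: "bundle_with_connection N K V"
begin

lemma trans_self: "p \<in> dom N i \<Longrightarrow> trans V i i p = mat 1"
  using V by (simp add: bundle_with_connection_def)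

lemma trans_cocycle:
  "\<lbrakk>p \<in> dom N i; p \<in> dom N j; p \<in> dom N k\<rbrakk> \<Longrightarrow> trans V i j p ** trans V j k p = trans V i k p"
  using V by (simp add: bundle_with_connection_def)

lemma trans_K: "\<lbrakk>p \<in> dom N i; p \<in> dom N j\<rbrakk> \<Longrightarrow> trans V i j p $ s $ t \<in> K"
  using V by (simp add: bundle_with_connection_def)

lemma smooth_trans: "smooth_on (overlap N i j) (\<lambda>y. trans V i j (chart_inv N i y))"
  using V unfolding bundle_with_connection_def overlap_def by blast

lemma smooth_conn: "smooth_on (cdom N i) (conn V i)"
  using V by (simp add: bundle_with_connection_def)

lemma conn_K: "y \<in> cdom N i \<Longrightarrow> conn V i y $ a $ s $ t \<in> K"
  using V by (simp add: bundle_with_connection_def)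

lemma conn_transform:
  "\<lbrakk>p \<in> dom N i; p \<in> dom N j\<rbrakk> \<Longrightarrow> conn V i (crd N i p) $ a ** trans V i j p
           + pd a (\<lambda>y. trans V i j (chart_inv N i y)) (crd N i p)
         = trans V i j p ** (\<^bold>\<Sum>b. jac N i j p $ b $ a *\<^sub>R conn V j (crd N j p) $ b)"
  using V by (simp add: bundle_with_connection_def)

lemma trans_inverse: "\<lbrakk>p \<in> dom N i; p \<in> dom N j\<rbrakk> \<Longrightarrow> trans V i j p ** trans V j i p = mat 1"
  using trans_cocycle[of p i j i] trans_self by simp

lemma matrix_inv_trans: "\<lbrakk>p \<in> dom N i; p \<in> dom N j\<rbrakk> \<Longrightarrow> matrix_inv (trans V i j p) = trans V j i p"
  using matrix_inv_unique trans_inverse by blast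

lemma trans_dual: "\<lbrakk>p \<in> dom N i; p \<in> dom N j\<rbrakk> \<Longrightarrow> trans (dual V) i j p = transpose (trans V j i p)"
  by (simp add: dual_def matrix_inv_trans)

lemma conn_dual: "conn (dual V) i y $ a = - transpose (conn V i y $ a)"
  by (simp add: dual_def)

lemma smooth_trans_rev: "smooth_on (overlap N i j) (\<lambda>y. trans V j i (chart_inv N i y))"
proof (rule smooth_on_cong[OF open_overlap])
  show "smooth_on (overlap N i j) (\<lambda>y. trans V j i (chart_inv N j (transition N i j y)))"
    by (rule smooth_pull[OF smooth_trans])
qed (auto elim!: overlapE)

text \<open>
  The transformation law of the connection, with the derivative of the transition matrix eliminated in
  favour of that of its inverse: differentiate \<open>T T\<^sup>-\<^sup>1 = 1\<close>.
\<close>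

lemma conn_transform_inverse:
  assumes p: "p \<in> dom N i" "p \<in> dom N j"
  shows "- (trans V j i p ** conn V i (crd N i p) $ a) + pd a (\<lambda>y. trans V j i (chart_inv N i y)) (crd N i p)
         = - ((\<^bold>\<Sum>b. jac N i j p $ b $ a *\<^sub>R conn V j (crd N j p) $ b) ** trans V j i p)"
proof -
  let ?y = "crd N i p" and ?T = "trans V i j p" and ?R = "trans V j i p"
  let ?dT = "pd a (\<lambda>y. trans V i j (chart_inv N i y)) ?y"
  let ?dR = "pd a (\<lambda>y. trans V j i (chart_inv N i y)) ?y"
  let ?A = "conn V i ?y $ a" and ?B = "\<^bold>\<Sum>b. jac N i j p $ b $ a *\<^sub>R conn V j (crd N j p) $ b"
  have y: "?y \<in> overlap N i j" using p overlap_crd by blast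
  have "pd a (\<lambda>z. trans V i j (chart_inv N i z) ** trans V j i (chart_inv N i z)) ?y = ?T ** ?dR + ?dT ** ?R"
    using pd_bilinear(1)[OF bounded_bilinear_matrix_matrix smooth_on_differentiable[OF smooth_trans open_overlap y]
      smooth_on_differentiable[OF smooth_trans_rev open_overlap y]] p by simp
  moreover have "pd a (\<lambda>z. trans V i j (chart_inv N i z) ** trans V j i (chart_inv N i z)) ?y = pd a (\<lambda>_. mat 1) ?y"
    by (rule pd_cong_open[OF open_overlap y]) (auto elim!: overlapE simp: trans_inverse)
  ultimately have D: "?T ** ?dR = - (?dT ** ?R)" by (simp add: add_eq_0_iff2)
  have RT: "?R ** ?T = mat 1" "?T ** ?R = mat 1" using trans_inverse p by auto
  have neg: "X ** (- Y) = - (X ** Y)" "(- X) ** Y = - (X ** Y)" for X Y :: "complex^'r^'r"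
    by (simp_all add: matrix_matrix_mult_def vec_eq_iff sum_negf)
  have sub: "X ** (Y - Z) = X ** Y - X ** Z" "(Y - Z) ** X = Y ** X - Z ** X" for X Y Z :: "complex^'r^'r"
    by (simp_all add: matrix_matrix_mult_def vec_eq_iff sum_subtractf algebra_simps)
  have "?dR = ?R ** (?T ** ?dR)" by (simp add: matrix_mul_assoc RT)
  also have "\<dots> = - (?R ** ?dT ** ?R)" unfolding D by (simp add: neg matrix_mul_assoc)
  also have "?dT = ?T ** ?B - ?A ** ?T" using conn_transform[OF p, of a] by (simp add: algebra_simps)
  also have "?R ** (?T ** ?B - ?A ** ?T) ** ?R = (?R ** ?T) ** ?B ** ?R - ?R ** ?A ** (?T ** ?R)"
    by (simp add: sub matrix_mul_assoc)
  finally show ?thesis by (simp add: RT)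
qed

text \<open>
  The transformation law for \<open>- A\<^sup>T\<close> is the transpose of \<open>conn_transform_inverse\<close>.
\<close>

lemma dual_bundle: "bundle_with_connection N K (dual V)"
  unfolding bundle_with_connection_def
proof (intro conjI allI ballI)
  fix i p assume "p \<in> dom N i"
  then show "trans (dual V) i i p = mat 1" by (simp add: trans_dual trans_self)
next
  fix i j k p assume "p \<in> dom N i \<inter> dom N j \<inter> dom N k"
  then show "trans (dual V) i j p ** trans (dual V) j k p = trans (dual V) i k p"
    by (simp add: trans_dual matrix_transpose_mul[symmetric] trans_cocycle)
next
  fix i j p s t assume "p \<in> dom N i \<inter> dom N j"
  then show "trans (dual V) i j p $ s $ t \<in> K" by (simp add: trans_dual transpose_def trans_K)
next
  fix i j
  show "smooth_on (crd N i ` (dom N i \<inter> dom N j)) (\<lambda>y. trans (dual V) i j (chart_inv N i y))"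
    unfolding overlap_def[symmetric]
  proof (rule smooth_on_cong[OF open_overlap])
    show "smooth_on (overlap N i j) (\<lambda>y. transpose (trans V j i (chart_inv N i y)))"
      by (rule smooth_on_linear[OF bounded_linear_transpose open_overlap smooth_trans_rev])
  qed (auto elim!: overlapE simp: trans_dual)
next
  fix i show "smooth_on (cdom N i) (conn (dual V) i)"
    by (rule smooth_on_componentwise[OF open_cdom], unfold conn_dual,
      intro smooth_on_minus open_cdom smooth_on_linear[OF bounded_linear_transpose]
        smooth_on_vec_nth smooth_conn)
next
  fix i y a s t assume "y \<in> cdom N i"
  then show "conn (dual V) i y $ a $ s $ t \<in> K"
    by (simp add: conn_dual transpose_def conn_K scalar_field_closed(4)[OF K])
next
  fix i j p a assume "p \<in> dom N i \<inter> dom N j"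
  then have p: "p \<in> dom N i" "p \<in> dom N j" by auto
  let ?y = "crd N i p"
  have y: "?y \<in> overlap N i j" using p overlap_crd by blast
  have "pd a (\<lambda>y. trans (dual V) i j (chart_inv N i y)) ?y
     = pd a (\<lambda>y. transpose (trans V j i (chart_inv N i y))) ?y"
    by (rule pd_cong_open[OF open_overlap y]) (auto elim!: overlapE simp: trans_dual)
  also have "\<dots> = transpose (pd a (\<lambda>y. trans V j i (chart_inv N i y)) ?y)"
    by (intro pd_linear(1) bounded_linear_transpose smooth_on_differentiable[OF smooth_trans_rev open_overlap y])
  finally have d: "pd a (\<lambda>y. trans (dual V) i j (chart_inv N i y)) ?y
     = transpose (pd a (\<lambda>y. trans V j i (chart_inv N i y)) ?y)" .
  have neg: "X ** (- Y) = - (X ** Y)" "(- X) ** Y = - (X ** Y)" for X Y :: "complex^'r^'r"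
    by (simp_all add: matrix_matrix_mult_def vec_eq_iff sum_negf)
  have ta: "transpose (X + Y) = transpose X + transpose Y" "transpose (- X) = - transpose X"
    "transpose (X - Y) = transpose X - transpose Y" for X Y :: "complex^'r^'r"
    by (simp_all add: transpose_def vec_eq_iff)
  have ts: "(\<^bold>\<Sum>b. jac N i j p $ b $ a *\<^sub>R conn (dual V) j (crd N j p) $ b)
      = - transpose (\<^bold>\<Sum>b. jac N i j p $ b $ a *\<^sub>R conn V j (crd N j p) $ b)"
    by (simp add: conn_dual transpose_def vec_eq_iff sum_negf)
  show "conn (dual V) i (crd N i p) $ a ** trans (dual V) i j p
           + pd a (\<lambda>y. trans (dual V) i j (chart_inv N i y)) (crd N i p)
         = trans (dual V) i j p ** (\<^bold>\<Sum>b. jac N i j p $ b $ a *\<^sub>R conn (dual V) j (crd N j p) $ b)"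
    unfolding d ts using arg_cong[OF conn_transform_inverse[OF p, of a], of transpose] p
    by (simp add: trans_dual conn_dual ta neg matrix_transpose_mul)
qed

lemma connection_bundle_dual: "connection_bundle N K (dual V)"
  by unfold_locales (rule K, rule dual_bundle)

end

section \<open>Covariance of the exterior derivatives\<close>

lemma covd_cong_open:
  assumes "open S" "y \<in> S" "\<And>z. z \<in> S \<Longrightarrow> s z = t z"
  shows "covd V i a s y = covd V i a t y"
  using pd_cong_open[OF assms] assms(2,3) by (simp add: covd_def)

lemma matrix_vector_mult_scaleR_complex: "A *v (c *\<^sub>R v) = c *\<^sub>R (A *v v)" for A :: "complex^'n^'m"
  by (simp add: matrix_vector_mult_def vec_eq_iff scaleR_sum_right)

lemma covd_scaleR:
  assumes "f differentiable (at y)" "s differentiable (at y)"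
  shows "covd V i a (\<lambda>z. f z *\<^sub>R s z) y = pd a f y *\<^sub>R s y + f y *\<^sub>R covd V i a s y"
  using pd_bilinear(1)[OF bounded_bilinear_scaleR assms]
  by (simp add: covd_def matrix_vector_mult_scaleR_complex algebra_simps)

lemma matrix_vector_mult_sum: "A *v (\<Sum>x\<in>I. f x) = (\<Sum>x\<in>I. A *v f x)" for A :: "complex^'n^'m"
proof (induction I rule: infinite_finite_induct)
  case (insert x F)
  then show ?case by (simp add: matrix_vector_right_distrib)
qed simp_all

lemma covd_sum:
  assumes "finite I" "\<And>x. x \<in> I \<Longrightarrow> s x differentiable (at y)"
  shows "covd V i a (\<lambda>z. \<Sum>x\<in>I. s x z) y = (\<Sum>x\<in>I. covd V i a (s x) y)"
  unfolding covd_def matrix_vector_mult_sum sum.distrib using pd_sum[OF assms] by simp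

context connection_bundle
begin

abbreviation frame_change where "frame_change i j y \<equiv> trans V i j (chart_inv N i y)"

text \<open>
  The covariant derivative is tensorial because the inhomogeneous term in the transformation law of
  the connection cancels the derivative of the transition matrix.
\<close>

lemma covd_transform:
  assumes y: "y \<in> overlap N i j" and s: "s differentiable (at (transition N i j y))"
  shows "covd V i a (\<lambda>z. frame_change i j z *v s (transition N i j z)) y
    = frame_change i j y *v (\<^bold>\<Sum>b. jacf i j y $ b $ a *\<^sub>R covd V j b s (transition N i j y))"
proof -
  let ?t = "transition N i j y" and ?T = "frame_change i j y"
  have dt: "transition N i j differentiable (at y)" using transition_differentiable[OF y] .
  have dT: "(\<lambda>z. frame_change i j z) differentiable (at y)"
    using smooth_on_differentiable[OF smooth_trans open_overlap y] .
  note st = pd_compose[OF s dt]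
  let ?c = "\<^bold>\<Sum>b. jacf i j y $ b $ a *\<^sub>R conn V j ?t $ b"
  have c: "conn V i y $ a ** ?T + pd a (\<lambda>z. frame_change i j z) y = ?T ** ?c"
    using y conn_transform by (auto elim!: overlapE simp: jacf_def)
  have "covd V i a (\<lambda>z. frame_change i j z *v s (transition N i j z)) y
     = ?T *v pd a (\<lambda>z. s (transition N i j z)) y + pd a (\<lambda>z. frame_change i j z) y *v s ?t + conn V i y $ a *v (?T *v s ?t)"
    unfolding covd_def using pd_bilinear(1)[OF bounded_bilinear_matrix_vector dT st(2)] by simp
  also have "\<dots> = ?T *v pd a (\<lambda>z. s (transition N i j z)) y + (?T ** ?c) *v s ?t"
    unfolding c[symmetric] by (simp add: matrix_vector_mul_assoc matrix_vector_mult_add_rdistrib)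
  also have "\<dots> = ?T *v (pd a (\<lambda>z. s (transition N i j z)) y + ?c *v s ?t)"
    by (simp add: matrix_vector_mul_assoc[symmetric] matrix_vector_right_distrib)
  also have "?c *v s ?t = (\<^bold>\<Sum>b. jacf i j y $ b $ a *\<^sub>R (conn V j ?t $ b *v s ?t))"
    by (simp add: vec_eq_iff matrix_vector_mult_def sum_distrib_right scaleR_sum_right)
      (subst sum.swap, simp)
  also have "pd a (\<lambda>z. s (transition N i j z)) y + \<dots>
    = (\<^bold>\<Sum>b. jacf i j y $ b $ a *\<^sub>R covd V j b s ?t)"
    unfolding st(1) covd_def sum.distrib[symmetric] by (simp add: jacf_nth[OF y] scaleR_right_distrib)
  finally show ?thesis .
qed

lemma smooth_covd:
  assumes "open S" "S \<subseteq> cdom N i" "smooth_on S s"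
  shows "smooth_on S (covd V i a s)"
  unfolding covd_def[abs_def]
  by (intro smooth_on_add smooth_on_pd smooth_on_bilinear[OF bounded_bilinear_matrix_vector]
      smooth_on_vec_nth smooth_on_subset[OF smooth_conn] assms)

lemma covd_K:
  assumes y: "y \<in> cdom N i" and s: "smooth_on (cdom N i) s" "\<And>z r. z \<in> cdom N i \<Longrightarrow> s z $ r \<in> K"
  shows "covd V i a s y $ r \<in> K"
proof -
  have d: "s differentiable (at y)" using smooth_on_differentiable[OF s(1) open_cdom y] .
  have "pd a s y $ r = pd a (\<lambda>z. s z $ r) y"
    by (rule pd_linear(1)[OF bounded_linear_vec_nth d, symmetric])
  also have "\<dots> \<in> K"
    by (rule pd_scalar_field[OF K open_cdom y pd_linear(2)[OF bounded_linear_vec_nth d]]) (rule s(2))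
  finally have "pd a s y $ r \<in> K" .
  then show ?thesis using conn_K[OF y] s(2)[OF y]
    by (auto simp: covd_def matrix_vector_mult_def intro!: scalar_field_closed[OF K])
qed

lemma form0D:
  assumes "f \<in> forms0 N K V"
  shows "smooth_on (cdom N i) (f i)" "y \<in> cdom N i \<Longrightarrow> f i y $ s \<in> K"
    "y \<in> overlap N i j \<Longrightarrow> f i y = frame_change i j y *v f j (transition N i j y)"
proof -
  have s: "is_section N V act0 f" using assms by (simp add: forms0_def)
  then show "smooth_on (cdom N i) (f i)" by (simp add: is_section_def)
  show "y \<in> cdom N i \<Longrightarrow> f i y $ s \<in> K" using assms by (simp add: forms0_def)
  assume "y \<in> overlap N i j"
  then obtain p where p: "p \<in> dom N i" "p \<in> dom N j" "y = crd N i p" "chart_inv N i y = p"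
    "transition N i j y = crd N j p" by (rule overlapE)
  have "f i (crd N i p) = act0 (jac N i j p) (trans V i j p) (f j (crd N j p))"
    using s p(1,2) unfolding is_section_def by blast
  then show "f i y = frame_change i j y *v f j (transition N i j y)"
    using p(1,2) by (simp add: p(3) transition_crd act0_def)
qed

lemma form1D:
  assumes "f \<in> forms1 N K V"
  shows "smooth_on (cdom N i) (f i)" "y \<in> cdom N i \<Longrightarrow> f i y $ a $ s \<in> K"
    "y \<in> overlap N i j \<Longrightarrow> f i y $ a = (\<^bold>\<Sum>b. jacf i j y $ b $ a *\<^sub>R (frame_change i j y *v f j (transition N i j y) $ b))"
proof -
  have s: "is_section N V act1 f" using assms by (simp add: forms1_def)
  then show "smooth_on (cdom N i) (f i)" by (simp add: is_section_def)
  show "y \<in> cdom N i \<Longrightarrow> f i y $ a $ s \<in> K" using assms by (simp add: forms1_def)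
  assume "y \<in> overlap N i j"
  then obtain p where p: "p \<in> dom N i" "p \<in> dom N j" "y = crd N i p" "chart_inv N i y = p"
    "transition N i j y = crd N j p" by (rule overlapE)
  have "f i (crd N i p) = act1 (jac N i j p) (trans V i j p) (f j (crd N j p))"
    using s p(1,2) unfolding is_section_def by blast
  then show "f i y $ a = (\<^bold>\<Sum>b. jacf i j y $ b $ a *\<^sub>R (frame_change i j y *v f j (transition N i j y) $ b))"
    using p(1,2) by (simp add: p(3) transition_crd act1_def jacf_def)
qed

lemma d0_forms1:
  assumes f: "f \<in> forms0 N K V"
  shows "d0 V f \<in> forms1 N K V"
  unfolding forms1_def is_section_def mem_Collect_eq
proof (intro conjI allI ballI)
  note f = form0D[OF f]
  fix i
  show "smooth_on (cdom N i) (d0 V f i)"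
    unfolding d0_def
    by (intro smooth_on_vec_lambda open_cdom smooth_covd f) simp
  show "d0 V f i y $ a $ s \<in> K" if "y \<in> cdom N i" for y a s
    unfolding d0_def using covd_K[OF that f(1)] f(2) by simp
  fix j p assume "p \<in> dom N i \<inter> dom N j"
  then have p: "p \<in> dom N i" "p \<in> dom N j" by auto
  let ?y = "crd N i p"
  have y: "?y \<in> overlap N i j" using p overlap_crd by blast
  have "covd V i a (f i) ?y = frame_change i j ?y *v (\<^bold>\<Sum>b. jacf i j ?y $ b $ a *\<^sub>R covd V j b (f j) (transition N i j ?y))" for a
  proof -
    have "covd V i a (f i) ?y = covd V i a (\<lambda>z. frame_change i j z *v f j (transition N i j z)) ?y"
      by (rule covd_cong_open[OF open_overlap y f(3)])
    also have "\<dots> = frame_change i j ?y *v (\<^bold>\<Sum>b. jacf i j ?y $ b $ a *\<^sub>R covd V j b (f j) (transition N i j ?y))"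
      by (rule covd_transform[OF y], rule smooth_on_differentiable[OF f(1) open_cdom])
        (use p in \<open>simp add: transition_crd\<close>)
    finally show ?thesis .
  qed
  then show "d0 V f i (crd N i p) = act1 (jac N i j p) (trans V i j p) (d0 V f j (crd N j p))"
    using p by (simp add: d0_def act1_def vec_eq_iff[where 'b=4] jacf_def transition_crd
        matrix_vector_mult_sum matrix_vector_mult_scaleR_complex)
qed

text \<open>
  The derivatives of the Jacobian that arise from differentiating the transformation law of \<open>f\<close> are
  symmetric in the two form indices and drop out of the exterior derivative.
\<close>

lemma d1_forms2:
  assumes f: "f \<in> forms1 N K V"
  shows "d1 V f \<in> forms2 N K V"
  unfolding forms2_def is_section_def mem_Collect_eq
proof (intro conjI allI ballI)
  note f = form1D[OF f]
  have fs: "smooth_on (cdom N i) (\<lambda>z. f i z $ b)" for i b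
    by (intro smooth_on_vec_nth open_cdom f)
  fix i
  show "smooth_on (cdom N i) (d1 V f i)"
    unfolding d1_def
    by (intro smooth_on_vec_lambda open_cdom smooth_on_diff smooth_covd fs) auto
  show "d1 V f i y $ a $ b $ s \<in> K" if "y \<in> cdom N i" for y a b s
    unfolding d1_def using covd_K[OF that fs] f(2) scalar_field_closed(2)[OF K] by simp
  show "d1 V f i y $ a $ b = - d1 V f i y $ b $ a" for y a b
    by (simp add: d1_def)
  fix j p assume "p \<in> dom N i \<inter> dom N j"
  then have p: "p \<in> dom N i" "p \<in> dom N j" by auto
  let ?y = "crd N i p" and ?t = "crd N j p" and ?T = "trans V i j p" and ?J = "jac N i j p"
  have y: "?y \<in> overlap N i j" using p overlap_crd by blast
  have t: "transition N i j ?y = ?t" using p transition_crd by blast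
  have J: "jacf i j ?y = ?J" "frame_change i j ?y = ?T" using p by (auto simp: jacf_def)
  have df: "(\<lambda>z. f j z $ b) differentiable (at ?t)" for b
    by (rule smooth_on_differentiable[OF fs open_cdom]) (use p in simp)
  let ?g = "\<lambda>b z. frame_change i j z *v f j (transition N i j z) $ b"
  have dg: "?g b differentiable (at ?y)" for b
  proof (rule pd_bilinear(2)[OF bounded_bilinear_matrix_vector])
    show "(\<lambda>z. frame_change i j z) differentiable (at ?y)"
      by (rule smooth_on_differentiable[OF smooth_trans open_overlap y])
    show "(\<lambda>z. f j (transition N i j z) $ b) differentiable (at ?y)"
      using pd_compose(2)[of "\<lambda>z. f j z $ b", OF _ transition_differentiable[OF y]] df t by simp
  qed
  have dJ: "(\<lambda>z. jacf i j z $ d $ b) differentiable (at ?y)" for d b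
    by (rule smooth_on_differentiable[OF _ open_overlap y]) (intro smooth_on_vec_nth open_overlap smooth_jacf)
  define C where "C a b = covd V j a (\<lambda>z. f j z $ b) ?t" for a b
  \<comment> \<open>The first sum is symmetric in \<open>a\<close> and \<open>b\<close> by \<open>pd_jacf_sym\<close>.\<close>
  have c: "covd V i a (\<lambda>z. f i z $ b) ?y
    = (\<^bold>\<Sum>d. pd a (\<lambda>z. jacf i j z $ d $ b) ?y *\<^sub>R ?g d ?y)
    + (\<^bold>\<Sum>d e. (?J $ e $ a * ?J $ d $ b) *\<^sub>R (?T *v C e d))" for a b
  proof -
    have "covd V i a (\<lambda>z. f i z $ b) ?y = covd V i a (\<lambda>z. \<^bold>\<Sum>d. jacf i j z $ d $ b *\<^sub>R ?g d z) ?y"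
      by (rule covd_cong_open[OF open_overlap y f(3)])
    also have "\<dots> = (\<^bold>\<Sum>d. covd V i a (\<lambda>z. jacf i j z $ d $ b *\<^sub>R ?g d z) ?y)"
      by (rule covd_sum) (auto intro: pd_bilinear(2)[OF bounded_bilinear_scaleR dJ dg])
    also have "\<dots> = (\<^bold>\<Sum>d. pd a (\<lambda>z. jacf i j z $ d $ b) ?y *\<^sub>R ?g d ?y
       + ?J $ d $ b *\<^sub>R covd V i a (?g d) ?y)"
      by (intro sum.cong refl, subst covd_scaleR[OF dJ dg]) (simp only: J)
    also have "\<dots> = (\<^bold>\<Sum>d. pd a (\<lambda>z. jacf i j z $ d $ b) ?y *\<^sub>R ?g d ?y
       + ?J $ d $ b *\<^sub>R (?T *v (\<^bold>\<Sum>e. ?J $ e $ a *\<^sub>R C e d)))"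
    proof -
      have "covd V i a (?g d) ?y = ?T *v (\<^bold>\<Sum>e. ?J $ e $ a *\<^sub>R C e d)" for d
      using covd_transform[OF y, of "\<lambda>z. f j z $ d" a] df t J by (simp add: C_def)
      then show ?thesis by simp
    qed
    also have "\<dots> = (\<^bold>\<Sum>d. pd a (\<lambda>z. jacf i j z $ d $ b) ?y *\<^sub>R ?g d ?y)
    + (\<^bold>\<Sum>d e. (?J $ e $ a * ?J $ d $ b) *\<^sub>R (?T *v C e d))"
      by (simp add: sum.distrib matrix_vector_mult_sum matrix_vector_mult_scaleR_complex scaleR_sum_right mult.commute)
    finally show ?thesis .
  qed
  have "d1 V f i ?y $ a $ b = (\<^bold>\<Sum>e d. (?J $ e $ a * ?J $ d $ b) *\<^sub>R (?T *v d1 V f j ?t $ e $ d))" for a b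
  proof -
    have "d1 V f i ?y $ a $ b = (\<^bold>\<Sum>d e. (?J $ e $ a * ?J $ d $ b) *\<^sub>R (?T *v C e d))
       - (\<^bold>\<Sum>d e. (?J $ e $ b * ?J $ d $ a) *\<^sub>R (?T *v C e d))"
      by (simp add: d1_def c pd_jacf_sym[OF y, of a _ b])
    also have "(\<^bold>\<Sum>d e. (?J $ e $ a * ?J $ d $ b) *\<^sub>R (?T *v C e d))
        = (\<^bold>\<Sum>e d. (?J $ e $ a * ?J $ d $ b) *\<^sub>R (?T *v C e d))"
      by (rule sum.swap)
    also have "(\<^bold>\<Sum>d e. (?J $ e $ b * ?J $ d $ a) *\<^sub>R (?T *v C e d))
        = (\<^bold>\<Sum>e d. (?J $ e $ a * ?J $ d $ b) *\<^sub>R (?T *v C d e))"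
      by (simp add: mult.commute)
    finally show ?thesis
      by (simp add: d1_def C_def sum_subtractf[symmetric] scaleR_diff_right[symmetric]
          matrix_vector_mult_diff_distrib)
  qed
  then show "d1 V f i (crd N i p) = act2 (jac N i j p) (trans V i j p) (d1 V f j (crd N j p))"
    by (simp add: act2_def vec_eq_iff[where 'b=4])
qed

lemma covd_covd:
  assumes S: "open S" "S \<subseteq> cdom N i" "y \<in> S" and s: "smooth_on S s"
  shows "covd V i a (covd V i b s) y = pd a (pd b s) y + pd a (\<lambda>z. conn V i z $ b) y *v s y
    + conn V i y $ b *v pd a s y + conn V i y $ a *v pd b s y + (conn V i y $ a ** conn V i y $ b) *v s y"
proof -
  have dc: "(\<lambda>z. conn V i z $ b) differentiable (at y)"
    by (rule smooth_on_differentiable[OF _ S(1,3)])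
      (intro smooth_on_vec_nth S(1) smooth_on_subset[OF smooth_conn S(2)])
  have ds: "s differentiable (at y)" "pd b s differentiable (at y)"
    using smooth_on_differentiable[OF s S(1,3)] smooth_on_differentiable[OF smooth_on_pd[OF s] S(1,3)] by auto
  note bil = pd_bilinear[OF bounded_bilinear_matrix_vector dc ds(1)]
  have "pd a (covd V i b s) y = pd a (pd b s) y + (conn V i y $ b *v pd a s y + pd a (\<lambda>z. conn V i z $ b) y *v s y)"
    unfolding covd_def[abs_def] using pd_add[OF ds(2) bil(2)] bil(1) by simp
  then show ?thesis
    unfolding covd_def[of V i a "covd V i b s"]
    by (simp add: covd_def matrix_vector_right_distrib matrix_vector_mul_assoc)
qed

lemma curvature_eq:
  assumes y: "y \<in> cdom N i"
  shows "curvature V i y $ a $ b = pd a (\<lambda>z. conn V i z $ b) y - pd b (\<lambda>z. conn V i z $ a) y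
    + conn V i y $ a ** conn V i y $ b - conn V i y $ b ** conn V i y $ a" (is "_ = ?F")
proof -
  have "covd V i a (covd V i b (\<lambda>_. v)) y - covd V i b (covd V i a (\<lambda>_. v)) y = ?F *v v" for v
    unfolding covd_covd[OF open_cdom order_refl y smooth_on_const]
    by (simp add: pd_const[abs_def] matrix_vector_mult_diff_rdistrib matrix_vector_mult_add_rdistrib)
  then show ?thesis by (simp add: curvature_def matrix_of_matrix_vector_mul)
qed

lemma ricci_identity:
  assumes S: "open S" "S \<subseteq> cdom N i" "y \<in> S" and s: "smooth_on S s"
  shows "covd V i a (covd V i b s) y - covd V i b (covd V i a s) y = curvature V i y $ a $ b *v s y"
proof -
  have y: "y \<in> cdom N i" using S by blast
  show ?thesis
    unfolding covd_covd[OF assms] curvature_eq[OF y] pd_commute[OF S(1,3) s, of a b]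
    by (simp add: matrix_vector_mult_diff_rdistrib matrix_vector_mult_add_rdistrib)
qed

lemma curvature_dual:
  assumes y: "y \<in> cdom N i"
  shows "curvature (dual V) i y $ a $ b = - transpose (curvature V i y $ a $ b)"
proof -
  interpret d: connection_bundle N K "dual V" by (rule connection_bundle_dual)
  have dc: "(\<lambda>z. conn V i z $ b) differentiable (at y)" for b
    by (rule smooth_on_differentiable[OF _ open_cdom y]) (intro smooth_on_vec_nth open_cdom smooth_conn)
  have L: "bounded_linear (\<lambda>A :: complex^'r^'r. - transpose A)"
    by (intro bounded_linear_minus bounded_linear_transpose)
  have p: "pd a (\<lambda>z. conn (dual V) i z $ b) y = - transpose (pd a (\<lambda>z. conn V i z $ b) y)" for a b
    unfolding conn_dual by (rule pd_linear(1)[OF L dc])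
  have t: "transpose (A - B) = transpose A - transpose B" "transpose (A + B) = transpose A + transpose B"
    "(- transpose A) ** (- transpose B) = transpose (B ** A)" for A B :: "complex^'r^'r"
    by (simp_all add: transpose_def vec_eq_iff matrix_matrix_mult_def mult.commute)
  show ?thesis
    unfolding d.curvature_eq[OF y] p unfolding curvature_eq[OF y] conn_dual t by (simp add: t)
qed

lemma d1_d0:
  assumes f: "f \<in> forms0 N K V" and y: "y \<in> cdom N i"
  shows "d1 V (d0 V f) i y $ a $ b = curvature V i y $ a $ b *v f i y"
  using ricci_identity[OF open_cdom order_refl y form0D(1)[OF f]] by (simp add: d1_def d0_def)

end

section \<open>Integration in a chart\<close>

context oriented_mfd
begin

text \<open>
  The diagonal form of the metric has determinant \<open>(-1)\<^sup>q\<close>, and a congruence multiplies the determinant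
  by a square.
\<close>

lemma pseudo_metric_det:
  assumes "pseudo_metric N q g" "y \<in> cdom N i"
  shows "transpose (g i y) = g i y" "det (g i y) \<noteq> 0" "sgn (det (g i y)) = (-1) ^ q"
proof -
  have h: "has_index q (g i y)" using assms by (simp add: pseudo_metric_def)
  then show "transpose (g i y) = g i y" by (simp add: has_index_def)
  obtain P :: "real^4^4" and \<sigma> :: "4 \<Rightarrow> real" where P: "invertible P" "\<And>a. \<sigma> a \<in> {1, -1}"
    "card {a. \<sigma> a = -1} = q" "transpose P ** g i y ** P = (\<chi> a b. if a = b then \<sigma> a else 0)"
    using h unfolding has_index_def by blast
  have "det P * det (g i y) * det P = det (\<chi> a b. if a = b then \<sigma> a else 0 :: real^4^4)"
    unfolding P(4)[symmetric] by (simp add: det_mul)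
  also have "\<dots> = (\<Prod>a\<in>UNIV. \<sigma> a)" by (subst det_diagonal) auto
  also have "\<dots> = (\<Prod>a\<in>{a. \<sigma> a = -1}. \<sigma> a) * (\<Prod>a\<in>{a. \<sigma> a \<noteq> -1}. \<sigma> a)"
    by (subst prod.union_disjoint[symmetric]) (auto intro: prod.cong)
  also have "(\<Prod>a\<in>{a. \<sigma> a = -1}. \<sigma> a) = (-1) ^ q" by (simp add: P(3)[symmetric])
  also have "(\<Prod>a\<in>{a. \<sigma> a \<noteq> -1}. \<sigma> a) = 1" by (rule prod.neutral) (use P(2) in auto)
  finally have d: "det (g i y) * (det P * det P) = (-1) ^ q" by (simp add: ac_simps)
  then show nz: "det (g i y) \<noteq> 0" by auto
  have "det P * det P > 0" using d by (metis mult_zero_right not_real_square_gt_zero power_not_zero zero_neq_neg_one)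
  then have "sgn (det P * det P) = 1" by (rule sgn_pos)
  then have "sgn (det (g i y)) = sgn (det (g i y) * (det P * det P))" by (simp only: sgn_mult[of _ "det P * det P"] mult_1_right)
  then show "sgn (det (g i y)) = (-1) ^ q" unfolding d by (simp add: minus_one_power_iff)
qed

lemma smooth_metric:
  assumes "pseudo_metric N q g"
  shows "smooth_on (cdom N i) (g i)"
    "smooth_on (cdom N i) (\<lambda>y. matrix_inv (g i y) $ a $ b)"
    "smooth_on (cdom N i) (\<lambda>y. sqrt \<bar>det (g i y)\<bar>)"
proof -
  show g: "smooth_on (cdom N i) (g i)" using assms by (simp add: pseudo_metric_def)
  show "smooth_on (cdom N i) (\<lambda>y. matrix_inv (g i y) $ a $ b)"
    by (rule smooth_on_matrix_inv[OF open_cdom g pseudo_metric_det(2)[OF assms]])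
  have a: "\<bar>det (g i y)\<bar> = (-1) ^ q * det (g i y)" if "y \<in> cdom N i" for y
    using pseudo_metric_det(3)[OF assms that] by (metis abs_sgn mult.commute)
  show "smooth_on (cdom N i) (\<lambda>y. sqrt \<bar>det (g i y)\<bar>)"
  proof (rule smooth_on_sqrt[OF open_cdom])
    show "smooth_on (cdom N i) (\<lambda>y. \<bar>det (g i y)\<bar>)"
      by (rule smooth_on_cong[OF open_cdom a[symmetric], rotated])
        (intro smooth_on_mult smooth_on_const smooth_on_det smooth_on_vec_nth open_cdom g)
  qed (use pseudo_metric_det(2)[OF assms] in auto)
qed

lemma openin_chart_preimage:
  assumes "open S" shows "openin (mtop N) {p \<in> dom N i. crd N i p \<in> S}"
proof -
  have "continuous_map (subtopology (mtop N) (dom N i)) (top_of_set (cdom N i)) (crd N i)"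
    by (rule homeomorphic_imp_continuous_map[OF homeomorphic_crd])
  moreover have "openin (top_of_set (cdom N i)) (cdom N i \<inter> S)" using assms by auto
  ultimately have "openin (subtopology (mtop N) (dom N i)) {p \<in> dom N i. crd N i p \<in> cdom N i \<inter> S}"
    using openin_continuous_map_preimage[of "subtopology (mtop N) (dom N i)" "top_of_set (cdom N i)"]
    unfolding topspace_sub by blast
  then have "openin (mtop N) {p \<in> dom N i. crd N i p \<in> cdom N i \<inter> S}"
    using openin_trans_full openin_dom by blast
  moreover have "{p \<in> dom N i. crd N i p \<in> cdom N i \<inter> S} = {p \<in> dom N i. crd N i p \<in> S}" by auto
  ultimately show ?thesis by simp
qed

text \<open>
  The chart carries the volume measure on its domain to Lebesgue measure with density
  \<open>\<bar>det g\<bar>\<^sup>1\<^sup>/\<^sup>2\<close>; by the consistency of \<open>f\<close> the chart selected at each point does not influence the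
  integrand.
\<close>

lemma mfd_integral_chart:
  fixes f :: "'i \<Rightarrow> real^4 \<Rightarrow> complex"
  assumes vm: "volume_measure N g \<mu>" and g: "pseudo_metric N q g"
    and cons: "\<And>j k p. p \<in> dom N j \<Longrightarrow> p \<in> dom N k \<Longrightarrow> f j (crd N j p) = f k (crd N k p)"
    and supp: "\<And>j p. p \<in> dom N j \<Longrightarrow> p \<notin> dom N i \<Longrightarrow> f j (crd N j p) = 0"
    and cont: "continuous_on (cdom N i) (f i)"
  shows "mfd_integral N \<mu> f = (LINT y|lborel. indicator (cdom N i) y *\<^sub>R (sqrt \<bar>det (g i y)\<bar> *\<^sub>R f i y))"
proof -
  let ?D = "dom N i" and ?C = "cdom N i" and ?x = "crd N i"
  let ?w = "\<lambda>y. sqrt \<bar>det (g i y)\<bar>"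
  have sp: "space \<mu> = topspace (mtop N)" and st: "sets \<mu> = sigma_sets (topspace (mtop N)) {S. openin (mtop N) S}"
    and em: "\<And>B. B \<in> sets \<mu> \<Longrightarrow> B \<subseteq> ?D \<Longrightarrow> emeasure \<mu> B = (\<integral>\<^sup>+y\<in>?x ` B. ennreal (?w y) \<partial>lborel)"
    using vm by (auto simp: volume_measure_def)
  have os: "A \<in> sets \<mu>" if "openin (mtop N) A" for A using that by (simp add: st)
  have D: "?D \<in> sets \<mu>" "?D \<inter> space \<mu> \<in> sets \<mu>" using os[OF openin_dom] sp dom_subset by (auto simp: Int_absorb2)
  have Cs: "?C \<in> sets lborel" "?C \<in> sets borel" using open_cdom by auto
  let ?R = "restrict_space \<mu> ?D" and ?L = "restrict_space lborel ?C"
  have spR: "space ?R = ?D" using sp dom_subset by (auto simp: space_restrict_space)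
  have setsR: "A \<in> sets ?R \<longleftrightarrow> A \<subseteq> ?D \<and> A \<in> sets \<mu>" for A
    by (rule sets_restrict_space_iff[OF D(2)])
  have m1: "?x \<in> measurable ?R borel"
  proof (rule borel_measurableI)
    fix S :: "(real^4) set" assume "open S"
    moreover have "?x -` S \<inter> space ?R = {p \<in> ?D. ?x p \<in> S}" unfolding spR by auto
    ultimately show "?x -` S \<inter> space ?R \<in> sets ?R"
      using os[OF openin_chart_preimage] by (auto simp: setsR)
  qed
  have m: "?x \<in> measurable ?R ?L"
  proof (rule measurable_restrict_space2)
    show "?x \<in> measurable ?R lborel" using m1 by simp
    show "?x \<in> space ?R \<rightarrow> ?C" unfolding spR by auto
  qed
  have wm: "?w \<in> borel_measurable ?L"
  proof -
    have "?w \<in> borel_measurable (restrict_space borel ?C)"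
      by (rule borel_measurable_continuous_on_restrict[OF smooth_on_continuous[OF smooth_metric(3)[OF g]]])
    then show ?thesis by (subst measurable_cong_sets[where M'="restrict_space borel ?C"]) (auto simp: sets_restrict_space)
  qed
  have fm: "f i \<in> borel_measurable ?L"
  proof -
    have "f i \<in> borel_measurable (restrict_space borel ?C)"
      by (rule borel_measurable_continuous_on_restrict[OF cont])
    then show ?thesis by (subst measurable_cong_sets[where M'="restrict_space borel ?C"]) (auto simp: sets_restrict_space)
  qed
  \<comment> \<open>The assumption on the volume measure, read as an equality of measures on the coordinate domain.\<close>
  have deq: "distr ?R ?L ?x = density ?L (\<lambda>y. ennreal (?w y))"
  proof (rule measure_eqI)
    fix B assume "B \<in> sets (distr ?R ?L ?x)"
    then have B: "B \<in> sets ?L" by simp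
    then have BC: "B \<subseteq> ?C" "B \<in> sets lborel" using sets_restrict_space_iff[of ?C lborel B] Cs by auto
    let ?P = "?x -` B \<inter> ?D"
    have "?P \<in> sets ?R" using measurable_sets[OF m B] spR by simp
    then have P: "?P \<in> sets \<mu>" "?P \<subseteq> ?D" by (auto simp: setsR)
    have im: "?x ` ?P = B" using BC by (auto simp: cdom_def)
    have "emeasure (distr ?R ?L ?x) B = emeasure ?R ?P"
      using emeasure_distr[OF m B] spR by simp
    also have "\<dots> = emeasure \<mu> ?P" by (rule emeasure_restrict_space[OF D(2)]) auto
    also have "\<dots> = (\<integral>\<^sup>+y\<in>B. ennreal (?w y) \<partial>lborel)" using em[OF P] im by simp
    also have "\<dots> = (\<integral>\<^sup>+y. ennreal (?w y) * indicator B y * indicator ?C y \<partial>lborel)"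
      by (intro nn_integral_cong) (use BC in \<open>auto simp: indicator_def\<close>)
    also have "\<dots> = (\<integral>\<^sup>+y. ennreal (?w y) * indicator B y \<partial>?L)"
      by (rule nn_integral_restrict_space[symmetric]) (use Cs in auto)
    also have "\<dots> = emeasure (density ?L (\<lambda>y. ennreal (?w y))) B"
      by (rule emeasure_density[symmetric]) (use wm B in auto)
    finally show "emeasure (distr ?R ?L ?x) B = emeasure (density ?L (\<lambda>y. ennreal (?w y))) B" .
  qed simp
  have pick: "(let j = (SOME j. p \<in> dom N j) in f j (crd N j p)) = indicator ?D p *\<^sub>R f i (?x p)"
    if "p \<in> space \<mu>" for p
  proof -
    have "\<exists>j. p \<in> dom N j" using that N unfolding sp oriented_manifold_def by blast
    then have j: "p \<in> dom N (SOME j. p \<in> dom N j)" by (rule someI_ex)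
    show ?thesis
    proof (cases "p \<in> ?D")
      case True
      then show ?thesis using cons[OF j True] by (simp add: Let_def)
    next
      case False
      then show ?thesis using supp[OF j False] by (simp add: Let_def)
    qed
  qed
  have "mfd_integral N \<mu> f = (LINT p|\<mu>. indicator ?D p *\<^sub>R f i (?x p))"
    unfolding mfd_integral_def by (rule Bochner_Integration.integral_cong[OF refl pick])
  also have "\<dots> = (LINT p|?R. f i (?x p))"
    by (rule integral_restrict_space[OF D(2), symmetric])
  also have "\<dots> = (LINT y|distr ?R ?L ?x. f i y)"
    by (rule integral_distr[OF m fm, symmetric])
  also have "\<dots> = (LINT y|?L. ?w y *\<^sub>R f i y)"
    unfolding deq by (rule integral_density) (use fm wm in auto)
  also have "\<dots> = (LINT y|lborel. indicator ?C y *\<^sub>R (?w y *\<^sub>R f i y))"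
    by (rule integral_restrict_space) (use Cs in auto)
  finally show ?thesis .
qed

end

section \<open>Test sections supported in a chart\<close>

text \<open>
  The properties of the actions on 0- and 1-forms by which a constant vector in one chart extends to
  a section over all charts that meet it.
\<close>

locale fibre_action =
  fixes act :: "real^4^4 \<Rightarrow> complex^'r^'r \<Rightarrow> 'v \<Rightarrow> 'v::real_normed_vector"
  assumes act_comp: "act J T (act J' T' v) = act (J' ** J) (T ** T') v"
    and act_one: "act (mat 1) (mat 1) v = v"
    and act_scaleR: "act J T (c *\<^sub>R v) = c *\<^sub>R act J T v"
    and act_smooth: "open S \<Longrightarrow> smooth_on S Jf \<Longrightarrow> smooth_on S Tf \<Longrightarrow> smooth_on S (\<lambda>y. act (Jf y) (Tf y) v)"

interpretation act0: fibre_action act0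
  by unfold_locales (auto simp: act0_def matrix_vector_mul_assoc matrix_vector_mult_scaleR_complex
      intro!: smooth_on_bilinear[OF bounded_bilinear_matrix_vector] smooth_on_const)

interpretation act1: fibre_action act1
proof
  fix J J' :: "real^4^4" and T T' :: "complex^'r^'r" and v :: "complex^'r^4" and c :: real
  show "act1 J T (act1 J' T' v) = act1 (J' ** J) (T ** T') v"
    unfolding act1_def matrix_matrix_mult_def[of J' J]
    by (simp add: vec_eq_iff[where 'b=4] matrix_vector_mult_sum matrix_vector_mult_scaleR_complex scaleR_sum_right
        matrix_vector_mul_assoc scaleR_sum_left mult.commute) (intro allI sum.swap)
  have "(\<^bold>\<Sum>b. mat (1::real) $ b $ a *\<^sub>R (mat 1 *v v $ b)) = v $ a" for a
    by (subst sum.cong[OF refl, where h = "\<lambda>b. if b = a then v $ b else 0"]) (auto simp: mat_def[where 'a = real])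
  then show "act1 (mat 1) (mat 1) v = v" by (simp add: act1_def)
  show "act1 J T (c *\<^sub>R v) = c *\<^sub>R act1 J T v"
    by (simp add: act1_def vec_eq_iff[where 'b=4] matrix_vector_mult_scaleR_complex scaleR_sum_right mult.commute)
next
  fix S :: "(real^4) set" and J' :: "real^4 \<Rightarrow> real^4^4" and T' :: "real^4 \<Rightarrow> complex^'r^'r" and v :: "complex^'r^4"
  assume "open S" "smooth_on S J'" "smooth_on S T'"
  then show "smooth_on S (\<lambda>y. act1 (J' y) (T' y) v)"
    unfolding act1_def
    by (intro smooth_on_vec_lambda smooth_on_sum smooth_on_scaleR smooth_on_vec_nth
      smooth_on_bilinear[OF bounded_bilinear_matrix_vector] smooth_on_const) auto
qed

context connection_bundle
begin

text \<open>
  In chart \<open>i\<close> this is a bump function times the constant \<open>v\<close>; the value in every other chart is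
  dictated by the transformation law.
\<close>

definition bump_section ::
    "(real^4^4 \<Rightarrow> complex^'r^'r \<Rightarrow> 'v \<Rightarrow> 'v) \<Rightarrow> 'i \<Rightarrow> real^4 \<Rightarrow> real \<Rightarrow> 'v \<Rightarrow> 'i \<Rightarrow> real^4 \<Rightarrow> 'v::real_normed_vector" where
  "bump_section act i x r v j y = (let p = chart_inv N j y in
     if p \<in> dom N i then bump x r (crd N i p) *\<^sub>R act (jac N j i p) (trans V j i p) v else 0)"

lemma bump_section_own_chart:
  assumes "fibre_action act" "y \<in> cdom N i"
  shows "bump_section act i x r v i y = bump x r y *\<^sub>R v"
proof -
  interpret fibre_action act by fact
  show ?thesis using assms(2) by (simp add: bump_section_def Let_def jac_self trans_self act_one)
qed

lemma bump_section_outside: "p \<in> dom N j \<Longrightarrow> p \<notin> dom N i \<Longrightarrow> bump_section act i x r v j (crd N j p) = 0"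
  by (simp add: bump_section_def)

text \<open>
  Smoothness at the points outside chart \<open>i\<close> holds because the support is compact, hence closed in the
  Hausdorff manifold, so that the section vanishes near such points.
\<close>

lemma is_section_bump_section:
  assumes act: "fibre_action act" and r: "r > 0" "cball x r \<subseteq> cdom N i"
  shows "is_section N V act (bump_section act i x r v)"
    and "compact_support N (bump_section act i x r v)"
    and "\<lbrakk>p \<in> dom N k; p \<notin> dom N i\<rbrakk> \<Longrightarrow>
      \<exists>T. open T \<and> crd N k p \<in> T \<and> (\<forall>z\<in>T. bump_section act i x r v k z = 0)"
proof -
  interpret fibre_action act by fact
  let ?\<psi> = "bump_section act i x r v"
  define C where "C = {p \<in> dom N i. crd N i p \<in> cball x r}"
  have im: "crd N i ` C = cball x r"
  proof
    show "cball x r \<subseteq> crd N i ` C"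
    proof
      fix y assume y: "y \<in> cball x r"
      then have "y \<in> cdom N i" using r by blast
      then show "y \<in> crd N i ` C" using y by (intro image_eqI[of _ _ "chart_inv N i y"]) (auto simp: C_def)
    qed
  qed (auto simp: C_def)
  have "compactin (top_of_set (cdom N i)) (crd N i ` C)"
    unfolding im using r by (simp add: compactin_subtopology)
  then have "compactin (subtopology (mtop N) (dom N i)) C"
    using homeomorphic_map_compactness[OF homeomorphic_crd, of C i] topspace_sub by (auto simp: C_def)
  then have C: "compactin (mtop N) C" by (simp add: compactin_subtopology)
  have zero: "?\<psi> j (crd N j p) = 0" if "p \<in> dom N j" "p \<notin> C" for j p
  proof (cases "p \<in> dom N i")
    case True
    then have "dist x (crd N i p) \<ge> r" using that by (auto simp: C_def)
    then show ?thesis using bump_zero r that by (simp add: bump_section_def)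
  qed (simp add: bump_section_outside that)
  show "compact_support N ?\<psi>"
    unfolding compact_support_def using C zero by auto
  have closedC: "closedin (mtop N) C"
    using N C compactin_imp_closedin by (auto simp: oriented_manifold_def)
  have near: "\<exists>T. open T \<and> crd N k p \<in> T \<and> (\<forall>z\<in>T. ?\<psi> k z = 0)" if p: "p \<in> dom N k" "p \<notin> dom N i" for p k
  proof -
    define U where "U = topspace (mtop N) - C"
    have U: "openin (mtop N) U" using closedC by (simp add: U_def openin_diff)
    have "crd N k p \<in> crd N k ` (dom N k \<inter> U)" using p dom_subset by (auto simp: U_def C_def)
    moreover have "\<forall>z\<in>crd N k ` (dom N k \<inter> U). ?\<psi> k z = 0" using zero by (auto simp: U_def)
    ultimately show ?thesis using open_crd_image[OF U] by blast
  qed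
  then show "\<lbrakk>p \<in> dom N k; p \<notin> dom N i\<rbrakk> \<Longrightarrow> \<exists>T. open T \<and> crd N k p \<in> T \<and> (\<forall>z\<in>T. ?\<psi> k z = 0)" .
  have sm: "smooth_on (cdom N j) (?\<psi> j)" for j
  proof (rule smooth_on_local)
    fix y assume y: "y \<in> cdom N j"
    define p where "p = chart_inv N j y"
    have p: "p \<in> dom N j" "y = crd N j p" using y by (auto simp: p_def)
    show "\<exists>T. open T \<and> y \<in> T \<and> smooth_on T (?\<psi> j)"
    proof (cases "p \<in> dom N i")
      case True
      have "smooth_on (overlap N j i) (?\<psi> j)"
      proof (rule smooth_on_cong[OF open_overlap])
        show "smooth_on (overlap N j i) (\<lambda>z. bump x r (transition N j i z) *\<^sub>R
           act (jacf j i z) (frame_change j i z) v)"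
          by (intro smooth_on_scaleR open_overlap smooth_pull smooth_on_bump act_smooth smooth_jacf smooth_trans)
      qed (auto elim!: overlapE simp: bump_section_def jacf_def)
      then show ?thesis using open_overlap overlap_crd[OF p(1) True] p by blast
    next
      case False
      then obtain T where T: "open T" "y \<in> T" "\<forall>z\<in>T. ?\<psi> j z = 0" using near[of p j] p by blast
      then have "smooth_on T (?\<psi> j)"
        by (intro smooth_on_cong[OF T(1) _ smooth_on_const[of _ 0]]) auto
      then show ?thesis using T by blast
    qed
  qed
  show "is_section N V act ?\<psi>"
    unfolding is_section_def
  proof (intro conjI allI ballI sm)
    fix j k p assume "p \<in> dom N j \<inter> dom N k"
    then have p: "p \<in> dom N j" "p \<in> dom N k" by auto
    show "?\<psi> j (crd N j p) = act (jac N j k p) (trans V j k p) (?\<psi> k (crd N k p))"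
    proof (cases "p \<in> dom N i")
      case True
      then show ?thesis using p
        by (simp add: bump_section_def act_scaleR act_comp jac_cocycle[symmetric] trans_cocycle)
    next
      case False
      have "act J T 0 = 0" for J T using act_scaleR[of J T 0 0] by simp
      then show ?thesis using p False by (simp add: bump_section_outside)
    qed
  qed
qed

lemma bump_section_form0:
  assumes r: "r > 0" "cball x r \<subseteq> cdom N i"
  shows "bump_section act0 i x r (axis s 1) \<in> forms0 N K V"
  unfolding forms0_def
proof (intro CollectI conjI allI ballI is_section_bump_section(1)[OF act0.fibre_action_axioms r])
  fix j y t assume "y \<in> cdom N j"
  then show "bump_section act0 i x r (axis s 1) j y $ t \<in> K"
    using trans_K by (auto simp: bump_section_def Let_def act0_def matrix_vector_mult_def axis_def
      intro!: scalar_field_closed[OF K])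
qed

lemma bump_section_form1:
  assumes r: "r > 0" "cball x r \<subseteq> cdom N i"
  shows "bump_section act1 i x r (axis b (axis s 1)) \<in> forms1 N K V"
  unfolding forms1_def
proof (intro CollectI conjI allI ballI is_section_bump_section(1)[OF act1.fibre_action_axioms r])
  fix j y a t assume "y \<in> cdom N j"
  then show "bump_section act1 i x r (axis b (axis s 1)) j y $ a $ t \<in> K"
    using trans_K by (auto simp: bump_section_def Let_def act1_def matrix_vector_mult_def axis_def
      intro!: scalar_field_closed[OF K])
qed

end

section \<open>Invariance of the pairings under changes of chart and frame\<close>

lemma dualpair_bilinear:
  "dualpair (v + v') w = dualpair v w + dualpair v' w" "dualpair v (w + w') = dualpair v w + dualpair v w'"
  "dualpair (c *\<^sub>R v) w = of_real c * dualpair v w" "dualpair v (c *\<^sub>R w) = of_real c * dualpair v w"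
  "dualpair 0 w = 0" "dualpair v 0 = 0" "dualpair (- v) w = - dualpair v w" "dualpair v (- w) = - dualpair v w"
  "dualpair (v - v') w = dualpair v w - dualpair v' w" "dualpair v (w - w') = dualpair v w - dualpair v w'"
  by (simp_all add: dualpair_def sum.distrib algebra_simps scaleR_complex sum_distrib_left sum_negf sum_subtractf)

lemma dualpair_sum:
  "dualpair (\<Sum>x\<in>I. f x) w = (\<Sum>x\<in>I. dualpair (f x) w)" "dualpair v (\<Sum>x\<in>I. g x) = (\<Sum>x\<in>I. dualpair v (g x))"
  by (induction I rule: infinite_finite_induct) (simp_all add: dualpair_bilinear)

lemma dualpair_transpose: "dualpair (A *v v) w = dualpair v (transpose A *v w)"
proof -
  have "dualpair (A *v v) w = (\<^bold>\<Sum>s t. A $ s $ t * v $ t * w $ s)"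
    by (simp add: dualpair_def matrix_vector_mult_def sum_distrib_right)
  also have "\<dots> = (\<^bold>\<Sum>t s. A $ s $ t * v $ t * w $ s)" by (rule sum.swap)
  also have "\<dots> = dualpair v (transpose A *v w)"
    by (simp add: dualpair_def matrix_vector_mult_def transpose_def sum_distrib_left ac_simps)
  finally show ?thesis .
qed

lemma dualpair_trans:
  assumes "R ** T = mat 1"
  shows "dualpair (T *v v) (transpose R *v w) = dualpair v w"
  unfolding dualpair_transpose[symmetric] matrix_vector_mul_assoc assms by simp

text \<open>
  The Jacobians cancel by \<open>matrix_inv_congruence\<close> and the transition matrices by duality.
\<close>

lemma pair1_pullback:
  assumes "det J \<noteq> 0" "det h \<noteq> 0" "R ** T = mat 1"
  shows "pair1 (transpose J ** h ** J) (act1 J T v) (act1 J (transpose R) w) = pair1 h v w"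
proof -
  let ?H = "matrix_inv (transpose J ** h ** J)"
  have H: "matrix_inv h $ c $ d = (\<^bold>\<Sum>a b. J $ c $ a * J $ d $ b * ?H $ a $ b)" for c d
    unfolding matrix_inv_congruence(2)[OF assms(1,2), symmetric] by (rule matrix_conj_nth)
  have "pair1 (transpose J ** h ** J) (act1 J T v) (act1 J (transpose R) w)
    = (\<^bold>\<Sum>a b c d. of_real (J $ c $ a * J $ d $ b * ?H $ a $ b) * dualpair (v $ c) (w $ d))"
    unfolding pair1_def act1_def vec_lambda_beta dualpair_sum(1)
    unfolding dualpair_sum(2) dualpair_bilinear dualpair_trans[OF assms(3)]
    by (simp add: sum_distrib_left ac_simps)
  also have "\<dots> = (\<^bold>\<Sum>c d a b. of_real (J $ c $ a * J $ d $ b * ?H $ a $ b) * dualpair (v $ c) (w $ d))"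
    by (rule sum_swap4)
  also have "\<dots> = pair1 h v w"
    by (simp add: pair1_def H sum_distrib_right)
  finally show ?thesis .
qed

lemma pair2_fibre:
  assumes "R ** T = mat 1"
  shows "pair2 h (\<chi> a b. T *v v $ a $ b) (\<chi> a b. transpose R *v w $ a $ b) = pair2 h v w"
  unfolding pair2_def vec_lambda_beta dualpair_trans[OF assms] ..

lemma act2_component:
  "(\<chi> a b. act2 J T v $ a $ b $ s) = pullback J (\<chi> a b. (T *v v $ a $ b) $ s)"
  by (simp add: vec_eq_iff pullback_nth act2_def scaleR_complex)

lemma ip2_pullback:
  assumes "det J \<noteq> 0" "det h \<noteq> 0"
  shows "ip2 (transpose J ** h ** J) (pullback J u) (pullback J w) = ip2 h u w"
proof -
  let ?H = "cmat (matrix_inv (transpose J ** h ** J))"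
  have H: "cmat J ** ?H ** transpose (cmat J) = cmat (matrix_inv h)"
    using arg_cong[OF matrix_inv_congruence(2)[OF assms], of cmat] by (simp add: cmat_mult cmat_transpose)
  have adj: "(\<^bold>\<Sum>a b. (pullback J u) $ a $ b * m $ a $ b)
     = (\<^bold>\<Sum>c d. u $ c $ d * (cmat J ** m ** transpose (cmat J)) $ c $ d)" for m
  proof -
    have "(\<^bold>\<Sum>a b. (pullback J u) $ a $ b * m $ a $ b)
      = (\<^bold>\<Sum>a b c d. of_real (J $ c $ a * J $ d $ b) * u $ c $ d * m $ a $ b)"
      by (simp add: pullback_nth sum_distrib_right)
    also have "\<dots> = (\<^bold>\<Sum>c d a b. of_real (J $ c $ a * J $ d $ b) * u $ c $ d * m $ a $ b)"
      by (rule sum_swap4)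
    also have "\<dots> = (\<^bold>\<Sum>c d. u $ c $ d * (cmat J ** m ** transpose (cmat J)) $ c $ d)"
      by (simp add: matrix_conj_nth sum_distrib_left ac_simps)
    finally show ?thesis .
  qed
  have "cmat J ** (?H ** (pullback J w) ** transpose ?H) ** transpose (cmat J)
    = (cmat J ** ?H ** transpose (cmat J)) ** w ** transpose (cmat J ** ?H ** transpose (cmat J))"
    by (simp add: matrix_transpose_mul matrix_mul_assoc transpose_transpose)
  then show ?thesis unfolding ip2_def adj H by simp
qed

lemma pair2_pullback:
  assumes "det J \<noteq> 0" "det h \<noteq> 0" "R ** T = mat 1"
  shows "pair2 (transpose J ** h ** J) (act2 J T v) (act2 J (transpose R) w) = pair2 h v w"
proof -
  have "pair2 (transpose J ** h ** J) (act2 J T v) (act2 J (transpose R) w)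
    = pair2 h (\<chi> a b. T *v v $ a $ b) (\<chi> a b. transpose R *v w $ a $ b)"
    unfolding pair2_ip2 act2_component ip2_pullback[OF assms(1,2)] by simp
  then show ?thesis unfolding pair2_fibre[OF assms(3)] .
qed

section \<open>Self-dual and anti-self-dual forms of a conformal class\<close>

lemma hodge_sum:
  assumes "finite I"
  shows "hodge h (\<chi> a b. \<Sum>x\<in>I. k x * U x $ a $ b) = (\<chi> a b. \<Sum>x\<in>I. k x * hodge h (U x) $ a $ b)"
  using assms
proof (induction I)
  case empty
  then show ?case by (simp add: hodge_def vec_eq_iff)
next
  case (insert x I)
  have "hodge h (\<chi> a b. \<Sum>x\<in>insert x I. k x * U x $ a $ b)
    = hodge h (\<chi> a b. k x * U x $ a $ b + 1 * (\<chi> a b. \<Sum>x\<in>I. k x * U x $ a $ b) $ a $ b)"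
    using insert by simp
  also have "\<dots> = (\<chi> a b. k x * hodge h (U x) $ a $ b + 1 * hodge h (\<chi> a b. \<Sum>x\<in>I. k x * U x $ a $ b) $ a $ b)"
    by (rule hodge_linear)
  also have "\<dots> = (\<chi> a b. \<Sum>x\<in>insert x I. k x * hodge h (U x) $ a $ b)"
    using insert by simp
  finally show ?case .
qed

lemma half_proj_sum:
  assumes "finite I"
  shows "half_proj h \<mu> (\<chi> a b. \<Sum>x\<in>I. k x * U x $ a $ b) = (\<chi> a b. \<Sum>x\<in>I. k x * half_proj h \<mu> (U x) $ a $ b)"
  unfolding half_proj_def hodge_sum[OF assms]
  by (simp add: vec_eq_iff sum_divide_distrib sum.distrib add_divide_distrib distrib_left)

lemma half_proj_zero_iff: "\<mu> \<noteq> 0 \<Longrightarrow> half_proj h \<mu> u = 0 \<longleftrightarrow> hodge h u = (\<chi> a b. - \<mu> * u $ a $ b)"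
  by (auto simp: half_proj_def vec_eq_iff field_simps add_eq_0_iff)

lemma skew_d1: "skew (\<chi> a b. d1 W \<phi> i y $ a $ b $ s)"
  by (simp add: skew_def d1_def)

lemma skew_curvature: "skew (\<chi> a b. curvature W i y $ a $ b $ s $ t)"
  unfolding skew_def by (simp add: curvature_def matrix_def)

locale conformal_bundle = connection_bundle N K V for N :: "('m, 'i) mfd" and K and V :: "('m, 'i, 'r::finite) vbundle" +
  fixes q :: nat and c :: "'i metric set" and vol :: "'i metric \<Rightarrow> 'm measure"
  assumes cc: "conformal_class N q c"
    and vol: "\<And>g. g \<in> c \<Longrightarrow> volume_measure N g (vol g)"
begin

lemma class_metric: "g \<in> c \<Longrightarrow> pseudo_metric N q g"
  using cc by (auto simp: conformal_class_def)

lemma class_ex: "\<exists>g. g \<in> c"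
proof -
  obtain g where g: "pseudo_metric N q g" "c = {h. pseudo_metric N q h \<and> (\<exists>\<omega>. rescaling N \<omega> g h)}"
    using cc by (auto simp: conformal_class_def)
  have "rescaling N (\<lambda>_. 1) g g" by (simp add: rescaling_def)
  then show ?thesis using g by blast
qed

lemma class_rescale:
  assumes "g \<in> c" "h \<in> c" "y \<in> cdom N i"
  shows "\<exists>t>0. h i y = t *\<^sub>R g i y"
proof -
  obtain k where k: "\<exists>\<omega>. rescaling N \<omega> k g" "\<exists>\<omega>. rescaling N \<omega> k h"
    using cc assms by (auto simp: conformal_class_def)
  obtain p where p: "p \<in> dom N i" "y = crd N i p" using assms(3) by (auto simp: cdom_def)
  have "p \<in> topspace (mtop N)" using p dom_subset by blast
  then obtain s t where "s > 0" "t > 0" "g i y = s\<^sup>2 *\<^sub>R k i y" "h i y = t\<^sup>2 *\<^sub>R k i y"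
    using k p unfolding rescaling_def by blast
  then show ?thesis by (intro exI[of _ "t\<^sup>2 / s\<^sup>2"]) simp
qed

lemmas metric_sym = pseudo_metric_det(1)[OF class_metric]
lemmas metric_det = pseudo_metric_det(2)[OF class_metric]
lemmas metric_sgn = pseudo_metric_det(3)[OF class_metric]

text \<open>
  The index of a metric on \<open>\<real>\<^sup>4\<close> is at most 4, so it is odd in Minkowskian signature only.
\<close>

lemma star_eigenvalue_sq:
  assumes "g \<in> c" "y \<in> cdom N i" "\<sigma> \<in> {1, -1}"
  shows "(star_eigenvalue q \<sigma>)\<^sup>2 = of_real (sgn (det (g i y)))"
proof -
  have "has_index q (g i y)" using class_metric[OF assms(1)] assms(2) by (simp add: pseudo_metric_def)
  then obtain \<sigma>' :: "4 \<Rightarrow> real" where "card {a. \<sigma>' a = -1} = q" unfolding has_index_def by blast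
  then have "q \<le> 4" using card_mono[of UNIV "{a. \<sigma>' a = -1}"] by simp
  then have "q = 0 \<or> q = 1 \<or> q = 2 \<or> q = 3 \<or> q = 4" by linarith
  then show ?thesis unfolding metric_sgn[OF assms(1,2)] star_eigenvalue_def using assms(3)
    by (auto simp: power_mult_distrib)
qed

lemma star_eigenvalue_nonzero: "\<sigma> \<in> {1, -1} \<Longrightarrow> star_eigenvalue q \<sigma> \<noteq> 0"
  by (auto simp: star_eigenvalue_def)

lemma star_eigenvalue_minus: "star_eigenvalue q (- \<sigma>) = - star_eigenvalue q \<sigma>"
  by (simp add: star_eigenvalue_def)

text \<open>
  By conformal invariance of the star the eigenvalue equation may be checked for one metric of the
  class.
\<close>

lemma in_E2pm_iff:
  assumes "g \<in> c" "y \<in> cdom N i"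
  shows "in_E2pm q c \<sigma> i y u \<longleftrightarrow> skew u \<and> hodge (g i y) u = (\<chi> a b. star_eigenvalue q \<sigma> * u $ a $ b)"
proof -
  have "hodge (h i y) u = hodge (g i y) u" if h: "h \<in> c" for h
  proof -
    obtain t where "t > 0" "h i y = t *\<^sub>R g i y" using class_rescale[OF assms(1) h assms(2)] by blast
    then show ?thesis using hodge_rescale[OF _ metric_det[OF assms]] by simp
  qed
  then have eq: "(\<forall>h\<in>c. hodge (h i y) u = X) \<longleftrightarrow> hodge (g i y) u = X" for X
    using assms(1) by (metis (no_types))
  show ?thesis unfolding in_E2pm_def skew_def eq ..
qed

lemma proj_pm_eq:
  assumes g: "g \<in> c" "y \<in> cdom N i" and \<sigma>: "\<sigma> \<in> {1, -1}" and u: "skew u"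
  shows "proj_pm q c \<sigma> i y u = half_proj (g i y) (star_eigenvalue q \<sigma>) u"
  unfolding proj_pm_def
proof (rule the_equality)
  let ?P = "half_proj (g i y) (star_eigenvalue q \<sigma>) u"
  have P: "skew ?P" by (rule skew_half_proj[OF u])
  have uP: "skew (u - ?P)" unfolding skew_def
  proof (intro allI)
    fix a b
    have "u $ a $ b = - u $ b $ a" "?P $ a $ b = - ?P $ b $ a" using u P unfolding skew_def by blast+
    then show "(u - ?P) $ a $ b = - (u - ?P) $ b $ a" by simp
  qed
  note hp = hodge_half_proj[OF metric_sym[OF g] metric_det[OF g] star_eigenvalue_sq[OF g \<sigma>] u]
  show "in_E2pm q c \<sigma> i y ?P \<and> in_E2pm q c (- \<sigma>) i y (u - ?P)"
    unfolding in_E2pm_iff[OF g] star_eigenvalue_minus using P uP hp by blast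
  fix v assume "in_E2pm q c \<sigma> i y v \<and> in_E2pm q c (- \<sigma>) i y (u - v)"
  then show "v = ?P"
    unfolding in_E2pm_iff[OF g] star_eigenvalue_minus
    using half_proj_unique[OF star_eigenvalue_nonzero[OF \<sigma>]] by blast
qed

lemma d_pm_eq:
  assumes "g \<in> c" "y \<in> cdom N i" "\<sigma> \<in> {1, -1}"
  shows "d_pm q c \<sigma> W \<phi> i y = (\<chi> a b s. half_proj (g i y) (star_eigenvalue q \<sigma>) (\<chi> a b. d1 W \<phi> i y $ a $ b $ s) $ a $ b)"
  unfolding d_pm_def proj_pm_eq[OF assms skew_d1] ..

text \<open>
  \<open>F\<^sub>\<sigma> = 0\<close> says that the entries of \<open>F\<close> lie in the opposite eigenspace.
\<close>

lemma curvature_eigen: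
  assumes "curvature_pm_zero N q c \<sigma> V" "g \<in> c" "y \<in> cdom N i" "\<sigma> \<in> {1, -1}"
  shows "hodge (g i y) (\<chi> a b. curvature V i y $ a $ b $ s $ t)
    = (\<chi> a b. - star_eigenvalue q \<sigma> * curvature V i y $ a $ b $ s $ t)"
proof -
  have "proj_pm q c \<sigma> i y (\<chi> a b. curvature V i y $ a $ b $ s $ t) = 0"
    using assms(1,3) unfolding curvature_pm_zero_def by blast
  then have "half_proj (g i y) (star_eigenvalue q \<sigma>) (\<chi> a b. curvature V i y $ a $ b $ s $ t) = 0"
    unfolding proj_pm_eq[OF assms(2-4) skew_curvature] .
  then show ?thesis unfolding half_proj_zero_iff[OF star_eigenvalue_nonzero[OF assms(4)]] by simp
qed

text \<open>
  \<open>d\<^sub>\<sigma> d\<^sup>D f = F\<^sub>\<sigma> f\<close>.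
\<close>

lemma d_pm_d0_zero:
  assumes F: "curvature_pm_zero N q c \<sigma> V" and f: "f \<in> forms0 N K V" and y: "y \<in> cdom N i" and \<sigma>: "\<sigma> \<in> {1, -1}"
  shows "d_pm q c \<sigma> V (d0 V f) i y = 0"
proof -
  obtain g where g: "g \<in> c" using class_ex by blast
  let ?F = "\<lambda>s t. (\<chi> a b. curvature V i y $ a $ b $ s $ t)"
  have "half_proj (g i y) (star_eigenvalue q \<sigma>) (\<chi> a b. d1 V (d0 V f) i y $ a $ b $ s) = 0" for s
  proof -
    have "(\<chi> a b. d1 V (d0 V f) i y $ a $ b $ s) = (\<chi> a b. \<^bold>\<Sum>t. f i y $ t * ?F s t $ a $ b)"
      unfolding d1_d0[OF f y] by (simp add: matrix_vector_mult_def mult.commute)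
    moreover have "half_proj (g i y) (star_eigenvalue q \<sigma>) (?F s t) = 0" for t
      unfolding half_proj_zero_iff[OF star_eigenvalue_nonzero[OF \<sigma>]]
      using curvature_eigen[OF F g y \<sigma>] by simp
    moreover have "half_proj (g i y) (star_eigenvalue q \<sigma>) (\<chi> a b. \<^bold>\<Sum>t. f i y $ t * ?F s t $ a $ b)
        = (\<chi> a b. \<^bold>\<Sum>t. f i y $ t * half_proj (g i y) (star_eigenvalue q \<sigma>) (?F s t) $ a $ b)"
      by (rule half_proj_sum) simp
    ultimately show ?thesis by (simp add: vec_eq_iff)
  qed
  then show ?thesis unfolding d_pm_eq[OF g y \<sigma>] by (simp add: vec_eq_iff)
qed

lemma conformal_bundle_dual: "conformal_bundle N K (dual V) q c vol"
proof -
  interpret d: connection_bundle N K "dual V" by (rule connection_bundle_dual)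
  show ?thesis by unfold_locales (rule cc, rule vol)
qed

lemma curvature_pm_zero_dual:
  assumes F: "curvature_pm_zero N q c \<sigma> V" and \<sigma>: "\<sigma> \<in> {1, -1}"
  shows "curvature_pm_zero N q c \<sigma> (dual V)"
  unfolding curvature_pm_zero_def
proof (intro allI ballI)
  fix i y s t assume y: "y \<in> cdom N i"
  obtain g where g: "g \<in> c" using class_ex by blast
  have e: "(\<chi> a b. curvature (dual V) i y $ a $ b $ s $ t)
      = (\<chi> a b. \<Sum>x\<in>{t}. (-1) * (\<chi> a b. curvature V i y $ a $ b $ x $ s) $ a $ b)"
    by (simp add: curvature_dual[OF y] transpose_def)
  have "half_proj (g i y) (star_eigenvalue q \<sigma>) (\<chi> a b. curvature V i y $ a $ b $ x $ s) = 0" for x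
    unfolding half_proj_zero_iff[OF star_eigenvalue_nonzero[OF \<sigma>]]
    using curvature_eigen[OF F g y \<sigma>] by simp
  then have "half_proj (g i y) (star_eigenvalue q \<sigma>) (\<chi> a b. curvature (dual V) i y $ a $ b $ s $ t) = 0"
    unfolding e by (subst half_proj_sum) (simp_all add: vec_eq_iff)
  then show "proj_pm q c \<sigma> i y (\<chi> a b. curvature (dual V) i y $ a $ b $ s $ t) = 0"
    unfolding proj_pm_eq[OF g y \<sigma> skew_curvature] .
qed

lemma smooth_half_proj:
  assumes g: "g \<in> c" and u: "\<And>a b. smooth_on (cdom N i) (\<lambda>y. u y $ a $ b)"
  shows "smooth_on (cdom N i) (\<lambda>y. half_proj (g i y) \<mu> (u y) $ a $ b)"
proof -
  note sm = smooth_metric[OF class_metric[OF g]]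
  have "smooth_on (cdom N i) (\<lambda>y. hodge (g i y) (u y) $ a $ b)"
    unfolding hodge_def vec_lambda_beta
    by (intro smooth_on_mult smooth_on_const smooth_on_sum open_cdom finite smooth_on_of_real sm u)
  then have "smooth_on (cdom N i) (\<lambda>y. (u y $ a $ b + hodge (g i y) (u y) $ a $ b * (1 / \<mu>)) * (1 / 2))"
    by (intro smooth_on_mult smooth_on_add smooth_on_const open_cdom u)
  then show ?thesis by (simp add: half_proj_def)
qed

lemma form2D:
  assumes "f \<in> forms2 N K' V"
  shows "smooth_on (cdom N i) (f i)"
    "\<lbrakk>p \<in> dom N i; p \<in> dom N j\<rbrakk> \<Longrightarrow> f i (crd N i p) = act2 (jac N i j p) (trans V i j p) (f j (crd N j p))"
proof -
  have s: "is_section N V act2 f" using assms by (simp add: forms2_def)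
  then show "smooth_on (cdom N i) (f i)" by (simp add: is_section_def)
  assume "p \<in> dom N i" "p \<in> dom N j"
  then show "f i (crd N i p) = act2 (jac N i j p) (trans V i j p) (f j (crd N j p))"
    using s unfolding is_section_def by blast
qed

text \<open>
  Outside Minkowskian signature the eigenvalues are \<open>1\<close> and \<open>-1\<close>, so the projections are defined over
  the reals.
\<close>

lemma half_proj_K:
  assumes "q \<notin> {1, 3}" "\<sigma> \<in> {1, -1}" "\<And>a b. u $ a $ b \<in> K"
  shows "half_proj h (star_eigenvalue q \<sigma>) u $ a $ b \<in> K"
proof (cases "K = UNIV")
  case False
  then have [simp]: "K = \<real>" using K by (simp add: scalar_field_def)
  have "star_eigenvalue q \<sigma> \<in> \<real>" using assms by (auto simp: star_eigenvalue_def)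
  moreover have "hodge h u $ a $ b \<in> \<real>" for a b
    using assms(3) unfolding hodge_def vec_lambda_beta
    by (intro Reals_mult sum_in_Reals Reals_of_real Reals_divide) auto
  ultimately show ?thesis using assms(3) by (auto simp: half_proj_def)
qed simp

text \<open>
  The change of frame mixes the fibre components linearly and the change of chart pulls back by an
  orientation-preserving Jacobian; the projection commutes with both.
\<close>

lemma d_pm_forms:
  assumes f: "f \<in> forms1 N K V" and \<sigma>: "\<sigma> \<in> {1, -1}"
  shows "d_pm q c \<sigma> V f \<in> forms2_pm N q c K \<sigma> V"
proof -
  obtain g where g: "g \<in> c" using class_ex by blast
  let ?ev = "star_eigenvalue q \<sigma>" and ?d = "d1 V f"
  note e = d_pm_eq[OF g _ \<sigma>, of _ _ V f]
  note F = form2D[OF d1_forms2[OF f]]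
  have comp: "(\<chi> a b. d_pm q c \<sigma> V f i y $ a $ b $ s) = half_proj (g i y) ?ev (\<chi> a b. ?d i y $ a $ b $ s)"
    if "y \<in> cdom N i" for i y s
    unfolding e[OF that] by simp
  show ?thesis
    unfolding forms2_pm_def forms2_def is_section_def mem_Collect_eq
  proof (intro conjI allI ballI)
    fix i
    show "smooth_on (cdom N i) (d_pm q c \<sigma> V f i)"
    proof (rule smooth_on_cong[OF open_cdom e[symmetric]])
      have "smooth_on (cdom N i) (\<lambda>y. (\<chi> a b. ?d i y $ a $ b $ s) $ a $ b)" for s a b
        by (simp, intro smooth_on_vec_nth open_cdom F)
      then show "smooth_on (cdom N i) (\<lambda>y. \<chi> a b s. half_proj (g i y) ?ev (\<chi> a b. ?d i y $ a $ b $ s) $ a $ b)"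
        by (intro smooth_on_vec_lambda open_cdom smooth_half_proj g) blast
    qed
  next
    fix i j p assume "p \<in> dom N i \<inter> dom N j"
    then have p: "p \<in> dom N i" "p \<in> dom N j" by auto
    let ?J = "jac N i j p" and ?T = "trans V i j p"
    have gJ: "g i (crd N i p) = transpose ?J ** g j (crd N j p) ** ?J"
      using class_metric[OF g] p unfolding pseudo_metric_def by blast
    have det: "det ?J > 0" "det (g j (crd N j p)) \<noteq> 0" using det_jac p metric_det[OF g] by auto
    let ?u = "\<lambda>t. (\<chi> a b. ?d j (crd N j p) $ a $ b $ t)"
    have "(\<chi> a b. d_pm q c \<sigma> V f i (crd N i p) $ a $ b $ s)
      = (\<chi> a b. act2 ?J ?T (d_pm q c \<sigma> V f j (crd N j p)) $ a $ b $ s)" for s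
    proof -
      have T: "(\<chi> a b. (?T *v v $ a $ b) $ s) = (\<chi> a b. \<^bold>\<Sum>t. ?T $ s $ t * (\<chi> a b. v $ a $ b $ t) $ a $ b)"
        for v :: "complex^'r^4^4"
        by (simp add: matrix_vector_mult_def)
      have "(\<chi> a b. d_pm q c \<sigma> V f i (crd N i p) $ a $ b $ s)
        = half_proj (transpose ?J ** g j (crd N j p) ** ?J) ?ev
            (pullback ?J (\<chi> a b. (?T *v ?d j (crd N j p) $ a $ b) $ s))"
        using comp[of "crd N i p" i s] p F(2)[OF p] gJ by (simp add: act2_component)
      also have "\<dots> = pullback ?J (\<chi> a b. \<^bold>\<Sum>t. ?T $ s $ t * half_proj (g j (crd N j p)) ?ev (?u t) $ a $ b)"
        unfolding half_proj_pullback[OF det] T by (simp only: half_proj_sum finite)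
      also have "\<dots> = (\<chi> a b. act2 ?J ?T (d_pm q c \<sigma> V f j (crd N j p)) $ a $ b $ s)"
        unfolding act2_component T using comp[of "crd N j p" j] p by simp
      finally show ?thesis .
    qed
    then show "d_pm q c \<sigma> V f i (crd N i p) = act2 ?J ?T (d_pm q c \<sigma> V f j (crd N j p))"
      by (simp add: vec_eq_iff)
  next
    fix i y a b s assume y: "y \<in> cdom N i"
    show "d_pm q c \<sigma> V f i y $ a $ b $ s \<in> scalars_pm q K"
    proof (cases "q \<in> {1, 3}")
      case False
      have "?d i y $ a $ b $ s \<in> K" for a b
        using d1_forms2[OF f] y unfolding forms2_def by blast
      then have "half_proj (g i y) ?ev (\<chi> a b. ?d i y $ a $ b $ s) $ a $ b \<in> K"
        by (intro half_proj_K False \<sigma>) simp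
      then show ?thesis unfolding e[OF y] scalars_pm_def if_not_P[OF False] by simp
    qed (simp add: scalars_pm_def)
    show "d_pm q c \<sigma> V f i y $ a $ b = - d_pm q c \<sigma> V f i y $ b $ a"
      using skew_half_proj[OF skew_d1[of V f i y], of "g i y" ?ev]
      unfolding e[OF y] skew_def vec_eq_iff unfolding vector_uminus_component unfolding vec_lambda_beta by blast
  next
    fix i y s assume y: "y \<in> cdom N i"
    show "in_E2pm q c \<sigma> i y (\<chi> a b. d_pm q c \<sigma> V f i y $ a $ b $ s)"
      unfolding comp[OF y] in_E2pm_iff[OF g y]
      by (intro conjI skew_half_proj skew_d1
          hodge_half_proj(1)[OF metric_sym[OF g y] metric_det[OF g y] star_eigenvalue_sq[OF g y \<sigma>]])
  qed
qed

end

section \<open>The integrand as a divergence\<close>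

lemma matrix_vector_mult_minus_left: "(- A) *v v = - (A *v v)" for A :: "complex^'n^'m"
  by (simp add: matrix_vector_mult_def vec_eq_iff sum_negf)

lemma pd_sum3:
  assumes "\<And>b k l. f b k l differentiable (at y)"
  shows "pd a (\<lambda>z. \<^bold>\<Sum>b k l. f b k l z) y
    = (\<^bold>\<Sum>b k l. pd a (f (b::4) (k::4) (l::4)) y)"
proof -
  have d1: "(\<lambda>z. \<^bold>\<Sum>l. f b k l z) differentiable (at y)" for b k
    by (rule differentiable_sum) (use assms in auto)
  have d2: "(\<lambda>z. \<^bold>\<Sum>k l. f b k l z) differentiable (at y)" for b
    by (rule differentiable_sum) (use d1 in auto)
  show ?thesis
    unfolding pd_sum[OF finite d2] pd_sum[OF finite d1] pd_sum[OF finite assms] ..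
qed

lemma bounded_bilinear_dualpair: "bounded_bilinear (dualpair :: complex^'r \<Rightarrow> complex^'r::finite \<Rightarrow> complex)"
proof -
  have "bilinear (dualpair :: complex^'r \<Rightarrow> complex^'r \<Rightarrow> complex)"
    unfolding bilinear_def by (auto intro!: linearI simp: dualpair_bilinear scaleR_complex)
  then show ?thesis by (simp add: bilinear_conv_bounded_bilinear)
qed

lemma sum4_reorder:
  fixes f :: "4 \<Rightarrow> 4 \<Rightarrow> 4 \<Rightarrow> 4 \<Rightarrow> complex"
  shows "(\<^bold>\<Sum>a b k l. f a b k l)
    = (\<^bold>\<Sum>l b a k. f a b k l)"
proof -
  have "(\<^bold>\<Sum>a b k l. f a b k l)
    = (\<^bold>\<Sum>b a k l. f a b k l)" by (rule sum.swap)
  also have "\<dots> = (\<^bold>\<Sum>b a l k. f a b k l)"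
    by (intro sum.cong refl sum.swap)
  also have "\<dots> = (\<^bold>\<Sum>b l a k. f a b k l)"
    by (intro sum.cong refl sum.swap)
  also have "\<dots> = (\<^bold>\<Sum>l b a k. f a b k l)" by (rule sum.swap)
  finally show ?thesis .
qed

lemma skew_sum:
  fixes k x :: "4 \<Rightarrow> 4 \<Rightarrow> complex"
  assumes "\<And>a b. k b a = - k a b"
  shows "(\<^bold>\<Sum>a b. k a b * (x a b - x b a)) = 2 * (\<^bold>\<Sum>a b. k a b * x a b)"
proof -
  have "(\<^bold>\<Sum>a b. k a b * x b a) = (\<^bold>\<Sum>b a. k a b * x b a)" by (rule sum.swap)
  also have "\<dots> = - (\<^bold>\<Sum>a b. k a b * x a b)"
    by (subst assms) (simp add: sum_negf)
  finally show ?thesis by (simp add: right_diff_distrib sum_subtractf)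
qed

abbreviation lc :: "4 \<Rightarrow> 4 \<Rightarrow> 4 \<Rightarrow> 4 \<Rightarrow> complex" where
  "lc a b k l \<equiv> complex_of_real (levi_civita a b k l)"

lemma lc_swap: "lc b a k l = - lc a b k l" "lc a k b l = - lc a b k l" "lc a b l k = - lc a b k l"
  by (subst levi_civita_swap, simp)+

text \<open>
  The coefficient of \<open>u \<and> v\<close> for 2-forms with values in dual bundles, normalized like \<open>wedge2\<close>.
\<close>

definition eps_pair :: "(4 \<Rightarrow> 4 \<Rightarrow> complex^'r) \<Rightarrow> (4 \<Rightarrow> 4 \<Rightarrow> complex^'r::finite) \<Rightarrow> complex" where
  "eps_pair u v = (\<^bold>\<Sum>a b k l. lc a b k l * dualpair (u a b) (v k l))"

lemma wedge2_eps_pair: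
  "(\<^bold>\<Sum>s. wedge2 (\<chi> a b. u a b $ s) (\<chi> a b. v a b $ s)) = eps_pair u v"
proof -
  have "(\<^bold>\<Sum>s. wedge2 (\<chi> a b. u a b $ s) (\<chi> a b. v a b $ s))
    = (\<^bold>\<Sum>s a b k l. lc a b k l * (u a b $ s * v k l $ s))"
    by (simp add: wedge2_def eps2_def sum_distrib_left ac_simps)
  also have "\<dots> = (\<^bold>\<Sum>a b s k l. lc a b k l * (u a b $ s * v k l $ s))"
    by (subst sum.swap) (intro sum.cong refl sum.swap)
  also have "\<dots> = (\<^bold>\<Sum>a b k l s. lc a b k l * (u a b $ s * v k l $ s))"
    by (intro sum.cong refl, subst sum.swap) (intro sum.cong refl sum.swap)
  also have "\<dots> = eps_pair u v"
    by (simp add: eps_pair_def dualpair_def sum_distrib_left)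
  finally show ?thesis .
qed

lemma eps_pair_antisym:
  "eps_pair (\<lambda>a b. u a b - u b a) (\<lambda>k l. v k l - v l k) = 4 * eps_pair u v"
proof -
  let ?w = "\<lambda>k l. v k l - v l k"
  have "eps_pair (\<lambda>a b. u a b - u b a) ?w
    = (\<^bold>\<Sum>a b k l. lc a b k l * (dualpair (u a b) (?w k l) - dualpair (u b a) (?w k l)))"
    by (simp only: eps_pair_def dualpair_bilinear(9))
  also have "\<dots> = (\<^bold>\<Sum>k l a b. lc a b k l * (dualpair (u a b) (?w k l) - dualpair (u b a) (?w k l)))"
    by (rule sum_swap4)
  also have "\<dots> = (\<^bold>\<Sum>k l. 2 * (\<^bold>\<Sum>a b. lc a b k l * dualpair (u a b) (?w k l)))"
    by (intro sum.cong refl skew_sum lc_swap)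
  also have "\<dots> = 2 * (\<^bold>\<Sum>k l a b. lc a b k l * dualpair (u a b) (?w k l))"
    by (simp only: sum_distrib_left)
  also have "(\<^bold>\<Sum>k l a b. lc a b k l * dualpair (u a b) (?w k l))
    = (\<^bold>\<Sum>a b k l. lc a b k l * dualpair (u a b) (?w k l))"
    by (rule sum_swap4)
  also have "\<dots> = (\<^bold>\<Sum>a b. 2 * (\<^bold>\<Sum>k l. lc a b k l * dualpair (u a b) (v k l)))"
    unfolding dualpair_bilinear by (intro sum.cong refl skew_sum lc_swap)
  also have "\<dots> = 2 * eps_pair u v"
    by (simp only: eps_pair_def sum_distrib_left)
  finally show ?thesis by simp
qed

text \<open>
  Used for \<open>X\<^sub>a\<^sub>e\<^sub>b = F\<^sub>a\<^sub>e \<phi>\<^sub>b\<close>: it rewrites \<open>\<langle>F \<cdot> \<phi>, w\<rangle>\<close> in terms of scalar 2-forms whose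
  indices are raised.
\<close>

lemma pair1_contract:
  assumes "transpose h = h" "det h \<noteq> 0"
  shows "pair1 h (\<chi> a. \<^bold>\<Sum>e b. matrix_inv h $ e $ b *\<^sub>R X a e b) w
    = (\<^bold>\<Sum>l b. raised h (\<chi> a e. dualpair (X a e b) (w $ l)) $ l $ b)"
proof -
  let ?H = "matrix_inv h"
  have sym: "?H $ i $ j = ?H $ j $ i" for i j
    by (rule matrix_inv_symmetric_nth[OF assms])
  have "pair1 h (\<chi> a. \<^bold>\<Sum>e b. ?H $ e $ b *\<^sub>R X a e b) w
    = (\<^bold>\<Sum>a l e b. of_real (?H $ a $ l * ?H $ e $ b) * dualpair (X a e b) (w $ l))"
    by (simp add: pair1_def dualpair_sum dualpair_bilinear sum_distrib_left ac_simps)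
  also have "\<dots> = (\<^bold>\<Sum>b l a e. of_real (?H $ a $ l * ?H $ e $ b) * dualpair (X a e b) (w $ l))"
    by (rule sum4_reorder)
  also have "\<dots> = (\<^bold>\<Sum>l b a e. of_real (?H $ a $ l * ?H $ e $ b) * dualpair (X a e b) (w $ l))"
    by (rule sum.swap)
  also have "\<dots> = (\<^bold>\<Sum>l b a e. of_real (?H $ l $ a * ?H $ b $ e) * dualpair (X a e b) (w $ l))"
    by (intro sum.cong refl, subst (1 2) sym) (rule refl)
  also have "\<dots> = (\<^bold>\<Sum>l b. raised h (\<chi> a e. dualpair (X a e b) (w $ l)) $ l $ b)"
    unfolding matrix_conj_nth by simp
  finally show ?thesis .
qed

context connection_bundle
begin

lemma dualpair_covd:
  assumes "s differentiable (at y)" "t differentiable (at y)"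
  shows "pd a (\<lambda>z. dualpair (s z) (t z)) y = dualpair (covd V i a s y) (t y) + dualpair (s y) (covd (dual V) i a t y)"
  unfolding pd_bilinear(1)[OF bounded_bilinear_dualpair assms] covd_def dualpair_bilinear conn_dual
  by (simp add: dualpair_transpose matrix_vector_mult_minus_left dualpair_bilinear)

text \<open>
  Up to a constant factor, the vector density that corresponds to the 3-form \<open>\<phi> \<and> d\<^sup>D\<psi>\<close>.
\<close>

definition wedge_current :: "'i \<Rightarrow> (real^4 \<Rightarrow> complex^'r^4) \<Rightarrow> (real^4 \<Rightarrow> complex^'r^4) \<Rightarrow> 4 \<Rightarrow> real^4 \<Rightarrow> complex" where
  "wedge_current i \<phi> \<psi> a z = (\<^bold>\<Sum>b k l. lc a b k l * dualpair (\<phi> z $ b) (covd (dual V) i k (\<lambda>z. \<psi> z $ l) z))"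

lemma smooth_wedge_current:
  assumes S: "open S" "S \<subseteq> cdom N i" and \<phi>: "smooth_on S \<phi>" and \<psi>: "smooth_on S \<psi>"
  shows "smooth_on S (wedge_current i \<phi> \<psi> a)"
proof -
  interpret d: connection_bundle N K "dual V" by (rule connection_bundle_dual)
  show ?thesis unfolding wedge_current_def
    by (intro smooth_on_sum finite smooth_on_mult smooth_on_const S
        smooth_on_bilinear[OF bounded_bilinear_dualpair] smooth_on_vec_nth d.smooth_covd \<phi> \<psi>)
qed

text \<open>
  The Leibniz rule for \<open>d (\<phi> \<and> d\<^sup>D\<psi>)\<close>; the second covariant derivatives of \<open>\<psi>\<close> are antisymmetrized by
  the Levi-Civita symbol and so combine to the curvature of the dual bundle.
\<close>

lemma divergence_wedge_current:
  assumes S: "open S" "S \<subseteq> cdom N i" "y \<in> S" and \<phi>: "smooth_on S \<phi>" and \<psi>: "smooth_on S \<psi>"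
  shows "(\<^bold>\<Sum>a. pd a (wedge_current i \<phi> \<psi> a) y) =
    eps_pair (\<lambda>a b. d1 V (\<lambda>_. \<phi>) i y $ a $ b) (\<lambda>a b. d1 (dual V) (\<lambda>_. \<psi>) i y $ a $ b) / 4
    - (\<^bold>\<Sum>l b a k. lc a b k l *
        dualpair (curvature V i y $ a $ k *v \<phi> y $ b) (\<psi> y $ l)) / 2"
proof -
  interpret d: connection_bundle N K "dual V" by (rule connection_bundle_dual)
  have y: "y \<in> cdom N i" using S by blast
  let ?f = "\<lambda>b z. \<phi> z $ b" and ?g = "\<lambda>l z. \<psi> z $ l"
  have sf: "smooth_on S (?f b)" "smooth_on S (?g b)" for b
    by (intro smooth_on_vec_nth S \<phi> \<psi>)+
  have sg: "smooth_on S (covd (dual V) i k (?g l))" for k l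
    by (rule d.smooth_covd[OF S(1,2) sf(2)])
  have df: "?f b differentiable (at y)" for b using smooth_on_differentiable[OF sf(1) S(1,3)] .
  have dg: "covd (dual V) i k (?g l) differentiable (at y)" for k l
    using smooth_on_differentiable[OF sg S(1,3)] .
  define C where "C a b = covd V i a (?f b) y" for a b
  define C' where "C' a b = covd (dual V) i a (?g b) y" for a b
  define E where "E a k l = covd (dual V) i a (covd (dual V) i k (?g l)) y" for a k l
  note bd = pd_bilinear(2)[OF bounded_bilinear_dualpair df dg]
  have p: "pd a (wedge_current i \<phi> \<psi> a) y = (\<^bold>\<Sum>b k l. lc a b k l * (dualpair (C a b) (C' k l) + dualpair (\<phi> y $ b) (E a k l)))" for a
  proof -
    have L: "bounded_linear (\<lambda>z. lc a b k l * z)" for b k l by (rule bounded_linear_mult_right)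
    have "pd a (wedge_current i \<phi> \<psi> a) y = (\<^bold>\<Sum>b k l. pd a (\<lambda>z. lc a b k l * dualpair (?f b z) (covd (dual V) i k (?g l) z)) y)"
      unfolding wedge_current_def
      by (rule pd_sum3) (rule pd_linear(2)[OF L bd])
    also have "\<dots> = (\<^bold>\<Sum>b k l. lc a b k l * (dualpair (C a b) (C' k l) + dualpair (\<phi> y $ b) (E a k l)))"
      unfolding pd_linear(1)[OF L bd] dualpair_covd[OF df dg, of a _ _ _ i] C_def C'_def E_def ..
    finally show ?thesis .
  qed
  have "(\<^bold>\<Sum>a. pd a (wedge_current i \<phi> \<psi> a) y) = eps_pair C C' +
    (\<^bold>\<Sum>a b k l. lc a b k l * dualpair (\<phi> y $ b) (E a k l))"
    unfolding p eps_pair_def by (simp add: distrib_left sum.distrib)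
  also have "eps_pair C C' = eps_pair (\<lambda>a b. C a b - C b a) (\<lambda>a b. C' a b - C' b a) / 4"
    unfolding eps_pair_antisym by simp
  also have "\<dots> = eps_pair (\<lambda>a b. d1 V (\<lambda>_. \<phi>) i y $ a $ b) (\<lambda>a b. d1 (dual V) (\<lambda>_. \<psi>) i y $ a $ b) / 4"
    by (simp add: d1_def C_def C'_def)
  also have "(\<^bold>\<Sum>a b k l. lc a b k l * dualpair (\<phi> y $ b) (E a k l))
    = (\<^bold>\<Sum>l b a k. lc a b k l * dualpair (\<phi> y $ b) (E a k l))"
    by (rule sum4_reorder)
  also have "\<dots> = (\<^bold>\<Sum>l b. (\<^bold>\<Sum>a k. lc a b k l *
      (dualpair (\<phi> y $ b) (E a k l) - dualpair (\<phi> y $ b) (E k a l))) / 2)"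
  proof -
    have sw: "lc k b a l = - lc a b k l" for a b k l
      using lc_swap by (metis minus_minus)
    show ?thesis
      by (intro sum.cong refl, subst skew_sum) (simp_all add: sw[symmetric])
  qed
  also have "\<dots> = (\<^bold>\<Sum>l b. (\<^bold>\<Sum>a k. lc a b k l *
      - dualpair (curvature V i y $ a $ k *v \<phi> y $ b) (\<psi> y $ l)) / 2)"
  proof -
    have "dualpair (\<phi> y $ b) (E a k l) - dualpair (\<phi> y $ b) (E k a l)
      = - dualpair (curvature V i y $ a $ k *v \<phi> y $ b) (\<psi> y $ l)" for a b k l
      unfolding dualpair_bilinear(10)[symmetric] E_def d.ricci_identity[OF S sf(2)] curvature_dual[OF y]
        dualpair_transpose by (simp add: matrix_vector_mult_minus_left dualpair_bilinear)
    then show ?thesis by simp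
  qed
  finally show ?thesis
    by (simp add: sum_negf sum_divide_distrib)
qed

end

context conformal_bundle
begin

text \<open>
  By \<open>ip2_half_proj\<close> the first two pairings combine to a multiple of \<open>d\<^sup>D\<phi> \<and> d\<^sup>D\<psi>\<close>.  Because
  \<open>\<star> F = - \<mu> F\<close>, the third is the curvature term in \<open>divergence_wedge_current\<close> with the same factor.
\<close>

lemma integrand_divergence:
  assumes F: "curvature_pm_zero N q c \<sigma> V" and \<sigma>: "\<sigma> \<in> {1, -1}" and g: "g \<in> c" and y: "y \<in> cdom N i"
    and \<phi>: "smooth_on (cdom N i) (\<phi> i)" and \<psi>: "smooth_on (cdom N i) (\<psi> i)"
  shows "of_real (sqrt \<bar>det (g i y)\<bar>) * (pair2 (g i y) (d1 V \<phi> i y) (d1 (dual V) \<psi> i y)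
      - 2 * pair2 (g i y) (d_pm q c \<sigma> V \<phi> i y) (d_pm q c \<sigma> (dual V) \<psi> i y)
      - pair1 (g i y) (curv_dot V \<phi> g i y) (\<psi> i y))
    = - star_eigenvalue q \<sigma> * (\<^bold>\<Sum>a. pd a (wedge_current i (\<phi> i) (\<psi> i) a) y)"
proof -
  let ?h = "g i y" and ?\<mu> = "star_eigenvalue q \<sigma>"
  let ?r = "complex_of_real (sqrt \<bar>det ?h\<bar>)"
  let ?u = "d1 V \<phi> i y" and ?v = "d1 (dual V) \<psi> i y"
  note h = metric_sym[OF g y] metric_det[OF g y] star_eigenvalue_sq[OF g y \<sigma>]
  have A: "?r * (pair2 ?h ?u ?v - 2 * pair2 ?h (d_pm q c \<sigma> V \<phi> i y) (d_pm q c \<sigma> (dual V) \<psi> i y))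
    = - (?\<mu> / 4) * eps_pair (\<lambda>a b. ?u $ a $ b) (\<lambda>a b. ?v $ a $ b)"
  proof -
    let ?us = "\<lambda>s. (\<chi> a b. ?u $ a $ b $ s)" and ?vs = "\<lambda>s. (\<chi> a b. ?v $ a $ b $ s)"
    have "?r * (pair2 ?h ?u ?v - 2 * pair2 ?h (d_pm q c \<sigma> V \<phi> i y) (d_pm q c \<sigma> (dual V) \<psi> i y))
      = (\<^bold>\<Sum>s. ?r * (ip2 ?h (?us s) (?vs s) - 2 * ip2 ?h (half_proj ?h ?\<mu> (?us s)) (half_proj ?h ?\<mu> (?vs s))))"
      unfolding pair2_ip2 d_pm_eq[OF g y \<sigma>]
      by (simp add: sum_distrib_left sum_subtractf right_diff_distrib)
    also have "\<dots> = (\<^bold>\<Sum>s. - (?\<mu> / 4) * wedge2 (?us s) (?vs s))"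
      unfolding ip2_half_proj[OF h skew_d1] ..
    also have "\<dots> = - (?\<mu> / 4) * eps_pair (\<lambda>a b. ?u $ a $ b) (\<lambda>a b. ?v $ a $ b)"
      unfolding wedge2_eps_pair[symmetric] sum_distrib_left ..
    finally show ?thesis .
  qed
  \<comment> \<open>For fixed \<open>b\<close> and \<open>l\<close> the numbers \<open>\<langle>F\<^sub>a\<^sub>e \<phi>\<^sub>b, \<psi>\<^sub>l\<rangle>\<close> form a linear combination of the entries of \<open>F\<close>,
    hence again an eigenform.\<close>
  define D where "D b l = (\<chi> a e. dualpair (curvature V i y $ a $ e *v \<phi> i y $ b) (\<psi> i y $ l))" for b l
  have D: "hodge ?h (D b l) = (\<chi> a e. - ?\<mu> * D b l $ a $ e)" for b l
  proof -
    let ?F = "\<lambda>s t. (\<chi> a b. curvature V i y $ a $ b $ s $ t)"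
    let ?G = "\<lambda>s. (\<chi> a e. \<^bold>\<Sum>t. \<phi> i y $ b $ t * ?F s t $ a $ e)"
    have e: "D b l = (\<chi> a e. \<^bold>\<Sum>s. \<psi> i y $ l $ s * ?G s $ a $ e)"
      by (simp add: D_def dualpair_def matrix_vector_mult_def vec_eq_iff sum_distrib_right ac_simps)
    have G: "hodge ?h (?G s) = (\<chi> a e. \<^bold>\<Sum>t. \<phi> i y $ b $ t * hodge ?h (?F s t) $ a $ e)" for s
      by (rule hodge_sum) simp
    have "hodge ?h (D b l) = (\<chi> a e. \<^bold>\<Sum>s. \<psi> i y $ l $ s * hodge ?h (?G s) $ a $ e)"
      unfolding e by (rule hodge_sum) simp
    also have "\<dots> = (\<chi> a e. - ?\<mu> * D b l $ a $ e)"
      unfolding G curvature_eigen[OF F g y \<sigma>] unfolding e by (simp add: sum_distrib_left ac_simps sum_negf)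
    finally show ?thesis .
  qed
  have B: "?r * pair1 ?h (curv_dot V \<phi> g i y) (\<psi> i y)
    = - (?\<mu> / 2) * (\<^bold>\<Sum>l b a k. lc a b k l * D b l $ a $ k)"
  proof -
    have "pair1 ?h (curv_dot V \<phi> g i y) (\<psi> i y) = (\<^bold>\<Sum>l b. raised ?h (D b l) $ l $ b)"
      unfolding curv_dot_def pair1_contract[OF h(1,2)] D_def ..
    then have "?r * pair1 ?h (curv_dot V \<phi> g i y) (\<psi> i y)
      = (\<^bold>\<Sum>l b. - (?\<mu> / 2) * eps2 (D b l) $ l $ b)"
      by (simp add: sum_distrib_left raise_eigen[OF h D])
    also have "\<dots> = - (?\<mu> / 2) * (\<^bold>\<Sum>l b. eps2 (D b l) $ l $ b)"
      by (simp only: sum_distrib_left)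
    also have "(\<^bold>\<Sum>l b. eps2 (D b l) $ l $ b)
      = (\<^bold>\<Sum>l b a k. lc a b k l * D b l $ a $ k)"
    proof -
      have "lc l b a k = lc a b k l" for l b a k :: 4
        unfolding levi_civita_vandermonde by (simp add: algebra_simps)
      then show ?thesis unfolding eps2_def vec_lambda_beta
        by (intro sum.cong refl arg_cong2[where f = "(*)"]) blast
    qed
    finally show ?thesis .
  qed
  have loc: "d1 V (\<lambda>_. \<phi> i) i y = ?u" "d1 (dual V) (\<lambda>_. \<psi> i) i y = ?v" by (simp_all add: d1_def)
  have div: "(\<^bold>\<Sum>a. pd a (wedge_current i (\<phi> i) (\<psi> i) a) y) =
     eps_pair (\<lambda>a b. ?u $ a $ b) (\<lambda>a b. ?v $ a $ b) / 4
     - (\<^bold>\<Sum>l b a k. lc a b k l * D b l $ a $ k) / 2"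
    unfolding divergence_wedge_current[OF open_cdom order_refl y \<phi> \<psi>] loc by (simp add: D_def)
  have sp: "?r * (x - 2 * w - z) = ?r * (x - 2 * w) - ?r * z" for x w z by (simp add: algebra_simps)
  show ?thesis unfolding sp A B div by (simp add: algebra_simps)
qed

end

section \<open>Testing in a chart\<close>

lemma pair1_linear:
  "pair1 h (v + v') w = pair1 h v w + pair1 h v' w" "pair1 h (t *\<^sub>R v) w = of_real t * pair1 h v w"
  "pair1 h v (t *\<^sub>R w) = of_real t * pair1 h v w" "pair1 h (v - v') w = pair1 h v w - pair1 h v' w" "pair1 h v 0 = 0"
  by (simp_all add: pair1_def dualpair_bilinear distrib_left right_diff_distrib sum.distrib sum_subtractf sum_distrib_left ac_simps)

lemma pair1_nondegenerate:
  assumes h: "transpose h = h" "det h \<noteq> 0" and z: "\<And>b s. pair1 h v (axis b (axis s 1)) = 0"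
  shows "v = 0"
proof -
  let ?H = "matrix_inv h"
  have sym: "?H $ i $ j = ?H $ j $ i" for i j
    by (rule matrix_inv_symmetric_nth[OF h])
  have p: "pair1 h v (axis b (axis s 1)) = (\<^bold>\<Sum>a. of_real (?H $ a $ b) * v $ a $ s)" for b s
  proof -
    have "dualpair x (axis b (axis s 1) $ b') = (if b' = b then x $ s else 0)" for x :: "complex^'a" and b'
      by (simp add: dualpair_def axis_def if_distrib cong: if_cong)
    then have "of_real (?H $ a $ b') * dualpair (v $ a) (axis b (axis s 1) $ b') = (if b' = b then of_real (?H $ a $ b) * v $ a $ s else 0)" for a b'
      by simp
    then show ?thesis by (simp add: pair1_def)
  qed
  have "v $ k $ s = 0" for k s
  proof -
    let ?x = "\<chi> a. v $ a $ s"
    have "cmat ?H *v ?x = 0"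
      using z[of _ s] unfolding p by (simp add: vec_eq_iff matrix_vector_mult_def sym[of _ _])
    then have "(cmat h ** cmat ?H) *v ?x = 0" by (simp add: matrix_vector_mul_assoc[symmetric])
    moreover have "cmat h ** cmat ?H = mat 1" using matrix_inv_mult(1)[OF h(2)] by (metis cmat_mult cmat_mat_1)
    ultimately have "?x = 0" by simp
    then show ?thesis by (simp add: vec_eq_iff)
  qed
  then show ?thesis by (simp add: vec_eq_iff)
qed

context oriented_mfd
begin

lemma mfd_integral_cong:
  assumes "volume_measure N g \<mu>" "\<And>i p. p \<in> dom N i \<Longrightarrow> f i (crd N i p) = f' i (crd N i p)"
  shows "mfd_integral N \<mu> f = mfd_integral N \<mu> f'"
  unfolding mfd_integral_def
proof (rule Bochner_Integration.integral_cong[OF refl])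
  fix p assume "p \<in> space \<mu>"
  then have "p \<in> (\<Union>i. dom N i)" using assms(1) N by (simp add: volume_measure_def oriented_manifold_def)
  then have "\<exists>i. p \<in> dom N i" by blast
  then have "p \<in> dom N (SOME i. p \<in> dom N i)" by (rule someI_ex)
  then show "(let i = SOME i. p \<in> dom N i in f i (crd N i p)) = (let i = SOME i. p \<in> dom N i in f' i (crd N i p))"
    using assms(2) by (simp add: Let_def)
qed

text \<open>
  A compact set is closed in the Hausdorff manifold, so off it a section vanishes together with its
  derivatives.
\<close>

lemma compact_support_near_zero:
  assumes "compact_support N \<psi>"
  shows "\<exists>C. compactin (mtop N) C \<and>
    (\<forall>j. \<forall>p\<in>dom N j - C. \<exists>T. open T \<and> crd N j p \<in> T \<and> (\<forall>z\<in>T. \<psi> j z = 0))"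
proof -
  obtain C where C: "compactin (mtop N) C" "\<And>i p. p \<in> dom N i - C \<Longrightarrow> \<psi> i (crd N i p) = 0"
    using assms by (auto simp: compact_support_def)
  have "closedin (mtop N) C"
    using N C compactin_imp_closedin by (auto simp: oriented_manifold_def)
  then have U: "openin (mtop N) (topspace (mtop N) - C)" by (simp add: openin_diff)
  have "\<exists>T. open T \<and> crd N j p \<in> T \<and> (\<forall>z\<in>T. \<psi> j z = 0)" if "p \<in> dom N j" "p \<notin> C" for j p
    using open_crd_image[OF U, of j] that dom_subset C(2)
    by (intro exI[of _ "crd N j ` (dom N j \<inter> (topspace (mtop N) - C))"]) auto
  with C(1) show ?thesis by blast
qed

end

lemma d0_near_zero:
  assumes "open T" "y \<in> T" "\<forall>z\<in>T. \<psi> j z = 0"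
  shows "d0 W \<psi> j y = 0"
proof -
  have "covd W j a (\<psi> j) y = covd W j a (\<lambda>_. 0) y" for a
    by (rule covd_cong_open[OF assms(1,2)]) (use assms(3) in auto)
  then show ?thesis by (simp add: d0_def vec_eq_iff[where 'b=4] covd_def)
qed

lemma d1_near_zero:
  assumes "open T" "y \<in> T" "\<forall>z\<in>T. \<psi> j z = 0"
  shows "d1 W \<psi> j y = 0"
proof -
  have "covd W j a (\<lambda>z. \<psi> j z $ b) y = covd W j a (\<lambda>_. 0) y" for a b
    by (rule covd_cong_open[OF assms(1,2)]) (use assms(3) in auto)
  then show ?thesis by (simp add: d1_def vec_eq_iff[where 'b=4] covd_def)
qed

context oriented_mfd
begin

lemma compact_support_d0:
  assumes "compact_support N \<psi>"
  shows "compact_support N (d0 W \<psi>)"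
proof -
  obtain C where C: "compactin (mtop N) C"
    "\<And>j p. p \<in> dom N j - C \<Longrightarrow> \<exists>T. open T \<and> crd N j p \<in> T \<and> (\<forall>z\<in>T. \<psi> j z = 0)"
    using compact_support_near_zero[OF assms] by auto
  have "d0 W \<psi> j (crd N j p) = 0" if "p \<in> dom N j - C" for j p
    using C(2)[OF that] d0_near_zero by metis
  then show ?thesis using C(1) unfolding compact_support_def by blast
qed

end

context conformal_bundle
begin

definition chart_int :: "'i metric \<Rightarrow> 'i \<Rightarrow> (real^4 \<Rightarrow> complex) \<Rightarrow> complex" where
  "chart_int g i f = (LINT y|lborel. indicator (cdom N i) y *\<^sub>R (sqrt \<bar>det (g i y)\<bar> *\<^sub>R f y))"

lemma chart_int_cong: "(\<And>y. y \<in> cdom N i \<Longrightarrow> f y = f' y) \<Longrightarrow> chart_int g i f = chart_int g i f'"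
  unfolding chart_int_def by (rule Bochner_Integration.integral_cong) (auto simp: indicator_def)

lemma chart_integrable:
  fixes f :: "real^4 \<Rightarrow> complex"
  assumes g: "g \<in> c" and r: "cball x r \<subseteq> cdom N i" and f: "continuous_on (cdom N i) f"
    and z: "\<And>y. y \<in> cdom N i \<Longrightarrow> y \<notin> cball x r \<Longrightarrow> f y = 0"
  shows "integrable lborel (\<lambda>y. indicator (cdom N i) y *\<^sub>R (sqrt \<bar>det (g i y)\<bar> *\<^sub>R f y))"
proof (rule integrable_compact_support[of x r])
  have "continuous_on (cdom N i) (\<lambda>y. sqrt \<bar>det (g i y)\<bar> *\<^sub>R f y)"
    by (intro continuous_on_scaleR smooth_on_continuous smooth_metric(3)[OF class_metric[OF g]] f)
  then have "continuous_on (cball x r) (\<lambda>y. sqrt \<bar>det (g i y)\<bar> *\<^sub>R f y)"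
    using r continuous_on_subset by blast
  then show "continuous_on (cball x r) (\<lambda>y. indicator (cdom N i) y *\<^sub>R (sqrt \<bar>det (g i y)\<bar> *\<^sub>R f y))"
    by (rule continuous_on_eq) (use r in \<open>auto simp: indicator_def\<close>)
qed (use z in \<open>auto simp: indicator_def\<close>)

lemma chart_int_bump_zero:
  assumes g: "g \<in> c" and x: "x \<in> cdom N i" and f: "continuous_on (cdom N i) f"
    and z: "\<And>r. r > 0 \<Longrightarrow> cball x r \<subseteq> cdom N i \<Longrightarrow> chart_int g i (\<lambda>y. of_real (bump x r y) * f y) = 0"
  shows "f x = 0"
proof -
  let ?G = "\<lambda>y. sqrt \<bar>det (g i y)\<bar> *\<^sub>R f y"
  have "?G x = 0"
  proof (rule continuous_zero_if_bump_integrals_zero[OF open_cdom x])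
    show "continuous_on (cdom N i) ?G"
      by (intro continuous_on_scaleR smooth_on_continuous smooth_metric(3)[OF class_metric[OF g]] f)
    fix r :: real assume r: "r > 0" "cball x r \<subseteq> cdom N i"
    have "(LINT y|lborel. bump x r y *\<^sub>R ?G y) = chart_int g i (\<lambda>y. of_real (bump x r y) * f y)"
      unfolding chart_int_def
    proof (rule Bochner_Integration.integral_cong[OF refl])
      fix y
      show "bump x r y *\<^sub>R ?G y = indicator (cdom N i) y *\<^sub>R (sqrt \<bar>det (g i y)\<bar> *\<^sub>R (of_real (bump x r y) * f y))"
      proof (cases "y \<in> cdom N i")
        case False
        then have "y \<notin> cball x r" using r by blast
        then show ?thesis using False bump_zero[of r x y] r by simp
      qed (simp add: scaleR_complex)
    qed
    then show "(LINT y|lborel. bump x r y *\<^sub>R ?G y) = 0" using z[OF r] by simp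
  qed
  then show ?thesis using metric_det[OF g x] by simp
qed

lemma smooth_pair1:
  assumes g: "g \<in> c" and v: "smooth_on (cdom N i) v" and w: "smooth_on (cdom N i) w"
  shows "smooth_on (cdom N i) (\<lambda>y. pair1 (g i y) (v y) (w y))"
  unfolding pair1_def
  by (intro smooth_on_sum smooth_on_mult smooth_on_of_real smooth_on_bilinear[OF bounded_bilinear_dualpair]
      smooth_on_vec_nth open_cdom finite smooth_metric(2)[OF class_metric[OF g]] v w)

lemma smooth_pair2:
  assumes g: "g \<in> c" and v: "smooth_on (cdom N i) v" and w: "smooth_on (cdom N i) w"
  shows "smooth_on (cdom N i) (\<lambda>y. pair2 (g i y) (v y) (w y))"
  unfolding pair2_def
  by (intro smooth_on_sum smooth_on_mult smooth_on_of_real smooth_on_bilinear[OF bounded_bilinear_dualpair]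
      smooth_on_vec_nth open_cdom finite smooth_metric(2)[OF class_metric[OF g]] v w smooth_on_const)

lemma metric_transform:
  "\<lbrakk>g \<in> c; p \<in> dom N i; p \<in> dom N j\<rbrakk> \<Longrightarrow> g i (crd N i p) = transpose (jac N i j p) ** g j (crd N j p) ** jac N i j p"
  using class_metric[of g] unfolding pseudo_metric_def by blast

lemma det_jac_nz: "\<lbrakk>p \<in> dom N i; p \<in> dom N j\<rbrakk> \<Longrightarrow> det (jac N i j p) \<noteq> 0"
  using det_jac by (metis less_irrefl)

lemma sectionD:
  assumes "is_section N W act \<phi>"
  shows "smooth_on (cdom N i) (\<phi> i)"
    "\<lbrakk>p \<in> dom N i; p \<in> dom N j\<rbrakk> \<Longrightarrow> \<phi> i (crd N i p) = act (jac N i j p) (trans W i j p) (\<phi> j (crd N j p))"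
  using assms unfolding is_section_def by blast+

lemma integral_pair1_chart:
  assumes g: "g \<in> c" and \<phi>: "is_section N V act1 \<phi>" and \<psi>: "is_section N (dual V) act1 \<psi>"
    and supp: "\<And>j p. p \<in> dom N j \<Longrightarrow> p \<notin> dom N i \<Longrightarrow> \<psi> j (crd N j p) = 0"
  shows "mfd_integral N (vol g) (\<lambda>i y. pair1 (g i y) (\<phi> i y) (\<psi> i y)) = chart_int g i (\<lambda>y. pair1 (g i y) (\<phi> i y) (\<psi> i y))"
  unfolding chart_int_def
proof (rule mfd_integral_chart[OF vol[OF g] class_metric[OF g]])
  fix j k p assume p: "p \<in> dom N j" "p \<in> dom N k"
  show "pair1 (g j (crd N j p)) (\<phi> j (crd N j p)) (\<psi> j (crd N j p)) = pair1 (g k (crd N k p)) (\<phi> k (crd N k p)) (\<psi> k (crd N k p))"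
    unfolding metric_transform[OF g p] sectionD(2)[OF \<phi> p] sectionD(2)[OF \<psi> p] trans_dual[OF p]
    by (rule pair1_pullback[OF det_jac_nz[OF p] metric_det[OF g crd_in_cdom[OF p(2)]] trans_inverse[OF p(2,1)]])
next
  show "continuous_on (cdom N i) (\<lambda>y. pair1 (g i y) (\<phi> i y) (\<psi> i y))"
    by (rule smooth_on_continuous[OF smooth_pair1[OF g sectionD(1)[OF \<phi>] sectionD(1)[OF \<psi>]]])
qed (simp add: supp pair1_linear)

lemma pair2_zero: "pair2 h v 0 = 0" "pair2 h 0 v = 0"
  by (simp_all add: pair2_def dualpair_bilinear)

lemma integral_pair2_chart:
  assumes g: "g \<in> c" and \<phi>: "is_section N V act2 \<phi>" and \<psi>: "is_section N (dual V) act2 \<psi>"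
    and supp: "\<And>j p. p \<in> dom N j \<Longrightarrow> p \<notin> dom N i \<Longrightarrow> \<psi> j (crd N j p) = 0"
  shows "mfd_integral N (vol g) (\<lambda>i y. pair2 (g i y) (\<phi> i y) (\<psi> i y)) = chart_int g i (\<lambda>y. pair2 (g i y) (\<phi> i y) (\<psi> i y))"
  unfolding chart_int_def
proof (rule mfd_integral_chart[OF vol[OF g] class_metric[OF g]])
  fix j k p assume p: "p \<in> dom N j" "p \<in> dom N k"
  show "pair2 (g j (crd N j p)) (\<phi> j (crd N j p)) (\<psi> j (crd N j p)) = pair2 (g k (crd N k p)) (\<phi> k (crd N k p)) (\<psi> k (crd N k p))"
    unfolding metric_transform[OF g p] sectionD(2)[OF \<phi> p] sectionD(2)[OF \<psi> p] trans_dual[OF p]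
    by (rule pair2_pullback[OF det_jac_nz[OF p] metric_det[OF g crd_in_cdom[OF p(2)]] trans_inverse[OF p(2,1)]])
next
  show "continuous_on (cdom N i) (\<lambda>y. pair2 (g i y) (\<phi> i y) (\<psi> i y))"
    by (rule smooth_on_continuous[OF smooth_pair2[OF g sectionD(1)[OF \<phi>] sectionD(1)[OF \<psi>]]])
qed (simp add: supp pair2_zero)

lemma integral_dualpair_chart:
  assumes g: "g \<in> c" and \<phi>: "is_section N V act0 \<phi>" and \<psi>: "is_section N (dual V) act0 \<psi>"
    and supp: "\<And>j p. p \<in> dom N j \<Longrightarrow> p \<notin> dom N i \<Longrightarrow> \<psi> j (crd N j p) = 0"
  shows "mfd_integral N (vol g) (\<lambda>i y. dualpair (\<phi> i y) (\<psi> i y)) = chart_int g i (\<lambda>y. dualpair (\<phi> i y) (\<psi> i y))"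
  unfolding chart_int_def
proof (rule mfd_integral_chart[OF vol[OF g] class_metric[OF g]])
  fix j k p assume p: "p \<in> dom N j" "p \<in> dom N k"
  show "dualpair (\<phi> j (crd N j p)) (\<psi> j (crd N j p)) = dualpair (\<phi> k (crd N k p)) (\<psi> k (crd N k p))"
    unfolding sectionD(2)[OF \<phi> p] sectionD(2)[OF \<psi> p] trans_dual[OF p] act0_def
    by (rule dualpair_trans[OF trans_inverse[OF p(2,1)]])
next
  show "continuous_on (cdom N i) (\<lambda>y. dualpair (\<phi> i y) (\<psi> i y))"
    by (rule smooth_on_continuous[OF smooth_on_bilinear[OF bounded_bilinear_dualpair open_cdom sectionD(1)[OF \<phi>] sectionD(1)[OF \<psi>]]])
qed (simp add: supp dualpair_bilinear)

lemma smooth_curv_dot: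
  assumes g: "g \<in> c" and \<phi>: "smooth_on (cdom N i) (\<phi> i)"
  shows "smooth_on (cdom N i) (curv_dot V \<phi> g i)"
proof -
  have c: "smooth_on (cdom N i) (\<lambda>y. conn V i y $ a)" for a
    by (intro smooth_on_vec_nth open_cdom smooth_conn)
  have F: "smooth_on (cdom N i) (\<lambda>y. curvature V i y $ a $ b)" for a b
    by (rule smooth_on_cong[OF open_cdom curvature_eq[symmetric]], assumption)
      (intro smooth_on_diff smooth_on_add smooth_on_pd smooth_on_bilinear[OF bounded_bilinear_matrix_matrix] open_cdom c)
  show ?thesis unfolding curv_dot_def
    by (intro smooth_on_vec_lambda smooth_on_sum smooth_on_scaleR finite open_cdom F
        smooth_on_bilinear[OF bounded_bilinear_matrix_vector] smooth_on_vec_nth \<phi>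
        smooth_metric(2)[OF class_metric[OF g]])
qed

lemma curvature_K: "y \<in> cdom N i \<Longrightarrow> curvature V i y $ a $ b $ s $ t \<in> K"
proof -
  assume y: "y \<in> cdom N i"
  have "pd a (\<lambda>z. conn V i z $ b) y $ s $ t \<in> K" for a b
  proof -
    have d: "(\<lambda>z. conn V i z $ b) differentiable (at y)"
      by (rule smooth_on_differentiable[OF _ open_cdom y]) (intro smooth_on_vec_nth open_cdom smooth_conn)
    have L: "bounded_linear (\<lambda>A :: complex^'r^'r. A $ s $ t)"
      by (rule bounded_linear_compose[OF bounded_linear_vec_nth bounded_linear_vec_nth])
    have "pd a (\<lambda>z. conn V i z $ b) y $ s $ t = pd a (\<lambda>z. conn V i z $ b $ s $ t) y"
      using pd_linear(1)[OF L d] by simp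
    also have "\<dots> \<in> K"
      by (rule pd_scalar_field[OF K open_cdom y pd_linear(2)[OF L d]]) (rule conn_K)
    finally show ?thesis .
  qed
  then show ?thesis
    unfolding curvature_eq[OF y] using conn_K[OF y]
    by (auto simp: matrix_matrix_mult_def intro!: scalar_field_closed[OF K])
qed

text \<open>
  The current extends by zero from the ball to a smooth function on \<open>\<real>\<^sup>4\<close>, so the integral of its
  divergence vanishes.
\<close>

lemma chart_int_identity:
  assumes F: "curvature_pm_zero N q c \<sigma> V" and \<sigma>: "\<sigma> \<in> {1, -1}" and g: "g \<in> c"
    and r: "r > 0" "cball x r \<subseteq> cdom N i"
    and \<phi>: "smooth_on (cdom N i) (\<phi> i)" and \<psi>: "\<And>y. y \<in> cdom N i \<Longrightarrow> \<psi> i y = bump x r y *\<^sub>R w"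
  shows "chart_int g i (\<lambda>y. pair2 (g i y) (d1 V \<phi> i y) (d1 (dual V) \<psi> i y)
      - 2 * pair2 (g i y) (d_pm q c \<sigma> V \<phi> i y) (d_pm q c \<sigma> (dual V) \<psi> i y)
      - pair1 (g i y) (curv_dot V \<phi> g i y) (\<psi> i y)) = 0"
proof -
  let ?p = "\<lambda>z. bump x r z *\<^sub>R w" and ?\<mu> = "star_eigenvalue q \<sigma>"
  let ?C = "wedge_current i (\<phi> i) ?p"
  have p: "smooth_on S ?p" if "open S" for S
    by (intro smooth_on_scaleR that smooth_on_bump smooth_on_const)
  have \<psi>s: "smooth_on (cdom N i) (\<psi> i)"
    by (rule smooth_on_cong[OF open_cdom \<psi>[symmetric] p[OF open_cdom]])
  \<comment> \<open>The current involves \<open>\<psi>\<close> through its values and first derivatives only.\<close>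
  have out: "?C a z = 0" if "z \<in> - cball x r" for a z
  proof -
    have "covd (dual V) i k (\<lambda>z. ?p z $ l) z = covd (dual V) i k (\<lambda>_. 0) z" for k l
      by (rule covd_cong_open[of "- cball x r"]) (use that bump_zero r in auto)
    then show ?thesis by (simp add: wedge_current_def covd_def dualpair_bilinear)
  qed
  have sm: "smooth_on UNIV (?C a)" for a
  proof (rule smooth_on_local)
    fix y :: "real^4"
    show "\<exists>T. open T \<and> y \<in> T \<and> smooth_on T (?C a)"
    proof (cases "y \<in> cdom N i")
      case True
      then show ?thesis using smooth_wedge_current[OF open_cdom order_refl \<phi> p[OF open_cdom]] open_cdom by blast
    next
      case False
      have "smooth_on (- cball x r) (?C a)"
        by (rule smooth_on_cong[OF _ _ smooth_on_const[of _ 0]]) (use out in auto)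
      then show ?thesis using False r by (intro exI[of _ "- cball x r"]) auto
    qed
  qed
  have out': "pd a (?C a) z = 0" if "z \<notin> cball x r" for a z
  proof -
    have "pd a (?C a) z = pd a (\<lambda>_. 0) z"
      by (rule pd_cong_open[of "- cball x r"]) (use out that in auto)
    then show ?thesis by simp
  qed
  have cont: "continuous_on UNIV (pd a (?C a))" for a
    by (rule smooth_on_continuous[OF smooth_on_pd[OF sm]])
  have int0: "(LINT y|lborel. pd a (?C a) y) = 0" for a
    by (rule integral_pd_compact_support[of _ _ x r])
      (use smooth_on_differentiable[OF sm open_UNIV] cont out in auto)
  have intg: "integrable lborel (pd a (?C a))" for a
    by (rule integrable_compact_support[of x r]) (use cont continuous_on_subset out' in blast)+
  have eq: "pd a (wedge_current i (\<phi> i) (\<psi> i) a) y = pd a (?C a) y" if y: "y \<in> cdom N i" for a y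
  proof (rule pd_cong_open[OF open_cdom y])
    fix z assume z: "z \<in> cdom N i"
    have "covd (dual V) i k (\<lambda>z. \<psi> i z $ l) z = covd (dual V) i k (\<lambda>z. ?p z $ l) z" for k l
      by (rule covd_cong_open[OF open_cdom z]) (simp add: \<psi>)
    then show "wedge_current i (\<phi> i) (\<psi> i) a z = ?C a z" by (simp add: wedge_current_def)
  qed
  have "chart_int g i (\<lambda>y. pair2 (g i y) (d1 V \<phi> i y) (d1 (dual V) \<psi> i y)
      - 2 * pair2 (g i y) (d_pm q c \<sigma> V \<phi> i y) (d_pm q c \<sigma> (dual V) \<psi> i y)
      - pair1 (g i y) (curv_dot V \<phi> g i y) (\<psi> i y))
    = (LINT y|lborel. - ?\<mu> * (\<^bold>\<Sum>a. pd a (?C a) y))"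
    unfolding chart_int_def
  proof (rule Bochner_Integration.integral_cong[OF refl])
    fix y
    show "indicator (cdom N i) y *\<^sub>R (sqrt \<bar>det (g i y)\<bar> *\<^sub>R (pair2 (g i y) (d1 V \<phi> i y) (d1 (dual V) \<psi> i y)
      - 2 * pair2 (g i y) (d_pm q c \<sigma> V \<phi> i y) (d_pm q c \<sigma> (dual V) \<psi> i y)
      - pair1 (g i y) (curv_dot V \<phi> g i y) (\<psi> i y))) = - ?\<mu> * (\<^bold>\<Sum>a. pd a (?C a) y)"
    proof (cases "y \<in> cdom N i")
      case True
      then show ?thesis
        unfolding scaleR_complex integrand_divergence[where \<phi> = \<phi> and \<psi> = \<psi>, OF F \<sigma> g True \<phi> \<psi>s] eq[OF True] by simp
    next
      case False
      then have "y \<notin> cball x r" using r by blast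
      then show ?thesis using False out' by simp
    qed
  qed
  also have "\<dots> = - ?\<mu> * (\<^bold>\<Sum>a. (LINT y|lborel. pd a (?C a) y))"
    using intg by (simp add: Bochner_Integration.integral_sum)
  finally show ?thesis by (simp add: int0)
qed

end

section \<open>Comparison of the two detour complexes\<close>

lemma half_proj_0 [simp]: "half_proj h \<mu> 0 = 0"
  by (simp add: half_proj_def hodge_def vec_eq_iff)

context conformal_bundle
begin

lemma d_pm_near_zero:
  assumes "open T" "y \<in> T" "\<forall>z\<in>T. \<psi> j z = 0" "y \<in> cdom N j" "\<sigma> \<in> {1, -1}"
  shows "d_pm q c \<sigma> W \<psi> j y = 0"
proof -
  obtain g where g: "g \<in> c" using class_ex by blast
  have "(\<chi> a b. d1 W \<psi> j y $ a $ b $ s) = 0" for s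
    unfolding d1_near_zero[where \<psi> = \<psi>, OF assms(1-3)] by (simp add: vec_eq_iff)
  then show ?thesis unfolding d_pm_eq[OF g assms(4,5)] half_proj_0 by (simp only: half_proj_0) (simp add: vec_eq_iff)
qed

lemma chart_int_comb:
  assumes g: "g \<in> c" and r: "cball x r \<subseteq> cdom N i"
    and cont: "continuous_on (cdom N i) u" "continuous_on (cdom N i) v" "continuous_on (cdom N i) w"
    and zero: "\<And>y. y \<in> cdom N i \<Longrightarrow> y \<notin> cball x r \<Longrightarrow> u y = 0 \<and> v y = 0 \<and> w y = 0"
  shows "chart_int g i (\<lambda>y. u y - 2 * v y - w y) = chart_int g i u - 2 * chart_int g i v - chart_int g i w"
proof -
  let ?I = "\<lambda>f y. indicator (cdom N i) y *\<^sub>R (sqrt \<bar>det (g i y)\<bar> *\<^sub>R f y) :: complex"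
  have int: "integrable lborel (?I u)" "integrable lborel (?I v)" "integrable lborel (?I w)"
    using chart_integrable[OF g r cont(1)] chart_integrable[OF g r cont(2)] chart_integrable[OF g r cont(3)] zero by auto
  have lin: "(LINT y|lborel. U y - 2 * V y - W y) = (LINT y|lborel. U y) - 2 * (LINT y|lborel. V y) - (LINT y|lborel. W y)"
    if "integrable lborel U" "integrable lborel V" "integrable lborel W" for U V W :: "real^4 \<Rightarrow> complex"
    using that by simp
  have "chart_int g i (\<lambda>y. u y - 2 * v y - w y) = (LINT y|lborel. ?I u y - 2 * ?I v y - ?I w y)"
    unfolding chart_int_def by (rule Bochner_Integration.integral_cong) (auto simp: scaleR_complex algebra_simps)
  also have "\<dots> = chart_int g i u - 2 * chart_int g i v - chart_int g i w"
    unfolding chart_int_def by (rule lin[OF int])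
  finally show ?thesis .
qed

lemma wforms1D: "\<Phi> \<in> wforms1 N c K' V \<Longrightarrow> g \<in> c \<Longrightarrow> is_section N V act1 (\<Phi> g)"
  by (simp add: wforms1_def weighted_def forms1_def)

lemma wforms1_K: "\<Phi> \<in> wforms1 N c K' V \<Longrightarrow> g \<in> c \<Longrightarrow> y \<in> cdom N i \<Longrightarrow> \<Phi> g i y $ a $ s \<in> K'"
  by (simp add: wforms1_def weighted_def forms1_def)

lemma wforms2_const: "\<phi> \<in> forms2 N K V \<Longrightarrow> (\<lambda>_. \<phi>) \<in> wforms2 N c K V"
  by (simp add: wforms2_def weighted_def)

text \<open>
  The fundamental lemma of the calculus of variations for 1-forms with values in the bundle.
\<close>

lemma one_form_eq_zero:
  assumes g: "g \<in> c" and x: "x \<in> cdom N i" and X: "smooth_on (cdom N i) X"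
    and int: "\<And>r b s \<psi>. \<lbrakk>r > 0; cball x r \<subseteq> cdom N i;
       \<psi> = connection_bundle.bump_section N (dual V) act1 i x r (axis b (axis s 1))\<rbrakk>
       \<Longrightarrow> chart_int g i (\<lambda>y. pair1 (g i y) (X y) (\<psi> i y)) = 0"
  shows "X x = 0"
proof (rule pair1_nondegenerate[OF metric_sym[OF g x] metric_det[OF g x]])
  interpret d: connection_bundle N K "dual V" by (rule connection_bundle_dual)
  fix b and s :: 'r
  let ?w = "axis b (axis s 1) :: complex^'r^4"
  show "pair1 (g i x) (X x) ?w = 0"
  proof (rule chart_int_bump_zero[OF g x, of "\<lambda>y. pair1 (g i y) (X y) ?w"])
    show "continuous_on (cdom N i) (\<lambda>y. pair1 (g i y) (X y) ?w)"
      by (rule smooth_on_continuous[OF smooth_pair1[OF g X smooth_on_const]])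
    fix r :: real assume r: "r > 0" "cball x r \<subseteq> cdom N i"
    have "chart_int g i (\<lambda>y. of_real (bump x r y) * pair1 (g i y) (X y) ?w)
      = chart_int g i (\<lambda>y. pair1 (g i y) (X y) (d.bump_section act1 i x r ?w i y))"
      by (rule chart_int_cong)
        (simp add: d.bump_section_own_chart[OF act1.fibre_action_axioms] pair1_linear)
    then show "chart_int g i (\<lambda>y. of_real (bump x r y) * pair1 (g i y) (X y) ?w) = 0"
      using int[OF r refl] by simp
  qed
qed

lemma adjoint_d1_chart:
  assumes fa: "formal_adjoint_d1 N c K V vol \<delta>1" and \<phi>: "\<phi> \<in> forms1 N K V" and g: "g \<in> c"
    and \<psi>: "\<psi> \<in> forms1 N K (dual V)" "compact_support N \<psi>"
    and near: "\<And>j p. p \<in> dom N j \<Longrightarrow> p \<notin> dom N i \<Longrightarrow> \<exists>T. open T \<and> crd N j p \<in> T \<and> (\<forall>z\<in>T. \<psi> j z = 0)"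
  shows "chart_int g i (\<lambda>y. pair1 (g i y) (\<delta>1 (\<lambda>_. d1 V \<phi>) g i y) (\<psi> i y))
    = chart_int g i (\<lambda>y. pair2 (g i y) (d1 V \<phi> i y) (d1 (dual V) \<psi> i y))"
proof -
  interpret d: connection_bundle N K "dual V" by (rule connection_bundle_dual)
  have W: "(\<lambda>_. d1 V \<phi>) \<in> wforms2 N c K V" by (rule wforms2_const[OF d1_forms2[OF \<phi>]])
  note FA = fa[unfolded formal_adjoint_d1_def, THEN bspec, OF W]
  have D: "\<delta>1 (\<lambda>_. d1 V \<phi>) \<in> wforms1 N c K V" and
    adj: "mfd_integral N (vol g) (\<lambda>i y. pair1 (g i y) (\<delta>1 (\<lambda>_. d1 V \<phi>) g i y) (\<psi> i y)) =
             mfd_integral N (vol g) (\<lambda>i y. pair2 (g i y) (d1 V \<phi> i y) (d1 (dual V) \<psi> i y))"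
    using FA FA[THEN conjunct2, THEN bspec, OF \<psi>(1), THEN mp, OF \<psi>(2), THEN bspec, OF g] by simp_all
  have s1: "is_section N (dual V) act1 \<psi>" "is_section N V act2 (d1 V \<phi>)" "is_section N (dual V) act2 (d1 (dual V) \<psi>)"
    using \<psi>(1) d1_forms2[OF \<phi>] d.d1_forms2[OF \<psi>(1)] unfolding forms1_def forms2_def by blast+
  have z: "\<psi> j (crd N j p) = 0" "d1 (dual V) \<psi> j (crd N j p) = 0" if p: "p \<in> dom N j" "p \<notin> dom N i" for j p
  proof -
    obtain T where T: "open T" "crd N j p \<in> T" "\<forall>z\<in>T. \<psi> j z = 0" using near[OF p] by blast
    then show "\<psi> j (crd N j p) = 0" by blast
    show "d1 (dual V) \<psi> j (crd N j p) = 0" by (rule d1_near_zero[where \<psi> = \<psi>, OF T])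
  qed
  show ?thesis
    using adj integral_pair1_chart[OF g wforms1D[OF D g] s1(1) z(1)] integral_pair2_chart[OF g s1(2,3) z(2)]
    by simp
qed

lemma adjoint_d_pm_chart:
  assumes fa: "formal_adjoint_d_pm N q c K \<sigma> V vol \<delta>" and \<phi>: "\<phi> \<in> forms1 N K V" and g: "g \<in> c" and \<sigma>: "\<sigma> \<in> {1, -1}"
    and \<psi>: "\<psi> \<in> forms1 N K (dual V)" "compact_support N \<psi>"
    and near: "\<And>j p. p \<in> dom N j \<Longrightarrow> p \<notin> dom N i \<Longrightarrow> \<exists>T. open T \<and> crd N j p \<in> T \<and> (\<forall>z\<in>T. \<psi> j z = 0)"
  shows "chart_int g i (\<lambda>y. pair1 (g i y) (\<delta> (d_pm q c \<sigma> V \<phi>) g i y) (\<psi> i y))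
    = chart_int g i (\<lambda>y. pair2 (g i y) (d_pm q c \<sigma> V \<phi> i y) (d_pm q c \<sigma> (dual V) \<psi> i y))"
proof -
  interpret d: conformal_bundle N K "dual V" q c vol by (rule conformal_bundle_dual)
  note W = d_pm_forms[OF \<phi> \<sigma>]
  note FA = fa[unfolded formal_adjoint_d_pm_def, THEN bspec, OF W]
  have D: "\<delta> (d_pm q c \<sigma> V \<phi>) \<in> wforms1 N c (scalars_pm q K) V" and
    adj: "mfd_integral N (vol g) (\<lambda>i y. pair1 (g i y) (\<delta> (d_pm q c \<sigma> V \<phi>) g i y) (\<psi> i y)) =
             mfd_integral N (vol g) (\<lambda>i y. pair2 (g i y) (d_pm q c \<sigma> V \<phi> i y) (d_pm q c \<sigma> (dual V) \<psi> i y))"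
    using FA FA[THEN conjunct2, THEN bspec, OF \<psi>(1), THEN mp, OF \<psi>(2), THEN bspec, OF g] by simp_all
  have s1: "is_section N (dual V) act1 \<psi>" "is_section N V act2 (d_pm q c \<sigma> V \<phi>)"
    "is_section N (dual V) act2 (d_pm q c \<sigma> (dual V) \<psi>)"
    using \<psi>(1) W d.d_pm_forms[OF \<psi>(1) \<sigma>] 
    unfolding forms1_def forms2_def forms2_pm_def by blast+
  have z: "\<psi> j (crd N j p) = 0" "d_pm q c \<sigma> (dual V) \<psi> j (crd N j p) = 0"
    if p: "p \<in> dom N j" "p \<notin> dom N i" for j p
  proof -
    obtain T where T: "open T" "crd N j p \<in> T" "\<forall>z\<in>T. \<psi> j z = 0" using near[OF p] by blast
    then show "\<psi> j (crd N j p) = 0" by blast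
    show "d_pm q c \<sigma> (dual V) \<psi> j (crd N j p) = 0"
      by (rule d_pm_near_zero[where \<psi> = \<psi>, OF T crd_in_cdom[OF p(1)] \<sigma>])
  qed
  show ?thesis
    using adj integral_pair1_chart[OF g wforms1D[OF D g] s1(1) z(1)] integral_pair2_chart[OF g s1(2,3) z(2)]
    by simp
qed

text \<open>
  Test the difference of the two operators, move both adjoints to the test section, and apply
  \<open>chart_int_identity\<close>.
\<close>

lemma yang_mills_eq_half_op:
  assumes F: "curvature_pm_zero N q c \<sigma> V" and \<sigma>: "\<sigma> \<in> {1, -1}"
    and fa1: "formal_adjoint_d1 N c K V vol \<delta>1" and fap: "formal_adjoint_d_pm N q c K \<sigma> V vol \<delta>"
    and \<phi>: "\<phi> \<in> forms1 N K V" and g: "g \<in> c" and x: "x \<in> cdom N i"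
  shows "yang_mills_op V \<delta>1 \<phi> g i x = half_op q c \<sigma> V \<delta> \<phi> g i x"
proof -
  interpret d: conformal_bundle N K "dual V" q c vol by (rule conformal_bundle_dual)
  let ?P = "\<delta>1 (\<lambda>_. d1 V \<phi>) g i" and ?H = "\<delta> (d_pm q c \<sigma> V \<phi>) g i" and ?C = "curv_dot V \<phi> g i"
  let ?X = "\<lambda>y. ?P y - ?C y - 2 *\<^sub>R ?H y"
  have "\<delta>1 (\<lambda>_. d1 V \<phi>) \<in> wforms1 N c K V"
    using fa1 wforms2_const[OF d1_forms2[OF \<phi>]] unfolding formal_adjoint_d1_def by blast
  then have sP: "smooth_on (cdom N i) ?P" using sectionD(1)[OF wforms1D[OF _ g]] by blast
  have "\<delta> (d_pm q c \<sigma> V \<phi>) \<in> wforms1 N c (scalars_pm q K) V"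
    using fap d_pm_forms[OF \<phi> \<sigma>] unfolding formal_adjoint_d_pm_def by blast
  then have sH: "smooth_on (cdom N i) ?H" using sectionD(1)[OF wforms1D[OF _ g]] by blast
  have sC: "smooth_on (cdom N i) ?C" by (rule smooth_curv_dot[where \<phi> = \<phi>, OF g form1D(1)[OF \<phi>]])
  have "?X x = 0"
  proof (rule one_form_eq_zero[OF g x])
    show "smooth_on (cdom N i) ?X"
      by (intro smooth_on_diff smooth_on_scaleR smooth_on_const open_cdom sP sH sC)
    fix r b and s :: 'r and \<psi> assume r: "r > 0" "cball x r \<subseteq> cdom N i"
      and \<psi>: "\<psi> = d.bump_section act1 i x r (axis b (axis s 1))"
    have f\<psi>: "\<psi> \<in> forms1 N K (dual V)" unfolding \<psi> by (rule d.bump_section_form1[OF r])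
    note bs = d.is_section_bump_section[OF act1.fibre_action_axioms r, where v = "axis b (axis s 1)", folded \<psi>]
    have own: "\<psi> i y = bump x r y *\<^sub>R axis b (axis s 1)" if "y \<in> cdom N i" for y
      unfolding \<psi> by (rule d.bump_section_own_chart[OF act1.fibre_action_axioms that])
    let ?A = "\<lambda>X y. pair1 (g i y) (X y) (\<psi> i y)"
    let ?B = "\<lambda>y. pair2 (g i y) (d1 V \<phi> i y) (d1 (dual V) \<psi> i y)"
    let ?Bp = "\<lambda>y. pair2 (g i y) (d_pm q c \<sigma> V \<phi> i y) (d_pm q c \<sigma> (dual V) \<psi> i y)"
    note e1 = adjoint_d1_chart[OF fa1 \<phi> g f\<psi> bs(2,3)] and e2 = adjoint_d_pm_chart[OF fap \<phi> g \<sigma> f\<psi> bs(2,3)]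
    have s\<psi>: "smooth_on (cdom N i) (\<psi> i)" using sectionD(1)[OF bs(1)] .
    have cA: "continuous_on (cdom N i) (?A X)" if "smooth_on (cdom N i) X" for X
      by (rule smooth_on_continuous[OF smooth_pair1[OF g that s\<psi>]])
    have "continuous_on (cdom N i) ?B"
      by (rule smooth_on_continuous[OF smooth_pair2[OF g form2D(1)[OF d1_forms2[OF \<phi>]] d.form2D(1)[OF d.d1_forms2[OF f\<psi>]]]])
    moreover have "continuous_on (cdom N i) ?Bp"
    proof -
      have "d_pm q c \<sigma> V \<phi> \<in> forms2 N (scalars_pm q K) V" "d_pm q c \<sigma> (dual V) \<psi> \<in> forms2 N (scalars_pm q K) (dual V)"
        using d_pm_forms[OF \<phi> \<sigma>] d.d_pm_forms[OF f\<psi> \<sigma>] by (auto simp: forms2_pm_def)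
      then show ?thesis by (intro smooth_on_continuous smooth_pair2 g form2D(1) d.form2D(1))
    qed
    moreover have z\<psi>: "\<psi> i y = 0" if "y \<in> cdom N i" "y \<notin> cball x r" for y
      using own[OF that(1)] bump_zero[of r x y] r that by simp
    moreover have "?B y = 0" "?Bp y = 0" if y: "y \<in> cdom N i" "y \<notin> cball x r" for y
    proof -
      have T: "open (cdom N i - cball x r)" "y \<in> cdom N i - cball x r" "\<forall>z\<in>cdom N i - cball x r. \<psi> i z = 0"
        using y open_cdom z\<psi> by auto
      show "?B y = 0" "?Bp y = 0"
        by (simp_all add: d1_near_zero[where \<psi> = \<psi>, OF T] d_pm_near_zero[where \<psi> = \<psi>, OF T y(1) \<sigma>] pair2_zero)
    qed
    ultimately have "chart_int g i (\<lambda>y. ?B y - 2 * ?Bp y - ?A ?C y) = chart_int g i ?B - 2 * chart_int g i ?Bp - chart_int g i (?A ?C)"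
      by (intro chart_int_comb[OF g r(2)] cA sC) (simp_all add: pair1_linear)
    moreover have "chart_int g i (\<lambda>y. ?B y - 2 * ?Bp y - ?A ?C y) = 0"
      by (rule chart_int_identity[where \<phi> = \<phi> and \<psi> = \<psi>, OF F \<sigma> g r form1D(1)[OF \<phi>] own])
    moreover have "chart_int g i (\<lambda>y. ?A ?P y - 2 * ?A ?H y - ?A ?C y) = chart_int g i (?A ?P) - 2 * chart_int g i (?A ?H) - chart_int g i (?A ?C)"
      by (intro chart_int_comb[OF g r(2)] cA sP sH sC) (simp add: z\<psi> pair1_linear)
    moreover have "(\<lambda>y. pair1 (g i y) (?X y) (\<psi> i y)) = (\<lambda>y. ?A ?P y - 2 * ?A ?H y - ?A ?C y)"
      by (rule ext) (simp add: pair1_linear algebra_simps)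
    ultimately show "chart_int g i (\<lambda>y. pair1 (g i y) (?X y) (\<psi> i y)) = 0"
      using e1 e2 by simp
  qed
  then show ?thesis by (simp add: yang_mills_op_def half_op_def)
qed

text \<open>
  Sections may differ outside the coordinate domains, and the set of scalars may shrink to \<open>K\<close>.
\<close>

lemma wforms1_cong:
  assumes \<Phi>: "\<Phi> \<in> wforms1 N c K' V" and eq: "\<And>g i y. g \<in> c \<Longrightarrow> y \<in> cdom N i \<Longrightarrow> \<Psi> g i y = \<Phi> g i y"
    and K': "\<And>g i y a s. g \<in> c \<Longrightarrow> y \<in> cdom N i \<Longrightarrow> \<Phi> g i y $ a $ s \<in> K"
  shows "\<Psi> \<in> wforms1 N c K V"
  unfolding wforms1_def weighted_def forms1_def is_section_def mem_Collect_eq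
proof (intro conjI ballI allI impI)
  note w = \<Phi>[unfolded wforms1_def weighted_def]
  fix g assume g: "g \<in> c"
  note s = sectionD[OF wforms1D[OF \<Phi> g]]
  show "smooth_on (cdom N i) (\<Psi> g i)" for i
    by (rule smooth_on_cong[OF open_cdom _ s(1)]) (simp add: eq g)
  show "\<Psi> g i (crd N i p) = act1 (jac N i j p) (trans V i j p) (\<Psi> g j (crd N j p))" if "p \<in> dom N i \<inter> dom N j" for i j p
    using that eq[OF g] s(2)[of p i j] by simp
  show "\<Psi> g i y $ a $ s \<in> K" if "y \<in> cdom N i" for i y a s
    using K'[OF g that] eq[OF g that] by simp
  fix h \<omega> i p assume h: "h \<in> c" "rescaling N \<omega> g h" "p \<in> dom N i"
  then show "\<Psi> h i (crd N i p) = \<omega> p powi - 2 *\<^sub>R \<Psi> g i (crd N i p)"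
    using w g eq[OF g] eq[OF h(1)] by simp
qed

lemma scalars_pm_scaleR: "z \<in> scalars_pm q K \<Longrightarrow> t *\<^sub>R z \<in> scalars_pm q K"
  using scalar_field_closed(8)[OF K] by (auto simp: scalars_pm_def)

lemma half_op_wforms1:
  assumes fap: "formal_adjoint_d_pm N q c K \<sigma> V vol \<delta>" and \<phi>: "\<phi> \<in> forms1 N K V" and \<sigma>: "\<sigma> \<in> {1, -1}"
  shows "half_op q c \<sigma> V \<delta> \<phi> \<in> wforms1 N c (scalars_pm q K) V"
proof -
  have D: "\<delta> (d_pm q c \<sigma> V \<phi>) \<in> wforms1 N c (scalars_pm q K) V"
    using fap d_pm_forms[OF \<phi> \<sigma>] unfolding formal_adjoint_d_pm_def by blast
  show ?thesis
    unfolding wforms1_def weighted_def forms1_def is_section_def mem_Collect_eq half_op_def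
  proof (intro conjI ballI allI impI)
    fix g assume g: "g \<in> c"
    note s = sectionD[OF wforms1D[OF D g]]
    show "smooth_on (cdom N i) (\<lambda>y. 2 *\<^sub>R \<delta> (d_pm q c \<sigma> V \<phi>) g i y)" for i
      by (intro smooth_on_scaleR smooth_on_const open_cdom s(1))
    show "2 *\<^sub>R \<delta> (d_pm q c \<sigma> V \<phi>) g i (crd N i p) = act1 (jac N i j p) (trans V i j p) (2 *\<^sub>R \<delta> (d_pm q c \<sigma> V \<phi>) g j (crd N j p))"
      if "p \<in> dom N i \<inter> dom N j" for i j p
      using that s(2)[of p i j] by (simp add: act1.act_scaleR)
    show "(2 *\<^sub>R \<delta> (d_pm q c \<sigma> V \<phi>) g i y) $ a $ s \<in> scalars_pm q K" if "y \<in> cdom N i" for i y a s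
      using scalars_pm_scaleR[OF wforms1_K[OF D g that], of 2] by simp
    fix h \<omega> i p assume h: "h \<in> c" "rescaling N \<omega> g h" "p \<in> dom N i"
    then have "\<delta> (d_pm q c \<sigma> V \<phi>) h i (crd N i p) = \<omega> p powi - 2 *\<^sub>R \<delta> (d_pm q c \<sigma> V \<phi>) g i (crd N i p)"
      using D[unfolded wforms1_def weighted_def] g by blast
    then show "2 *\<^sub>R \<delta> (d_pm q c \<sigma> V \<phi>) h i (crd N i p) = \<omega> p powi - 2 *\<^sub>R 2 *\<^sub>R \<delta> (d_pm q c \<sigma> V \<phi>) g i (crd N i p)"
      by simp
  qed
qed

lemma yang_mills_op_K:
  assumes fa1: "formal_adjoint_d1 N c K V vol \<delta>1" and \<phi>: "\<phi> \<in> forms1 N K V" and g: "g \<in> c" and y: "y \<in> cdom N i"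
  shows "yang_mills_op V \<delta>1 \<phi> g i y $ a $ s \<in> K"
proof -
  have "\<delta>1 (\<lambda>_. d1 V \<phi>) \<in> wforms1 N c K V"
    using fa1 wforms2_const[OF d1_forms2[OF \<phi>]] unfolding formal_adjoint_d1_def by blast
  then have "\<delta>1 (\<lambda>_. d1 V \<phi>) g i y $ a $ s \<in> K" by (rule wforms1_K[OF _ g y])
  moreover have "curv_dot V \<phi> g i y $ a $ s \<in> K"
    using curvature_K[OF y] form1D(2)[OF \<phi> y]
    by (auto simp: curv_dot_def matrix_vector_mult_def intro!: scalar_field_closed[OF K])
  ultimately show ?thesis by (simp add: yang_mills_op_def scalar_field_closed(2)[OF K])
qed

text \<open>
  The argument \<open>d\<^sub>\<sigma> d\<^sup>D f\<close> of the adjoint vanishes by \<open>d_pm_d0_zero\<close>, hence so does every integral that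
  tests its image.
\<close>

lemma half_op_d0:
  assumes F: "curvature_pm_zero N q c \<sigma> V" and \<sigma>: "\<sigma> \<in> {1, -1}"
    and fap: "formal_adjoint_d_pm N q c K \<sigma> V vol \<delta>"
    and f: "f \<in> forms0 N K V" and g: "g \<in> c" and x: "x \<in> cdom N i"
  shows "half_op q c \<sigma> V \<delta> (d0 V f) g i x = 0"
proof -
  interpret d: conformal_bundle N K "dual V" q c vol by (rule conformal_bundle_dual)
  let ?H = "\<delta> (d_pm q c \<sigma> V (d0 V f))"
  note \<phi> = d0_forms1[OF f]
  have "?H \<in> wforms1 N c (scalars_pm q K) V"
    using fap d_pm_forms[OF \<phi> \<sigma>] unfolding formal_adjoint_d_pm_def by blast
  then have sH: "smooth_on (cdom N i) (?H g i)" using sectionD(1)[OF wforms1D[OF _ g]] by blast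
  have "?H g i x = 0"
  proof (rule one_form_eq_zero[OF g x sH])
    fix r b and s :: 'r and \<psi> assume r: "r > 0" "cball x r \<subseteq> cdom N i"
      and \<psi>: "\<psi> = d.bump_section act1 i x r (axis b (axis s 1))"
    have f\<psi>: "\<psi> \<in> forms1 N K (dual V)" unfolding \<psi> by (rule d.bump_section_form1[OF r])
    note bs = d.is_section_bump_section[OF act1.fibre_action_axioms r, where v = "axis b (axis s 1)", folded \<psi>]
    have "chart_int g i (\<lambda>y. pair1 (g i y) (?H g i y) (\<psi> i y))
      = chart_int g i (\<lambda>y. pair2 (g i y) (d_pm q c \<sigma> V (d0 V f) i y) (d_pm q c \<sigma> (dual V) \<psi> i y))"
      by (rule adjoint_d_pm_chart[OF fap \<phi> g \<sigma> f\<psi> bs(2,3)])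
    also have "\<dots> = chart_int g i (\<lambda>_. 0)"
      by (rule chart_int_cong) (simp add: d_pm_d0_zero[OF F f _ \<sigma>] pair2_zero)
    also have "\<dots> = 0" by (simp add: chart_int_def)
    finally show "chart_int g i (\<lambda>y. pair1 (g i y) (?H g i y) (\<psi> i y)) = 0" .
  qed
  then show ?thesis by (simp add: half_op_def)
qed

text \<open>
  Testing against \<open>\<psi>\<close> gives the pairing of \<open>d\<^sub>\<sigma> \<phi>\<close> with \<open>d\<^sub>\<sigma> d\<^sup>D \<psi>\<close>, which vanishes because the curvature
  of the dual bundle has no \<open>\<sigma>\<close>-part either.
\<close>

lemma delta0_half_op:
  assumes F: "curvature_pm_zero N q c \<sigma> V" and \<sigma>: "\<sigma> \<in> {1, -1}"
    and fa0: "formal_adjoint_d0 N c K V vol \<delta>0" and fap: "formal_adjoint_d_pm N q c K \<sigma> V vol \<delta>"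
    and \<phi>: "\<phi> \<in> forms1 N K V" and \<Phi>: "\<Phi> \<in> wforms1 N c K V"
    and eq: "\<And>g i y. g \<in> c \<Longrightarrow> y \<in> cdom N i \<Longrightarrow> \<Phi> g i y = half_op q c \<sigma> V \<delta> \<phi> g i y"
    and g: "g \<in> c" and x: "x \<in> cdom N i"
  shows "\<delta>0 \<Phi> g i x = 0"
proof -
  interpret d: conformal_bundle N K "dual V" q c vol by (rule conformal_bundle_dual)
  have W: "\<delta>0 \<Phi> \<in> wforms0 N c K V" using fa0 \<Phi> by (simp add: formal_adjoint_d0_def)
  then have s0: "is_section N V act0 (\<delta>0 \<Phi> g)" using g by (simp add: wforms0_def weighted_def forms0_def)
  have "\<delta>0 \<Phi> g i x $ s = 0" for s
  proof (rule chart_int_bump_zero[OF g x, of "\<lambda>y. \<delta>0 \<Phi> g i y $ s"])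
    show "continuous_on (cdom N i) (\<lambda>y. \<delta>0 \<Phi> g i y $ s)"
      by (rule smooth_on_continuous[OF smooth_on_vec_nth[OF open_cdom sectionD(1)[OF s0]]])
    fix r :: real assume r: "r > 0" "cball x r \<subseteq> cdom N i"
    define \<psi> where "\<psi> = d.bump_section act0 i x r (axis s 1)"
    have f\<psi>: "\<psi> \<in> forms0 N K (dual V)" unfolding \<psi>_def by (rule d.bump_section_form0[OF r])
    note bs = d.is_section_bump_section[OF act0.fibre_action_axioms r, where v = "axis s 1", folded \<psi>_def]
    note d\<psi> = d.d0_forms1[OF f\<psi>] and cd\<psi> = compact_support_d0[OF bs(2), of "dual V"]
    have dp: "dualpair v (t *\<^sub>R axis s 1) = of_real t * v $ s" for v :: "complex^'r" and t
      by (simp add: dualpair_def axis_def scaleR_complex if_distrib cong: if_cong)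
    have "chart_int g i (\<lambda>y. of_real (bump x r y) * \<delta>0 \<Phi> g i y $ s)
      = chart_int g i (\<lambda>y. dualpair (\<delta>0 \<Phi> g i y) (\<psi> i y))"
      by (rule chart_int_cong)
        (simp add: \<psi>_def d.bump_section_own_chart[OF act0.fibre_action_axioms] dp)
    also have "\<dots> = mfd_integral N (vol g) (\<lambda>i y. dualpair (\<delta>0 \<Phi> g i y) (\<psi> i y))"
      by (rule integral_dualpair_chart[OF g s0 bs(1), symmetric]) (simp add: \<psi>_def d.bump_section_outside)
    also have "\<dots> = mfd_integral N (vol g) (\<lambda>i y. pair1 (g i y) (\<Phi> g i y) (d0 (dual V) \<psi> i y))"
      using fa0 \<Phi> f\<psi> bs(2) g by (simp add: formal_adjoint_d0_def)
    also have "\<dots> = mfd_integral N (vol g) (\<lambda>i y. 2 * pair1 (g i y) (\<delta> (d_pm q c \<sigma> V \<phi>) g i y) (d0 (dual V) \<psi> i y))"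
      by (rule mfd_integral_cong[OF vol[OF g]]) (simp add: eq[OF g] half_op_def pair1_linear)
    also have "\<dots> = 2 * mfd_integral N (vol g) (\<lambda>i y. pair1 (g i y) (\<delta> (d_pm q c \<sigma> V \<phi>) g i y) (d0 (dual V) \<psi> i y))"
      by (simp add: mfd_integral_def Let_def)
    also have "mfd_integral N (vol g) (\<lambda>i y. pair1 (g i y) (\<delta> (d_pm q c \<sigma> V \<phi>) g i y) (d0 (dual V) \<psi> i y))
      = mfd_integral N (vol g) (\<lambda>i y. pair2 (g i y) (d_pm q c \<sigma> V \<phi> i y) (d_pm q c \<sigma> (dual V) (d0 (dual V) \<psi>) i y))"
      by (rule fap[unfolded formal_adjoint_d_pm_def, THEN bspec, OF d_pm_forms[OF \<phi> \<sigma>], THEN conjunct2,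
          THEN bspec, OF d\<psi>, THEN mp, OF cd\<psi>, THEN bspec, OF g])
    also have "\<dots> = mfd_integral N (vol g) (\<lambda>_ _. 0)"
      by (rule mfd_integral_cong[OF vol[OF g]])
        (simp add: d.d_pm_d0_zero[OF curvature_pm_zero_dual[OF F \<sigma>] f\<psi> _ \<sigma>] pair2_zero)
    finally show "chart_int g i (\<lambda>y. of_real (bump x r y) * \<delta>0 \<Phi> g i y $ s) = 0"
      by (simp add: mfd_integral_def)
  qed
  then show ?thesis by (simp add: vec_eq_iff)
qed

text \<open>
  The equality of the operators transfers the vanishing compositions from \<open>2 \<delta>\<^sub>\<sigma> d\<^sub>\<sigma>\<close> to \<open>M\<^sup>D\<close>, and the
  set of scalars from \<open>M\<^sup>D\<close> to \<open>2 \<delta>\<^sub>\<sigma> d\<^sub>\<sigma>\<close>.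
\<close>

theorem half_flat_detour:
  assumes F: "curvature_pm_zero N q c \<sigma> V" and \<sigma>: "\<sigma> \<in> {1, -1}"
    and fa0: "formal_adjoint_d0 N c K V vol \<delta>0" and fa1: "formal_adjoint_d1 N c K V vol \<delta>1"
    and fap: "formal_adjoint_d_pm N q c K \<sigma> V vol \<delta>"
  shows "detour_complex N c K V (d0 V) (half_op q c \<sigma> V \<delta>) \<delta>0 \<and>
    detour_complex N c K V (d0 V) (yang_mills_op V \<delta>1) \<delta>0 \<and>
    (\<forall>\<phi> \<in> forms1 N K V. wequal N c (yang_mills_op V \<delta>1 \<phi>) (half_op q c \<sigma> V \<delta> \<phi>))"
proof -
  note eq = yang_mills_eq_half_op[OF F \<sigma> fa1 fap]
  have K': "half_op q c \<sigma> V \<delta> \<phi> g i y $ a $ s \<in> K" if "\<phi> \<in> forms1 N K V" "g \<in> c" "y \<in> cdom N i" for \<phi> g i y a s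
    using yang_mills_op_K[OF fa1 that] eq[OF that] by simp
  have h: "half_op q c \<sigma> V \<delta> \<phi> \<in> wforms1 N c K V" if "\<phi> \<in> forms1 N K V" for \<phi>
    by (rule wforms1_cong[OF half_op_wforms1[OF fap that \<sigma>]]) (use K'[OF that] in auto)
  have ym: "yang_mills_op V \<delta>1 \<phi> \<in> wforms1 N c K V" if "\<phi> \<in> forms1 N K V" for \<phi>
    by (rule wforms1_cong[OF h[OF that] eq[OF that]]) (use K'[OF that] in auto)
  have "detour_complex N c K V (d0 V) Q \<delta>0"
    if Q: "\<And>\<phi>. \<phi> \<in> forms1 N K V \<Longrightarrow> Q \<phi> \<in> wforms1 N c K V"
      and Qeq: "\<And>\<phi> g i y. \<phi> \<in> forms1 N K V \<Longrightarrow> g \<in> c \<Longrightarrow> y \<in> cdom N i \<Longrightarrow> Q \<phi> g i y = half_op q c \<sigma> V \<delta> \<phi> g i y"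
    for Q
    unfolding detour_complex_def wequal_def
  proof (intro conjI ballI allI)
    fix f assume f: "f \<in> forms0 N K V"
    show "d0 V f \<in> forms1 N K V" by (rule d0_forms1[OF f])
    show "Q (d0 V f) g i y = 0" if "g \<in> c" "y \<in> cdom N i" for g i y
      using Qeq[OF d0_forms1[OF f] that] half_op_d0[OF F \<sigma> fap f that] by simp
  next
    fix \<phi> assume \<phi>: "\<phi> \<in> forms1 N K V"
    show "Q \<phi> \<in> wforms1 N c K V" by (rule Q[OF \<phi>])
    show "\<delta>0 (Q \<phi>) g i y = 0" if "g \<in> c" "y \<in> cdom N i" for g i y
      by (rule delta0_half_op[OF F \<sigma> fa0 fap \<phi> Q[OF \<phi>] Qeq[OF \<phi>] that])
  next
    fix \<Phi> assume "\<Phi> \<in> wforms1 N c K V"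
    then show "\<delta>0 \<Phi> \<in> wforms0 N c K V" using fa0 by (simp add: formal_adjoint_d0_def)
  qed
  from this[OF h] this[OF ym eq] show ?thesis using eq by (simp add: wequal_def)
qed

end

theorem proposition3p6:
  fixes N :: "('m, 'i) mfd" and V :: "('m, 'i, 'r::finite) vbundle"
    and K :: "complex set" and q :: nat and c :: "'i metric set"
    and vol :: "'i metric \<Rightarrow> 'm measure"
    and \<delta>0 :: "('i metric \<Rightarrow> ('i, 'r) form1) \<Rightarrow> 'i metric \<Rightarrow> ('i, 'r) form0"
    and \<delta>1 :: "('i metric \<Rightarrow> ('i, 'r) form2) \<Rightarrow> 'i metric \<Rightarrow> ('i, 'r) form1"
    and \<delta>p \<delta>m :: "('i, 'r) form2 \<Rightarrow> 'i metric \<Rightarrow> ('i, 'r) form1"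
  assumes "oriented_manifold N"
    and "conformal_class N q c"
    and "K = \<real> \<or> K = UNIV"
    and "bundle_with_connection N K V"
    and "\<And>g. g \<in> c \<Longrightarrow> volume_measure N g (vol g)"
    and "formal_adjoint_d0 N c K V vol \<delta>0"
    and "formal_adjoint_d1 N c K V vol \<delta>1"
    and "formal_adjoint_d_pm N q c K 1 V vol \<delta>p"
    and "formal_adjoint_d_pm N q c K (-1) V vol \<delta>m"
  shows "(curvature_pm_zero N q c 1 V \<longrightarrow>
            detour_complex N c K V (d0 V) (half_op q c 1 V \<delta>p) \<delta>0 \<and>
            detour_complex N c K V (d0 V) (yang_mills_op V \<delta>1) \<delta>0 \<and>
            (\<forall>\<phi> \<in> forms1 N K V. wequal N c (yang_mills_op V \<delta>1 \<phi>) (half_op q c 1 V \<delta>p \<phi>))) \<and>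
         (curvature_pm_zero N q c (-1) V \<longrightarrow>
            detour_complex N c K V (d0 V) (half_op q c (-1) V \<delta>m) \<delta>0 \<and>
            detour_complex N c K V (d0 V) (yang_mills_op V \<delta>1) \<delta>0 \<and>
            (\<forall>\<phi> \<in> forms1 N K V. wequal N c (yang_mills_op V \<delta>1 \<phi>) (half_op q c (-1) V \<delta>m \<phi>)))"
proof -
  interpret conformal_bundle N K V q c vol
  proof
    show "oriented_manifold N" by fact
    show "scalar_field K" using assms(3) by (simp add: scalar_field_def)
  qed (use assms in auto)
  show ?thesis using half_flat_detour assms(6-9) by simp
qed

end
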